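(* Let $M$ be an $n$-dimensional manifold, $E$ an $(n+m)$-dimensional manifold ($n,m\ge1$), $\Gamma$ and $\Theta$ torsion-free linear connections on $TE\to E$ and $TM\to M$. The connection $\dot\Gamma$ on $\pi_{1,0}\colon J^1(E,n)\to E$ is the quotient connection of $\dot\Gamma_{\mathrm{pr}_M}$ via $\mathrm{pr}_E^{(1)}$. More precisely, on $T(\mathrm{Imm}\,J^1\mathrm{pr}_M)$ one has $$T\mathrm{pr}_E^{(1)}\circ\upsilon_{\dot\Gamma_{\mathrm{pr}_M}}=\upsilon_{\dot\Gamma}\circ T\mathrm{pr}_E^{(1)},$$ where $\upsilon_{\dot\Gamma_{\mathrm{pr}_M}}$ takes values in $\ker T\mathrm{pr}_{M\,1,0}$ and $\upsilon_{\dot\Gamma}\colon TJ^1(E,n)\to\ker T\pi_{1,0}$.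
   Context: $J^1(E,n)$ is the Grassmann bundle of $n$-dimensional subspaces of $TE$, $\pi_{1,0}$ its projection to $E$, with coordinates $(u^\lambda,u^i,u^i_\lambda)$ ($1\le\lambda\le n<i\le n+m$) at the plane spanned by $\partial_{u^\lambda}+u^j_\lambda\partial_{u^j}$; capital indices run in $1..n+m$. $J^1\mathrm{pr}_M$ is the bundle of 1-jets $[s]^1_x$ of local maps $s\colon M\to E$, with coordinates $(x^\lambda,u^A,u^A_{x^\lambda})$ and projection $\mathrm{pr}_{M\,1,0}\colon J^1\mathrm{pr}_M\to M\times E$; $\mathrm{Imm}\,J^1\mathrm{pr}_M$ is the open subset of 1-jets of immersions. $\mathrm{pr}_E^{(1)}\colon\mathrm{Imm}\,J^1\mathrm{pr}_M\to J^1(E,n)$ sends $[s]^1_x$ to the plane $\mathrm{im}\,T_xs\subset T_{s(x)}E$. For a connection on a bundle, $\upsilon$ denotes its vertical projection onto the vertical bundle. $\Gamma_A{}^C{}_B$ are the Christoffel symbols of $\Gamma$ ($\nabla_{\partial_A}\partial_B=\Gamma_A{}^C{}_B\partial_C$). The connection $\dot\Gamma$ on $\pi_{1,0}$ has vertical projection $$\upsilon_{\dot\Gamma}=(du^k_\xi+\dot\Gamma_A{}^k{}_\xi\,du^A)\otimes\partial_{u^k_\xi},\qquad\dot\Gamma_A{}^k{}_\xi=\Gamma_A{}^k{}_\xi+\Gamma_A{}^k{}_iu^i_\xi-u^k_\beta(\Gamma_A{}^\beta{}_\xi+\Gamma_A{}^\beta{}_iu^i_\xi).$$ The connection $\dot\Gamma_{\mathrm{pr}_M}=\mathrm{pr}_E^*(\Gamma)\otimes\mathrm{pr}_M^*(\Theta^*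 )$ on $J^1\mathrm{pr}_M\simeq\mathrm{pr}_E^*(TE)\otimes\mathrm{pr}_M^*(T^*M)\to M\times E$, with $\Theta^*$ the dual of $\Theta$ and $\mathrm{pr}_E\colon M\times E\to E$, $\mathrm{pr}_M\colon M\times E\to M$ the projections, is, as a tangent-valued form, $$\dot\Gamma_{\mathrm{pr}_M}=dx^\lambda\otimes\big(\partial_{x^\lambda}+\Theta_\lambda{}^\xi{}_\eta u^A_{x^\xi}\partial_{u^A_{x^\eta}}\big)+du^B\otimes\big(\partial_{u^B}-\Gamma_B{}^C{}_Au^A_{x^\xi}\partial_{u^C_{x^\xi}}\big).$$ *)

theory Defs
  imports "HOL-Analysis.Analysis" "HOL-Library.Function_Algebras"
begin

text \<open>Functions form a real vector space pointwise; together with \<open>Function_Algebras\<close> this makes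
  \<open>subspace\<close>, \<open>span\<close> and \<open>dim\<close> available for the tangent spaces below.\<close>

instantiation "fun" :: (type, real_vector) real_vector
begin

definition scaleR_fun :: "real \<Rightarrow> ('a \<Rightarrow> 'b) \<Rightarrow> 'a \<Rightarrow> 'b"
  where "scaleR_fun r f = (\<lambda>x. r *\<^sub>R f x)"

instance
  by standard (auto simp: scaleR_fun_def plus_fun_def scaleR_add_right scaleR_add_left)

end

text \<open>\<open>Ck_on k f S\<close> is meant for open \<open>S\<close>.\<close>

primrec Ck_on ::
  "nat \<Rightarrow> ('a::euclidean_space \<Rightarrow> 'b::euclidean_space) \<Rightarrow> 'a set \<Rightarrow> bool"
where
  "Ck_on 0 f S \<longleftrightarrow> continuous_on S f"
| "Ck_on (Suc k) f S \<longleftrightarrow>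
     (\<forall>x\<in>S. f differentiable (at x)) \<and>
     (\<forall>v. Ck_on k (\<lambda>x. frechet_derivative f (at x) v) S)"

definition smooth_on :: "'a::euclidean_space set \<Rightarrow> ('a \<Rightarrow> 'b::euclidean_space) \<Rightarrow> bool"
  where "smooth_on S f \<longleftrightarrow> (\<forall>k. Ck_on k f S)"

text \<open>A chart is its domain together with its coordinate map; the coordinate map is a total
  function whose values outside the domain carry no information.\<close>

type_synonym ('p, 'a) chart = "'p set \<times> ('p \<Rightarrow> 'a)"

definition chart_inv :: "('p, 'a) chart \<Rightarrow> 'a \<Rightarrow> 'p"
  where "chart_inv c = inv_into (fst c) (snd c)"

definition transition :: "('p, 'a) chart \<Rightarrow> ('p, 'a) chart \<Rightarrow> 'a \<Rightarrow> 'a"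
  where "transition c c' = snd c' \<circ> chart_inv c"

definition points :: "('p, 'a) chart set \<Rightarrow> 'p set"
  where "points A = \<Union> (fst ` A)"

definition smooth_atlas :: "('p, 'a::euclidean_space) chart set \<Rightarrow> bool"
  where "smooth_atlas A \<longleftrightarrow>
    (\<forall>c\<in>A. inj_on (snd c) (fst c)) \<and>
    (\<forall>c\<in>A. \<forall>c'\<in>A. open (snd c ` (fst c \<inter> fst c')) \<and>
       smooth_on (snd c ` (fst c \<inter> fst c')) (transition c c'))"

definition manifold_topology :: "('p, 'a::euclidean_space) chart set \<Rightarrow> 'p topology"
  where "manifold_topology A =
    topology (\<lambda>U. U \<subseteq> points A \<and> (\<forall>c\<in>A. open (snd c ` (U \<inter> fst c))))"

text \<open>A smooth manifold is given by its maximal atlas; its underlying set is \<open>points A\<close> and its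
  dimension is that of the coordinate space.\<close>

definition smooth_manifold :: "('p, 'a::euclidean_space) chart set \<Rightarrow> bool"
  where "smooth_manifold A \<longleftrightarrow>
    smooth_atlas A \<and> (\<forall>c. smooth_atlas (insert c A) \<longrightarrow> c \<in> A) \<and>
    Hausdorff_space (manifold_topology A) \<and> second_countable (manifold_topology A)"

text \<open>A tangent vector at \<open>p\<close> is the family of its components in all charts around \<open>p\<close>, related by
  the derivatives of the transition maps. As a function on charts it is set to \<open>0\<close> at every pair
  that is not a chart of \<open>A\<close> around \<open>p\<close>, so that equality of functions is equality of vectors.\<close>

type_synonym ('p, 'a) tvec = "('p, 'a) chart \<Rightarrow> 'a"

definition tangent_space ::
  "('p, 'a::euclidean_space) chart set \<Rightarrow> 'p \<Rightarrow> ('p, 'a) tvec set"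
  where "tangent_space A p =
    {v. (\<forall>c\<in>A. \<forall>c'\<in>A. p \<in> fst c \<inter> fst c' \<longrightarrow>
           v c' = frechet_derivative (transition c c') (at (snd c p)) (v c)) \<and>
        (\<forall>c. \<not> (c \<in> A \<and> p \<in> fst c) \<longrightarrow> v c = 0)}"

definition tangent_bundle ::
  "('p, 'a::euclidean_space) chart set \<Rightarrow> ('p \<times> ('p, 'a) tvec) set"
  where "tangent_bundle A = {(p, v). p \<in> points A \<and> v \<in> tangent_space A p}"

definition chart_at :: "('p, 'a) chart set \<Rightarrow> 'p \<Rightarrow> ('p, 'a) chart"
  where "chart_at A p = (SOME c. c \<in> A \<and> p \<in> fst c)"

text \<open>For \<open>f\<close> defined and smooth near \<open>p\<close> the chart chosen at \<open>p\<close> is immaterial.\<close>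

definition tangent_map ::
  "('p, 'a::euclidean_space) chart set \<Rightarrow> ('q, 'b::euclidean_space) chart set \<Rightarrow>
   ('p \<Rightarrow> 'q) \<Rightarrow> 'p \<times> ('p, 'a) tvec \<Rightarrow> 'q \<times> ('q, 'b) tvec"
  where "tangent_map A B f = (\<lambda>(p, v).
    (f p, \<lambda>d. if d \<in> B \<and> f p \<in> fst d
              then frechet_derivative (snd d \<circ> f \<circ> chart_inv (chart_at A p))
                     (at (snd (chart_at A p) p)) (v (chart_at A p))
              else 0))"

definition vertical_bundle ::
  "('p, 'a::euclidean_space) chart set \<Rightarrow> ('q, 'b::euclidean_space) chart set \<Rightarrow>
   ('p \<Rightarrow> 'q) \<Rightarrow> ('p \<times> ('p, 'a) tvec) set"
  where "vertical_bundle A B f = {(p, v) \<in> tangent_bundle A. tangent_map A B f (p, v) = (f p, 0)}"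

text \<open>The tangent vector at \<open>p\<close> with components \<open>w\<close> in the chart \<open>c\<close>.\<close>

definition tangent_of_coords ::
  "('p, 'a::euclidean_space) chart set \<Rightarrow> ('p, 'a) chart \<Rightarrow> 'p \<Rightarrow> 'a \<Rightarrow> ('p, 'a) tvec"
  where "tangent_of_coords A c p w =
    (\<lambda>c'. if c' \<in> A \<and> p \<in> fst c'
          then frechet_derivative (transition c c') (at (snd c p)) w else 0)"

text \<open>\<open>smooth_at A B s p\<close>: the map \<open>s\<close> is smooth on some neighbourhood of \<open>p\<close> (for maximal atlases,
  domains of charts around \<open>p\<close> form a neighbourhood basis). A local map near \<open>p\<close> is represented by
  a total function with this property.\<close>

definition smooth_at ::
  "('p, 'a::euclidean_space) chart set \<Rightarrow> ('q, 'b::euclidean_space) chart set \<Rightarrow>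
   ('p \<Rightarrow> 'q) \<Rightarrow> 'p \<Rightarrow> bool"
  where "smooth_at A B s p \<longleftrightarrow>
    (\<exists>c\<in>A. \<exists>d\<in>B. p \<in> fst c \<and> s ` fst c \<subseteq> fst d \<and>
       smooth_on (snd c ` fst c) (snd d \<circ> s \<circ> chart_inv c))"

definition prod_atlas ::
  "('p, 'a) chart set \<Rightarrow> ('q, 'b) chart set \<Rightarrow> ('p \<times> 'q, 'a \<times> 'b) chart set"
  where "prod_atlas A B =
    {(fst c \<times> fst d, \<lambda>(x, y). (snd c x, snd d y)) | c d. c \<in> A \<and> d \<in> B}"

definition smooth_functions ::
  "('p, 'a::euclidean_space) chart set \<Rightarrow> 'p set \<Rightarrow> ('p \<Rightarrow> real) set"
  where "smooth_functions A U = {f. \<forall>p\<in>U. smooth_at A {(UNIV, \<lambda>t. t)} f p}"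

definition vector_fields ::
  "('p, 'a::euclidean_space) chart set \<Rightarrow> 'p set \<Rightarrow> ('p \<Rightarrow> ('p, 'a) tvec) set"
  where "vector_fields A U =
    {Y. (\<forall>p\<in>U. Y p \<in> tangent_space A p) \<and>
        (\<forall>c\<in>A. fst c \<subseteq> U \<longrightarrow> smooth_on (snd c ` fst c) (\<lambda>z. Y (chart_inv c z) c))}"

definition dir_deriv ::
  "('p, 'a::euclidean_space) chart set \<Rightarrow> ('p \<Rightarrow> real) \<Rightarrow> 'p \<Rightarrow> ('p, 'a) tvec \<Rightarrow> real"
  where "dir_deriv A f p v =
    frechet_derivative (f \<circ> chart_inv (chart_at A p)) (at (snd (chart_at A p) p)) (v (chart_at A p))"

text \<open>A linear connection as a covariant derivative on local vector fields: \<open>D p v Y\<close> is the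
  derivative at \<open>p\<close> in the direction \<open>v\<close> of the vector field \<open>Y\<close> defined near \<open>p\<close>. Since local
  fields are represented by total functions, independence of the values off \<open>U\<close> is required.\<close>

type_synonym ('p, 'a) cov_deriv =
  "'p \<Rightarrow> ('p, 'a) tvec \<Rightarrow> ('p \<Rightarrow> ('p, 'a) tvec) \<Rightarrow> ('p, 'a) tvec"

definition linear_connection ::
  "('p, 'a::euclidean_space) chart set \<Rightarrow> ('p, 'a) cov_deriv \<Rightarrow> bool"
  where "linear_connection A D \<longleftrightarrow>
    (\<forall>U. openin (manifold_topology A) U \<longrightarrow>
      (\<forall>Y\<in>vector_fields A U. \<forall>p\<in>U.
        (\<forall>v\<in>tangent_space A p. D p v Y \<in> tangent_space A p) \<and>
        (\<forall>v\<in>tangent_space A p. \<forall>w\<in>tangent_space A p. D p (v + w) Y = D p v Y + D p w Y) \<and>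
        (\<forall>r. \<forall>v\<in>tangent_space A p. D p (r *\<^sub>R v) Y = r *\<^sub>R D p v Y) \<and>
        (\<forall>v\<in>tangent_space A p. \<forall>Z\<in>vector_fields A U. D p v (Y + Z) = D p v Y + D p v Z) \<and>
        (\<forall>v\<in>tangent_space A p. \<forall>f\<in>smooth_functions A U.
           D p v (\<lambda>q. f q *\<^sub>R Y q) = dir_deriv A f p v *\<^sub>R Y p + f p *\<^sub>R D p v Y) \<and>
        (\<forall>v\<in>tangent_space A p. \<forall>Z\<in>vector_fields A U.
           (\<forall>q\<in>U. Y q = Z q) \<longrightarrow> D p v Y = D p v Z)) \<and>
      (\<forall>X\<in>vector_fields A U. \<forall>Y\<in>vector_fields A U.
        (\<lambda>p. D p (X p) Y) \<in> vector_fields A U))"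

text \<open>The torsion \<open>D\<^sub>X Y - D\<^sub>Y X - [X, Y]\<close> vanishes; vector fields are tested on smooth functions,
  on which the bracket acts as the commutator of derivations.\<close>

definition torsion_free ::
  "('p, 'a::euclidean_space) chart set \<Rightarrow> ('p, 'a) cov_deriv \<Rightarrow> bool"
  where "torsion_free A D \<longleftrightarrow>
    (\<forall>U. openin (manifold_topology A) U \<longrightarrow>
      (\<forall>X\<in>vector_fields A U. \<forall>Y\<in>vector_fields A U. \<forall>f\<in>smooth_functions A U. \<forall>p\<in>U.
        dir_deriv A f p (D p (X p) Y - D p (Y p) X) =
          dir_deriv A (\<lambda>q. dir_deriv A f q (Y q)) p (X p) -
          dir_deriv A (\<lambda>q. dir_deriv A f q (X q)) p (Y p)))"

definition coord_field ::
  "('p, real^'k) chart set \<Rightarrow> ('p, real^'k) chart \<Rightarrow> 'k \<Rightarrow> 'p \<Rightarrow> ('p, real^'k) tvec"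
  where "coord_field A c b = (\<lambda>p. tangent_of_coords A c p (axis b 1))"

text \<open>\<open>christoffel A D c p a k b\<close> is the \<open>k\<close>-th component of the derivative of \<open>\<partial>\<^sub>b\<close> in the direction
  \<open>\<partial>\<^sub>a\<close>: the direction is the first index, the upper index is in the middle.\<close>

definition christoffel ::
  "('p, real^'k) chart set \<Rightarrow> ('p, real^'k) cov_deriv \<Rightarrow> ('p, real^'k) chart \<Rightarrow>
   'p \<Rightarrow> 'k \<Rightarrow> 'k \<Rightarrow> 'k \<Rightarrow> real"
  where "christoffel A D c p a k b = D p (coord_field A c a p) (coord_field A c b) c $ k"

definition grassmann_bundle ::
  "nat \<Rightarrow> ('p, 'a::euclidean_space) chart set \<Rightarrow> ('p \<times> ('p, 'a) tvec set) set"
  where "grassmann_bundle n A =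
    {(p, W). p \<in> points A \<and> W \<subseteq> tangent_space A p \<and> subspace W \<and> dim W = n}"

text \<open>Coordinates on a manifold of dimension \<open>n + m\<close> are indexed by \<open>'n + 'm\<close>: the first \<open>n\<close> indices
  are \<open>Inl \<lambda>\<close>, the last \<open>m\<close> indices are \<open>Inr i\<close>. The coordinate \<open>u\<^sup>i\<^sub>\<lambda>\<close> is the entry \<open>u $ i $ \<lambda>\<close>.\<close>

definition coord_plane ::
  "('q, real^('n::finite + 'm::finite)) chart set \<Rightarrow> ('q, real^('n + 'm)) chart \<Rightarrow> 'q \<Rightarrow>
   real^'n^'m \<Rightarrow> ('q, real^('n + 'm)) tvec set"
  where "coord_plane E d y u =
    span (range (\<lambda>l. coord_field E d (Inl l) y +
                     (\<Sum>j\<in>UNIV. (u $ j $ l) *\<^sub>R coord_field E d (Inr j) y)))"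

definition grassmann_chart ::
  "('q, real^('n::finite + 'm::finite)) chart set \<Rightarrow> ('q, real^('n + 'm)) chart \<Rightarrow>
   ('q \<times> ('q, real^('n + 'm)) tvec set, (real^('n + 'm)) \<times> (real^'n^'m)) chart"
  where "grassmann_chart E d =
    ({(y, W) \<in> grassmann_bundle CARD('n) E. y \<in> fst d \<and> (\<exists>u. W = coord_plane E d y u)},
     \<lambda>(y, W). (snd d y, THE u. W = coord_plane E d y u))"

definition grassmann_atlas ::
  "('q, real^('n::finite + 'm::finite)) chart set \<Rightarrow>
   ('q \<times> ('q, real^('n + 'm)) tvec set, (real^('n + 'm)) \<times> (real^'n^'m)) chart set"
  where "grassmann_atlas E = grassmann_chart E ` E"

text \<open>A 1-jet is its source together with the class of all local maps having the same value and the
  same tangent map at the source.\<close>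

type_synonym ('p, 'q) jet = "'p \<times> ('p \<Rightarrow> 'q) set"

definition jet ::
  "('p, 'a::euclidean_space) chart set \<Rightarrow> ('q, 'b::euclidean_space) chart set \<Rightarrow>
   ('p \<Rightarrow> 'q) \<Rightarrow> 'p \<Rightarrow> ('p, 'q) jet"
  where "jet M E s x =
    (x, {t. smooth_at M E t x \<and> t x = s x \<and>
            (\<forall>v\<in>tangent_space M x. tangent_map M E t (x, v) = tangent_map M E s (x, v))})"

definition jet_bundle ::
  "('p, 'a::euclidean_space) chart set \<Rightarrow> ('q, 'b::euclidean_space) chart set \<Rightarrow> ('p, 'q) jet set"
  where "jet_bundle M E = {jet M E s x | s x. x \<in> points M \<and> smooth_at M E s x}"

definition jet_rep :: "('p, 'q) jet \<Rightarrow> 'p \<Rightarrow> 'q"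
  where "jet_rep j = (SOME s. s \<in> snd j)"

definition jet_target :: "('p, 'q) jet \<Rightarrow> 'q"
  where "jet_target j = jet_rep j (fst j)"

definition jet_proj :: "('p, 'q) jet \<Rightarrow> 'p \<times> 'q"
  where "jet_proj j = (fst j, jet_target j)"

definition jet_map ::
  "('p, 'a::euclidean_space) chart set \<Rightarrow> ('q, 'b::euclidean_space) chart set \<Rightarrow>
   ('p, 'q) jet \<Rightarrow> ('p, 'a) tvec \<Rightarrow> ('q, 'b) tvec"
  where "jet_map M E j v = snd (tangent_map M E (jet_rep j) (fst j, v))"

text \<open>The coordinate \<open>u\<^sup>A\<^sub>x\<^sub>\<lambda>\<close> is the entry \<open>$ A $ \<lambda>\<close>.\<close>

definition jet_coord ::
  "('p, real^'n) chart \<Rightarrow> ('q, real^'k) chart \<Rightarrow> ('p, 'q) jet \<Rightarrow> real^'n^'k"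
  where "jet_coord c d j =
    (\<chi> a l. frechet_derivative (snd d \<circ> jet_rep j \<circ> chart_inv c) (at (snd c (fst j))) (axis l 1) $ a)"

definition jet_chart ::
  "('p, real^'n) chart set \<Rightarrow> ('q, real^'k) chart set \<Rightarrow>
   ('p, real^'n) chart \<Rightarrow> ('q, real^'k) chart \<Rightarrow>
   (('p, 'q) jet, (real^'n) \<times> (real^'k) \<times> (real^'n^'k)) chart"
  where "jet_chart M E c d =
    ({j \<in> jet_bundle M E. fst j \<in> fst c \<and> jet_target j \<in> fst d},
     \<lambda>j. (snd c (fst j), snd d (jet_target j), jet_coord c d j))"

definition jet_atlas ::
  "('p, real^'n) chart set \<Rightarrow> ('q, real^'k) chart set \<Rightarrow>
   (('p, 'q) jet, (real^'n) \<times> (real^'k) \<times> (real^'n^'k)) chart set"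
  where "jet_atlas M E = {jet_chart M E c d | c d. c \<in> M \<and> d \<in> E}"

definition imm_jets ::
  "('p, 'a::euclidean_space) chart set \<Rightarrow> ('q, 'b::euclidean_space) chart set \<Rightarrow> ('p, 'q) jet set"
  where "imm_jets M E = {j \<in> jet_bundle M E. inj_on (jet_map M E j) (tangent_space M (fst j))}"

text \<open>The tangent bundle of the open subset of immersive jets is the restriction of the tangent
  bundle of the jet bundle.\<close>

definition imm_tangent_bundle ::
  "('p, real^'n) chart set \<Rightarrow> ('q, real^'k) chart set \<Rightarrow>
   (('p, 'q) jet \<times> (('p, 'q) jet, (real^'n) \<times> (real^'k) \<times> (real^'n^'k)) tvec) set"
  where "imm_tangent_bundle M E = {(j, v) \<in> tangent_bundle (jet_atlas M E). j \<in> imm_jets M E}"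

definition jet_plane ::
  "('p, 'a::euclidean_space) chart set \<Rightarrow> ('q, 'b::euclidean_space) chart set \<Rightarrow>
   ('p, 'q) jet \<Rightarrow> 'q \<times> ('q, 'b) tvec set"
  where "jet_plane M E j = (jet_target j, jet_map M E j ` tangent_space M (fst j))"

text \<open>Both connections are given by their components in adapted charts; the defining descriptions
  demand the formula in all adapted charts around the base point simultaneously.
  \<open>jet_connection\<close> is the tangent-valued form evaluated on a tangent vector, that is, the horizontal
  projection; \<open>jet_vproj\<close> is its complement.\<close>

definition jet_connection ::
  "('p, real^'n) chart set \<Rightarrow> ('q, real^'k) chart set \<Rightarrow>
   ('p, real^'n) cov_deriv \<Rightarrow> ('q, real^'k) cov_deriv \<Rightarrow> ('p, 'q) jet \<Rightarrow>
   (('p, 'q) jet, (real^'n) \<times> (real^'k) \<times> (real^'n^'k)) tvec \<Rightarrow>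
   (('p, 'q) jet, (real^'n) \<times> (real^'k) \<times> (real^'n^'k)) tvec"
  where "jet_connection M E \<Theta> \<Gamma> j v =
    (THE w. w \<in> tangent_space (jet_atlas M E) j \<and>
      (\<forall>c\<in>M. \<forall>d\<in>E. j \<in> fst (jet_chart M E c d) \<longrightarrow>
        (case v (jet_chart M E c d) of (dx, du, dux) \<Rightarrow>
          w (jet_chart M E c d) =
            (dx, du, \<chi> C h.
              (\<Sum>l\<in>UNIV. dx $ l *
                 (\<Sum>x\<in>UNIV. christoffel M \<Theta> c (fst j) l x h * jet_coord c d j $ C $ x)) -
              (\<Sum>B\<in>UNIV. du $ B *
                 (\<Sum>A\<in>UNIV. christoffel E \<Gamma> d (jet_target j) B C A * jet_coord c d j $ A $ h))))))"

definition jet_vproj ::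
  "('p, real^'n) chart set \<Rightarrow> ('q, real^'k) chart set \<Rightarrow>
   ('p, real^'n) cov_deriv \<Rightarrow> ('q, real^'k) cov_deriv \<Rightarrow>
   ('p, 'q) jet \<times> (('p, 'q) jet, (real^'n) \<times> (real^'k) \<times> (real^'n^'k)) tvec \<Rightarrow>
   ('p, 'q) jet \<times> (('p, 'q) jet, (real^'n) \<times> (real^'k) \<times> (real^'n^'k)) tvec"
  where "jet_vproj M E \<Theta> \<Gamma> = (\<lambda>(j, v). (j, v - jet_connection M E \<Theta> \<Gamma> j v))"

definition dot_christoffel ::
  "(('n + 'm) \<Rightarrow> ('n + 'm) \<Rightarrow> ('n + 'm) \<Rightarrow> real) \<Rightarrow> real^'n::finite^'m::finite \<Rightarrow>
   ('n + 'm) \<Rightarrow> 'm \<Rightarrow> 'n \<Rightarrow> real"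
  where "dot_christoffel G u A k x =
    G A (Inr k) (Inl x) + (\<Sum>i\<in>UNIV. G A (Inr k) (Inr i) * u $ i $ x) -
    (\<Sum>b\<in>UNIV. u $ k $ b *
       (G A (Inl b) (Inl x) + (\<Sum>i\<in>UNIV. G A (Inl b) (Inr i) * u $ i $ x)))"

definition grassmann_vproj ::
  "('q, real^('n::finite + 'm::finite)) chart set \<Rightarrow> ('q, real^('n + 'm)) cov_deriv \<Rightarrow>
   ('q \<times> ('q, real^('n + 'm)) tvec set) \<times>
     ('q \<times> ('q, real^('n + 'm)) tvec set, (real^('n + 'm)) \<times> (real^'n^'m)) tvec \<Rightarrow>
   ('q \<times> ('q, real^('n + 'm)) tvec set) \<times>
     ('q \<times> ('q, real^('n + 'm)) tvec set, (real^('n + 'm)) \<times> (real^'n^'m)) tvec"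
  where "grassmann_vproj E \<Gamma> = (\<lambda>(\<omega>, v).
    (\<omega>, THE w. w \<in> tangent_space (grassmann_atlas E) \<omega> \<and>
      (\<forall>d\<in>E. \<omega> \<in> fst (grassmann_chart E d) \<longrightarrow>
        (case v (grassmann_chart E d) of (du, dul) \<Rightarrow>
          w (grassmann_chart E d) =
            (0, \<chi> k x. dul $ k $ x +
              (\<Sum>A\<in>UNIV.
                 dot_christoffel (christoffel E \<Gamma> d (fst \<omega>)) (snd (snd (grassmann_chart E d) \<omega>)) A k x
                 * du $ A))))))"

end

theory Submission
  imports Defs
begin

text \<open>In adapted charts a jet is a matrix \<open>U\<close> with an upper block \<open>P\<close> and a lower block \<open>Q\<close>, and the plane
  that it spans is the graph of the slope \<open>s = Q P\<^sup>-\<^sup>1\<close>. Differentiating \<open>s P = Q\<close> shows that the tangent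
  map of \<open>jet_plane\<close> sends \<open>(dx, du, dU)\<close> to \<open>(du, \<kappa>(dU) P\<^sup>-\<^sup>1)\<close>, where \<open>\<kappa>(H)\<close> is the lower block of \<open>H\<close> minus \<open>s\<close>
  times its upper block, called \<open>vertical_part\<close> below (\<open>slope_has_derivative\<close>, \<open>jet_plane_local\<close>). The map \<open>\<kappa>\<close> kills every matrix whose
  columns lie in the plane. Now write \<open>\<Gamma>(du)\<close> and \<open>\<Theta>(dx)\<close> for the matrices of Christoffel symbols contracted
  with a direction. The vertical projection of a jet vector has the last component
  \<open>dU + \<Gamma>(du) U - U \<Theta>(dx)\<close>. The columns of \<open>U \<Theta>(dx)\<close> lie in the plane, so this term disappears, and
  since \<open>U\<close> is the graph matrix of \<open>s\<close> times \<open>P\<close>, the term \<open>\<Gamma>(du) U\<close> becomes \<open>\<kappa>\<close> of \<open>\<Gamma>(du)\<close> applied to the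
  graph matrix of \<open>s\<close>. That is the formula with the dotted symbols (\<open>dot_christoffel_entries\<close>,
  \<open>quotient_algebra\<close>).

  The larger part of the work is that the two vertical projections are well defined. Each is
  described by a formula in all adapted charts simultaneously, so the formulas must be shown to be
  compatible with the transition maps. This rests on the transformation law of the connection matrices,
  \<open>J \<Gamma>(v) = dJ(v) + \<Gamma>'(J v) J\<close> with \<open>J\<close> the Jacobian of a transition map
  (\<open>connection_matrix_transformation\<close>). The coordinate matrix of a jet changes by \<open>U' J = K U\<close>, with the
  Jacobians \<open>J\<close> and \<open>K\<close> of the transition maps of \<open>M\<close> and \<open>E\<close>; the derivatives of \<open>J\<close> and \<open>K\<close> that appear
  when this is differentiated are cancelled by those in the two transformation laws
  (\<open>jet_horizontal_change_chart\<close>). A plane with coordinates \<open>u\<close> passes to the slope of \<open>K\<close> times the graph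
  matrix of \<open>u\<close>, and the same cancellation takes place after applying \<open>\<kappa>\<close>
  (\<open>grassmann_vertical_change_chart\<close>).

  In order to speak of derivatives on the jet and Grassmann bundles at all, their charts must be shown
  to be injective with open images of overlaps; for jets this includes that every matrix is the
  coordinate matrix of a jet (\<open>jet_with_coordinates\<close>).\<close>

section \<open>Calculus of smooth maps on open sets\<close>

lemma frechet_derivative_cong_open:
  assumes "open S" "x \<in> S" "\<And>y. y \<in> S \<Longrightarrow> f y = g y"
  shows "frechet_derivative f (at x) = frechet_derivative g (at x)"
proof -
  have "(f has_derivative D) (at x) \<longleftrightarrow> (g has_derivative D) (at x)" for D
    using has_derivative_transform_within_open[OF _ assms(1,2)] assms(3) by metis
  then show ?thesis
    by (simp add: frechet_derivative_def)
qed

lemma differentiable_cong_open: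
  assumes "f differentiable (at x)" "open S" "x \<in> S" "\<And>y. y \<in> S \<Longrightarrow> f y = g y"
  shows "g differentiable (at x)"
  using assms has_derivative_transform_within_open unfolding differentiable_def by blast

lemma frechet_derivative_eqI:
  "(f has_derivative D) (at x) \<Longrightarrow> frechet_derivative f (at x) = D"
  using frechet_derivative_at by metis

lemma has_derivative_frechet:
  "f differentiable (at x) \<Longrightarrow> (f has_derivative frechet_derivative f (at x)) (at x)"
  by (simp add: frechet_derivative_works)

lemma Ck_on_cong:
  assumes "Ck_on k f S" "open S" "\<And>x. x \<in> S \<Longrightarrow> f x = g x"
  shows "Ck_on k g S"
  using assms
proof (induction k arbitrary: f g)
  case 0
  then show ?case by (simp cong: continuous_on_cong)
next
  case (Suc k)
  have "g differentiable (at x)" if "x \<in> S" for x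
    using Suc.prems that differentiable_cong_open[of f x S g] by simp
  moreover have "Ck_on k (\<lambda>x. frechet_derivative g (at x) v) S" for v
    using Suc.IH[of "\<lambda>x. frechet_derivative f (at x) v"] Suc.prems
      frechet_derivative_cong_open[of S _ f g] by simp
  ultimately show ?case by simp
qed

lemma Ck_on_subset:
  assumes "Ck_on k f S" "T \<subseteq> S"
  shows "Ck_on k f T"
  using assms by (induction k arbitrary: f) (auto intro: continuous_on_subset)

lemma Ck_on_SucD:
  assumes "Ck_on (Suc k) f S"
  shows "Ck_on k f S"
  using assms
proof (induction k arbitrary: f)
  case 0
  then have "f differentiable_on S"
    by (auto simp: differentiable_on_def intro: differentiable_at_withinI)
  then show ?case by (simp add: differentiable_imp_continuous_on)
next
  case (Suc k)
  have "Ck_on (Suc k) (\<lambda>x. frechet_derivative f (at x) v) S" for v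
    using Suc.prems unfolding Ck_on.simps(2)[of "Suc k"] by blast
  then have "Ck_on k (\<lambda>x. frechet_derivative f (at x) v) S" for v
    by (rule Suc.IH)
  with Suc.prems show ?case by simp
qed

text \<open>Lets a derivative be given in closed form, so that the inductions below never have to compute
  \<open>frechet_derivative\<close> of a compound expression.\<close>
lemma Ck_on_SucI:
  assumes "open S" "\<And>x. x \<in> S \<Longrightarrow> (f has_derivative D x) (at x)"
    "\<And>v. Ck_on k (\<lambda>x. D x v) S"
  shows "Ck_on (Suc k) f S"
proof -
  have "Ck_on k (\<lambda>x. frechet_derivative f (at x) v) S" for v
    by (rule Ck_on_cong[OF assms(3)[of v] assms(1)])
      (simp add: frechet_derivative_eqI[OF assms(2)])
  then show ?thesis
    using assms(2) by (auto simp: differentiable_def)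
qed

lemma Ck_on_Suc_has_derivative:
  assumes "Ck_on (Suc k) f S" "x \<in> S"
  shows "(f has_derivative frechet_derivative f (at x)) (at x)"
  using assms by (simp add: has_derivative_frechet)

lemma Ck_on_const: "open S \<Longrightarrow> Ck_on k (\<lambda>x. c) S"
  by (induction k arbitrary: c) simp_all

lemma Ck_on_linear:
  assumes "Ck_on k f S" "open S" "bounded_linear L"
  shows "Ck_on k (\<lambda>x. L (f x)) S"
  using assms(1)
proof (induction k arbitrary: f)
  case 0
  then show ?case
    using assms(3) by (simp add: bounded_linear.continuous_on)
next
  case (Suc k)
  show ?case
    by (rule Ck_on_SucI[OF assms(2)
          bounded_linear.has_derivative[OF assms(3) Ck_on_Suc_has_derivative[OF Suc.prems]]])
      (use Suc in auto)
qed

lemma Ck_on_id: "open S \<Longrightarrow> Ck_on k (\<lambda>x. x) S"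
  by (cases k) (simp_all add: Ck_on_const)

lemma Ck_on_add:
  assumes "Ck_on k f S" "Ck_on k g S" "open S"
  shows "Ck_on k (\<lambda>x. f x + g x) S"
  using assms(1,2)
proof (induction k arbitrary: f g)
  case 0
  then show ?case by (simp add: continuous_on_add)
next
  case (Suc k)
  show ?case
    by (rule Ck_on_SucI[OF assms(3) has_derivative_add[OF
            Ck_on_Suc_has_derivative[OF Suc.prems(1)] Ck_on_Suc_has_derivative[OF Suc.prems(2)]]])
      (use Suc in auto)
qed

lemma Ck_on_sum:
  assumes "\<And>i. i \<in> I \<Longrightarrow> Ck_on k (f i) S" "open S"
  shows "Ck_on k (\<lambda>x. \<Sum>i\<in>I. f i x) S"
  using assms by (induction I rule: infinite_finite_induct) (auto intro: Ck_on_const Ck_on_add)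

lemma Ck_on_scaleR:
  assumes "Ck_on k f S" "Ck_on k g S" "open S"
  shows "Ck_on k (\<lambda>x. f x *\<^sub>R g x) S"
  using assms(1,2)
proof (induction k arbitrary: f g)
  case 0
  then show ?case by (simp add: continuous_on_scaleR)
next
  case (Suc k)
  show ?case
  proof (rule Ck_on_SucI[OF assms(3) has_derivative_scaleR[OF
          Ck_on_Suc_has_derivative[OF Suc.prems(1)] Ck_on_Suc_has_derivative[OF Suc.prems(2)]]])
    fix v
    show "Ck_on k (\<lambda>x. f x *\<^sub>R frechet_derivative g (at x) v +
        frechet_derivative f (at x) v *\<^sub>R g x) S"
      using Suc Ck_on_SucD[OF Suc.prems(1)] Ck_on_SucD[OF Suc.prems(2)]
      by (intro Ck_on_add assms(3) Suc.IH) auto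
  qed
qed

text \<open>The derivative of \<open>g \<circ> f\<close> in a fixed direction is a finite sum over a basis of products of
  directional derivatives, each one order less regular; \<open>f\<close> itself stays fixed in the induction, so
  only \<open>g\<close> has to vary in the induction hypothesis.\<close>
lemma Ck_on_compose:
  assumes "Ck_on k g T" "Ck_on k f S" "open S" "f ` S \<subseteq> T"
  shows "Ck_on k (\<lambda>x. g (f x)) S"
  using assms(1,2)
proof (induction k arbitrary: g)
  case 0
  then show ?case using assms(4) continuous_on_compose2[of T g S f] by simp
next
  case (Suc k)
  show ?case
  proof (rule Ck_on_SucI[OF assms(3)])
    fix x assume "x \<in> S"
    then have df: "(f has_derivative frechet_derivative f (at x)) (at x)"
      and dg: "(g has_derivative frechet_derivative g (at (f x))) (at (f x))"
      using Ck_on_Suc_has_derivative[OF Suc.prems(1)] Ck_on_Suc_has_derivative[OF Suc.prems(2)]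
        assms(4) by blast+
    have eq: "frechet_derivative g (at (f x)) (frechet_derivative f (at x) v) =
        (\<Sum>b\<in>Basis. (frechet_derivative f (at x) v \<bullet> b) *\<^sub>R frechet_derivative g (at (f x)) b)" for v
    proof -
      have L: "linear (frechet_derivative g (at (f x)))"
        using dg by (rule has_derivative_linear)
      have "frechet_derivative g (at (f x)) (\<Sum>b\<in>Basis. (w \<bullet> b) *\<^sub>R b) =
          (\<Sum>b\<in>Basis. (w \<bullet> b) *\<^sub>R frechet_derivative g (at (f x)) b)" for w
        by (simp add: linear_sum[OF L] linear_scale[OF L])
      from this[of "frechet_derivative f (at x) v"] show ?thesis
        unfolding euclidean_representation .
    qed
    show "((\<lambda>x. g (f x)) has_derivative
        (\<lambda>v. \<Sum>b\<in>Basis. (frechet_derivative f (at x) v \<bullet> b) *\<^sub>R frechet_derivative g (at (f x)) b)) (at x)"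
      using diff_chain_at[OF df dg] unfolding o_def eq .
  next
    fix v
    have "Ck_on k f S" using Suc.prems(2) by (rule Ck_on_SucD)
    then show "Ck_on k (\<lambda>x. \<Sum>b\<in>Basis. (frechet_derivative f (at x) v \<bullet> b) *\<^sub>R
        frechet_derivative g (at (f x)) b) S"
    proof (intro Ck_on_sum Ck_on_scaleR assms(3))
      fix b
      have "Ck_on k (\<lambda>x. frechet_derivative f (at x) v) S"
        using Suc.prems(2) by simp
      then show "Ck_on k (\<lambda>x. frechet_derivative f (at x) v \<bullet> b) S"
        by (rule Ck_on_linear[OF _ assms(3) bounded_linear_inner_left])
      have "Ck_on k (\<lambda>y. frechet_derivative g (at y) b) T"
        using Suc.prems(1) by simp
      then show "Ck_on k (\<lambda>x. frechet_derivative g (at (f x)) b) S"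
        using \<open>Ck_on k f S\<close> by (rule Suc.IH)
    qed
  qed
qed

lemma smooth_on_cong:
  "\<lbrakk>smooth_on S f; open S; \<And>x. x \<in> S \<Longrightarrow> f x = g x\<rbrakk> \<Longrightarrow> smooth_on S g"
  unfolding smooth_on_def using Ck_on_cong by blast

lemma smooth_on_subset: "\<lbrakk>smooth_on S f; T \<subseteq> S\<rbrakk> \<Longrightarrow> smooth_on T f"
  unfolding smooth_on_def using Ck_on_subset by blast

lemma smooth_on_linear:
  "\<lbrakk>smooth_on S f; open S; bounded_linear L\<rbrakk> \<Longrightarrow> smooth_on S (\<lambda>x. L (f x))"
  unfolding smooth_on_def by (rule allI, rule Ck_on_linear) auto

lemma smooth_on_scaleR:
  "\<lbrakk>smooth_on S f; smooth_on S g; open S\<rbrakk> \<Longrightarrow> smooth_on S (\<lambda>x. f x *\<^sub>R g x)"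
  unfolding smooth_on_def by (rule allI, rule Ck_on_scaleR) auto

lemma smooth_on_sum:
  "\<lbrakk>\<And>i. i \<in> I \<Longrightarrow> smooth_on S (f i); open S\<rbrakk> \<Longrightarrow> smooth_on S (\<lambda>x. \<Sum>i\<in>I. f i x)"
  unfolding smooth_on_def by (rule allI, rule Ck_on_sum) auto

lemma smooth_on_compose:
  "\<lbrakk>smooth_on T g; smooth_on S f; open S; f ` S \<subseteq> T\<rbrakk> \<Longrightarrow> smooth_on S (\<lambda>x. g (f x))"
  unfolding smooth_on_def by (rule allI, rule Ck_on_compose) auto

lemma smooth_on_frechet_derivative:
  "smooth_on S f \<Longrightarrow> smooth_on S (\<lambda>x. frechet_derivative f (at x) v)"
  unfolding smooth_on_def by (metis Ck_on.simps(2))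

lemma smooth_on_differentiable: "\<lbrakk>smooth_on S f; x \<in> S\<rbrakk> \<Longrightarrow> f differentiable (at x)"
  unfolding smooth_on_def by (metis Ck_on.simps(2))

lemma smooth_on_affine:
  "\<lbrakk>open S; bounded_linear L\<rbrakk> \<Longrightarrow> smooth_on S (\<lambda>x. L x + c)"
  unfolding smooth_on_def
  by (intro allI Ck_on_add[OF Ck_on_linear[OF Ck_on_id] Ck_on_const])

section \<open>Tangent vectors and changes of charts\<close>

text \<open>The jet and Grassmann atlases enter only through tangent vectors, and for these differentiable
  transition maps suffice. Everything about tangent spaces is developed for such atlases, so that it
  applies to \<open>M\<close>, \<open>E\<close>, the jet bundle and the Grassmann bundle alike.\<close>
definition differentiable_atlas :: "('p, 'a::euclidean_space) chart set \<Rightarrow> bool"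
  where "differentiable_atlas A \<longleftrightarrow>
    (\<forall>c\<in>A. inj_on (snd c) (fst c)) \<and>
    (\<forall>c\<in>A. \<forall>c'\<in>A. open (snd c ` (fst c \<inter> fst c')) \<and>
       (\<forall>p\<in>fst c \<inter> fst c'. transition c c' differentiable (at (snd c p))))"

abbreviation dtrans :: "('p, 'a::euclidean_space) chart \<Rightarrow> ('p, 'a) chart \<Rightarrow> 'p \<Rightarrow> 'a \<Rightarrow> 'a"
  where "dtrans c c' p \<equiv> frechet_derivative (transition c c') (at (snd c p))"

lemma smooth_atlas_imp_differentiable_atlas:
  "smooth_atlas A \<Longrightarrow> differentiable_atlas A"
  unfolding smooth_atlas_def differentiable_atlas_def
  by (meson imageI smooth_on_differentiable)

lemma chart_inv_chart:
  "\<lbrakk>inj_on (snd c) (fst c); p \<in> fst c\<rbrakk> \<Longrightarrow> chart_inv c (snd c p) = p"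
  by (simp add: chart_inv_def)

lemma transition_chart:
  "\<lbrakk>inj_on (snd c) (fst c); p \<in> fst c\<rbrakk> \<Longrightarrow> transition c c' (snd c p) = snd c' p"
  by (simp add: transition_def chart_inv_chart)

lemma tangent_space_eq_0:
  "\<lbrakk>v \<in> tangent_space A p; \<not> (c \<in> A \<and> p \<in> fst c)\<rbrakk> \<Longrightarrow> v c = 0"
  unfolding tangent_space_def by blast

lemma chart_at_in: "\<lbrakk>c \<in> A; p \<in> fst c\<rbrakk> \<Longrightarrow> chart_at A p \<in> A \<and> p \<in> fst (chart_at A p)"
  unfolding chart_at_def by (rule someI[of "\<lambda>c. c \<in> A \<and> p \<in> fst c" c]) simp

context
  fixes A :: "('p, 'a::euclidean_space) chart set"
  assumes A: "differentiable_atlas A"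
begin

lemma atlas_inj: "c \<in> A \<Longrightarrow> inj_on (snd c) (fst c)"
  using A by (simp add: differentiable_atlas_def)

lemma atlas_open: "\<lbrakk>c \<in> A; c' \<in> A\<rbrakk> \<Longrightarrow> open (snd c ` (fst c \<inter> fst c'))"
  using A by (simp add: differentiable_atlas_def)

lemma atlas_open_image: "c \<in> A \<Longrightarrow> open (snd c ` fst c)"
  using atlas_open[of c c] by simp

lemma transition_has_derivative:
  "\<lbrakk>c \<in> A; c' \<in> A; p \<in> fst c; p \<in> fst c'\<rbrakk> \<Longrightarrow>
    (transition c c' has_derivative dtrans c c' p) (at (snd c p))"
  using A by (simp add: differentiable_atlas_def has_derivative_frechet)

lemma linear_dtrans:
  "\<lbrakk>c \<in> A; c' \<in> A; p \<in> fst c; p \<in> fst c'\<rbrakk> \<Longrightarrow> linear (dtrans c c' p)"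
  by (rule has_derivative_linear[OF transition_has_derivative])

text \<open>Near the point, the two chart expressions of \<open>h\<close> differ by the transition map, so this is the
  chain rule. It removes the arbitrary chart chosen in \<open>tangent_map\<close> and \<open>dir_deriv\<close>.\<close>
lemma has_derivative_change_chart:
  fixes h :: "'p \<Rightarrow> 'b::real_normed_vector"
  assumes "c \<in> A" "c' \<in> A" "p \<in> fst c" "p \<in> fst c'"
    and "((h \<circ> chart_inv c') has_derivative L) (at (snd c' p))"
  shows "((h \<circ> chart_inv c) has_derivative (L \<circ> dtrans c c' p)) (at (snd c p))"
proof (rule has_derivative_transform_within_open)
  have "((h \<circ> chart_inv c') has_derivative L) (at (transition c c' (snd c p)))"
    using assms by (simp add: transition_chart atlas_inj)
  from diff_chain_at[OF transition_has_derivative[OF assms(1-4)] this]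
  show "((h \<circ> chart_inv c') \<circ> transition c c' has_derivative (L \<circ> dtrans c c' p)) (at (snd c p))" .
  show "open (snd c ` (fst c \<inter> fst c'))" by (rule atlas_open[OF assms(1,2)])
  show "snd c p \<in> snd c ` (fst c \<inter> fst c')" using assms by simp
  fix z assume "z \<in> snd c ` (fst c \<inter> fst c')"
  then show "((h \<circ> chart_inv c') \<circ> transition c c') z = (h \<circ> chart_inv c) z"
    using assms by (auto simp: transition_chart chart_inv_chart atlas_inj)
qed

lemma dtrans_compose:
  assumes "c \<in> A" "c' \<in> A" "c'' \<in> A" "p \<in> fst c" "p \<in> fst c'" "p \<in> fst c''"
  shows "dtrans c' c'' p (dtrans c c' p v) = dtrans c c'' p v"
proof -
  have "(transition c c'' has_derivative (dtrans c' c'' p \<circ> dtrans c c' p)) (at (snd c p))"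
    using has_derivative_change_chart[OF assms(1,2,4,5), of "snd c''"]
      transition_has_derivative[OF assms(2,3,5,6)] by (simp add: transition_def)
  then show ?thesis
    by (simp add: frechet_derivative_eqI)
qed

lemma dtrans_same:
  assumes "c \<in> A" "p \<in> fst c"
  shows "dtrans c c p v = v"
proof -
  have "(transition c c has_derivative id) (at (snd c p))"
    by (rule has_derivative_transform_within_open[OF has_derivative_id atlas_open_image[OF assms(1)]])
      (use assms in \<open>auto simp: transition_chart atlas_inj\<close>)
  then show ?thesis
    by (simp add: frechet_derivative_eqI)
qed

lemma tangent_space_component:
  "\<lbrakk>v \<in> tangent_space A p; c \<in> A; c' \<in> A; p \<in> fst c; p \<in> fst c'\<rbrakk> \<Longrightarrow> v c' = dtrans c c' p (v c)"
  unfolding tangent_space_def by blast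

lemma tangent_space_eqI:
  assumes "v \<in> tangent_space A p" "w \<in> tangent_space A p" "c \<in> A" "p \<in> fst c" "v c = w c"
  shows "v = w"
proof
  fix c'
  show "v c' = w c'"
  proof (cases "c' \<in> A \<and> p \<in> fst c'")
    case True
    then show ?thesis
      using tangent_space_component[OF assms(1,3) _ assms(4), of c']
        tangent_space_component[OF assms(2,3) _ assms(4), of c'] assms(5) by simp
  next
    case False
    then show ?thesis
      using tangent_space_eq_0[OF assms(1), of c'] tangent_space_eq_0[OF assms(2), of c'] by simp
  qed
qed

lemma tangent_of_coords_in_tangent_space:
  assumes "c \<in> A" "p \<in> fst c"
  shows "tangent_of_coords A c p w \<in> tangent_space A p"
  unfolding tangent_space_def
proof (intro CollectI conjI ballI allI impI)
  fix c' c'' assume "c' \<in> A" "c'' \<in> A" "p \<in> fst c' \<inter> fst c''"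
  then show "tangent_of_coords A c p w c'' = dtrans c' c'' p (tangent_of_coords A c p w c')"
    using dtrans_compose[OF assms(1) _ _ assms(2), of c' c''] by (simp add: tangent_of_coords_def)
qed (auto simp: tangent_of_coords_def)

lemma tangent_of_coords_same:
  "\<lbrakk>c \<in> A; p \<in> fst c\<rbrakk> \<Longrightarrow> tangent_of_coords A c p w c = w"
  by (simp add: tangent_of_coords_def dtrans_same)

lemma subspace_tangent_space: "subspace (tangent_space A p)"
proof (rule subspaceI)
  show "0 \<in> tangent_space A p"
    by (simp add: tangent_space_def linear_0[OF linear_dtrans])
next
  fix v w assume v: "v \<in> tangent_space A p" and w: "w \<in> tangent_space A p"
  show "v + w \<in> tangent_space A p"
    unfolding tangent_space_def
  proof (intro CollectI conjI ballI allI impI)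
    fix c c' assume "c \<in> A" "c' \<in> A" "p \<in> fst c \<inter> fst c'"
    then show "(v + w) c' = dtrans c c' p ((v + w) c)"
      using tangent_space_component[OF v, of c c'] tangent_space_component[OF w, of c c']
      by (simp add: linear_add[OF linear_dtrans])
  qed (simp add: tangent_space_eq_0[OF v] tangent_space_eq_0[OF w])
next
  fix r :: real and v assume v: "v \<in> tangent_space A p"
  show "r *\<^sub>R v \<in> tangent_space A p"
    unfolding tangent_space_def
  proof (intro CollectI conjI ballI allI impI)
    fix c c' assume "c \<in> A" "c' \<in> A" "p \<in> fst c \<inter> fst c'"
    then show "(r *\<^sub>R v) c' = dtrans c c' p ((r *\<^sub>R v) c)"
      using tangent_space_component[OF v, of c c']
      by (simp add: scaleR_fun_def linear_scale[OF linear_dtrans])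
  qed (simp add: scaleR_fun_def tangent_space_eq_0[OF v])
qed

lemma tangent_map_component:
  assumes "c \<in> A" "p \<in> fst c" "v \<in> tangent_space A p" "d \<in> B" "f p \<in> fst d"
    and "((snd d \<circ> f \<circ> chart_inv c) has_derivative L) (at (snd c p))"
  shows "snd (tangent_map A B f (p, v)) d = L (v c)"
proof -
  define c0 where "c0 = chart_at A p"
  have c0: "c0 \<in> A" "p \<in> fst c0"
    using chart_at_in[OF assms(1,2)] by (auto simp: c0_def)
  have "((snd d \<circ> f) \<circ> chart_inv c0 has_derivative (L \<circ> dtrans c0 c p)) (at (snd c0 p))"
    by (rule has_derivative_change_chart[OF c0(1) assms(1) c0(2) assms(2)])
      (use assms(6) in \<open>simp add: o_assoc\<close>)
  then have "snd (tangent_map A B f (p, v)) d = L (dtrans c0 c p (v c0))"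
    using assms(4,5) by (simp add: tangent_map_def c0_def[symmetric] o_assoc frechet_derivative_eqI)
  then show ?thesis
    using tangent_space_component[OF assms(3) c0(1) assms(1) c0(2) assms(2)] by simp
qed

lemma dir_deriv_eq:
  assumes "c \<in> A" "p \<in> fst c" "v \<in> tangent_space A p"
    and "((f \<circ> chart_inv c) has_derivative L) (at (snd c p))"
  shows "dir_deriv A f p v = L (v c)"
proof -
  define c0 where "c0 = chart_at A p"
  have c0: "c0 \<in> A" "p \<in> fst c0"
    using chart_at_in[OF assms(1,2)] by (auto simp: c0_def)
  have "(f \<circ> chart_inv c0 has_derivative (L \<circ> dtrans c0 c p)) (at (snd c0 p))"
    by (rule has_derivative_change_chart[OF c0(1) assms(1) c0(2) assms(2,4)])
  then have "dir_deriv A f p v = L (dtrans c0 c p (v c0))"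
    by (simp add: dir_deriv_def c0_def[symmetric] frechet_derivative_eqI)
  then show ?thesis
    using tangent_space_component[OF assms(3) c0(1) assms(1) c0(2) assms(2)] by simp
qed

end

lemma tangent_map_outside:
  "\<not> (d \<in> B \<and> f p \<in> fst d) \<Longrightarrow> snd (tangent_map A B f (p, v)) d = 0"
  by (auto simp: tangent_map_def)

lemma fst_tangent_map: "fst (tangent_map A B f (p, v)) = f p"
  by (simp add: tangent_map_def)

text \<open>The components of the image vector transform correctly because, near the point, the chart
  expressions of \<open>f\<close> differ by a transition map of the target atlas. This needs \<open>f\<close> to stay in the
  target chart near the point, which for a total function \<open>f\<close> is a separate requirement.\<close>
lemma tangent_map_in_tangent_space:
  assumes A: "differentiable_atlas A" and B: "differentiable_atlas B"
    and p: "c \<in> A" "p \<in> fst c" and v: "v \<in> tangent_space A p"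
    and diff: "\<And>d. \<lbrakk>d \<in> B; f p \<in> fst d\<rbrakk> \<Longrightarrow>
      (snd d \<circ> f \<circ> chart_inv c) differentiable (at (snd c p))"
    and near: "\<And>d. \<lbrakk>d \<in> B; f p \<in> fst d\<rbrakk> \<Longrightarrow>
      \<forall>\<^sub>F z in nhds (snd c p). f (chart_inv c z) \<in> fst d"
  shows "snd (tangent_map A B f (p, v)) \<in> tangent_space B (f p)"
  unfolding tangent_space_def
proof (intro CollectI conjI ballI allI impI)
  fix d d' assume d: "d \<in> B" "d' \<in> B" "f p \<in> fst d \<inter> fst d'"
  let ?e = "snd d \<circ> f \<circ> chart_inv c" and ?e' = "snd d' \<circ> f \<circ> chart_inv c"
  let ?D = "frechet_derivative ?e (at (snd c p))"
  have D: "(?e has_derivative ?D) (at (snd c p))"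
    using diff d by (simp add: has_derivative_frechet)
  have fp: "?e (snd c p) = snd d (f p)"
    using p by (simp add: chart_inv_chart atlas_inj[OF A])
  have "(transition d d' \<circ> ?e has_derivative (dtrans d d' (f p) \<circ> ?D)) (at (snd c p))"
    using diff_chain_at[OF D, of "transition d d'"] transition_has_derivative[OF B d(1,2)] d(3) fp
    by simp
  moreover have "\<forall>\<^sub>F z in nhds (snd c p). (transition d d' \<circ> ?e) z = ?e' z"
  proof (rule eventually_mono[OF near[OF d(1)]])
    show "f p \<in> fst d" using d(3) by simp
    fix z assume "f (chart_inv c z) \<in> fst d"
    then show "(transition d d' \<circ> ?e) z = ?e' z"
      using transition_chart[OF atlas_inj[OF B d(1)]] by simp
  qed
  then have "\<forall>\<^sub>F z in at (snd c p). (transition d d' \<circ> ?e) z = ?e' z"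
    and "(transition d d' \<circ> ?e) (snd c p) = ?e' (snd c p)"
    by (auto simp: eventually_nhds_conv_at)
  ultimately have "(?e' has_derivative (dtrans d d' (f p) \<circ> ?D)) (at (snd c p))"
    by (rule has_derivative_transform_eventually) auto
  then show "snd (tangent_map A B f (p, v)) d' =
      dtrans d d' (f p) (snd (tangent_map A B f (p, v)) d)"
    using tangent_map_component[OF A p v d(1) _ D]
      tangent_map_component[where f = f, OF A p v d(2)] d(3) by simp
next
  fix d assume "\<not> (d \<in> B \<and> f p \<in> fst d)"
  then show "snd (tangent_map A B f (p, v)) d = 0"
    by (rule tangent_map_outside)
qed

lemma tangent_space_eq_componentsI:
  assumes "v \<in> tangent_space A p" "w \<in> tangent_space A p"
    and "\<And>c. \<lbrakk>c \<in> A; p \<in> fst c\<rbrakk> \<Longrightarrow> v c = w c"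
  shows "v = w"
proof
  fix c
  show "v c = w c"
  proof (cases "c \<in> A \<and> p \<in> fst c")
    case True
    then show ?thesis using assms(3) by simp
  next
    case False
    then show ?thesis
      using tangent_space_eq_0[OF assms(1), of c] tangent_space_eq_0[OF assms(2), of c] by simp
  qed
qed

text \<open>A vector may be prescribed by components in all charts at once as soon as they satisfy the
  transformation rule. Both connections are described in this way, with charts indexed by pairs of
  charts of \<open>M\<close> and \<open>E\<close> or by charts of \<open>E\<close>; at a point without charts the zero vector is the one
  that is described.\<close>
lemma tangent_vector_with_components:
  assumes A: "differentiable_atlas (X ` K)"
    and compat: "\<And>k l. \<lbrakk>k \<in> K; l \<in> K; p \<in> fst (X k); p \<in> fst (X l)\<rbrakk> \<Longrightarrow>
      dtrans (X k) (X l) p (F k) = F l"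
  obtains w where "w \<in> tangent_space (X ` K) p"
    and "\<And>k. \<lbrakk>k \<in> K; p \<in> fst (X k)\<rbrakk> \<Longrightarrow> w (X k) = F k"
proof (cases "\<exists>k\<in>K. p \<in> fst (X k)")
  case True
  then obtain k where k: "k \<in> K" "p \<in> fst (X k)" by blast
  show thesis
  proof (rule that[of "tangent_of_coords (X ` K) (X k) p (F k)"])
    show "tangent_of_coords (X ` K) (X k) p (F k) \<in> tangent_space (X ` K) p"
      using k by (intro tangent_of_coords_in_tangent_space[OF A]) auto
    fix l assume "l \<in> K" "p \<in> fst (X l)"
    then show "tangent_of_coords (X ` K) (X k) p (F k) (X l) = F l"
      using compat k by (simp add: tangent_of_coords_def)
  qed
next
  case False
  then show thesis
    using that[of 0] subspace_0[OF subspace_tangent_space[OF A]] by blast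
qed

section \<open>Restricted charts and local representatives\<close>

text \<open>Transition maps of restricted charts are restrictions of transition maps; the overlaps stay open
  because transition maps are continuous.\<close>
lemma smooth_atlas_restrictions:
  assumes A: "smooth_atlas A"
    and B: "\<And>e. e \<in> B \<Longrightarrow> \<exists>c\<in>A. fst e \<subseteq> fst c \<and> snd e = snd c \<and> open (snd c ` fst e)"
  shows "smooth_atlas B"
  unfolding smooth_atlas_def
proof (intro conjI ballI)
  note dA = smooth_atlas_imp_differentiable_atlas[OF A]
  fix e assume "e \<in> B"
  then obtain c where c: "c \<in> A" "fst e \<subseteq> fst c" "snd e = snd c" "open (snd c ` fst e)"
    using B by blast
  show inj: "inj_on (snd e) (fst e)"
    using atlas_inj[OF dA c(1)] c(2,3) inj_on_subset by metis
  fix e' assume "e' \<in> B"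
  then obtain c' where c': "c' \<in> A" "fst e' \<subseteq> fst c'" "snd e' = snd c'" "open (snd c' ` fst e')"
    using B by blast
  let ?O = "snd c ` (fst c \<inter> fst c')" and ?T = "transition c c'"
  have O: "open ?O" by (rule atlas_open[OF dA c(1) c'(1)])
  have T: "smooth_on ?O ?T"
    using A c(1) c'(1) by (simp add: smooth_atlas_def)
  then have "continuous_on ?O ?T"
    unfolding smooth_on_def using Ck_on.simps(1) by blast
  then have "open (?O \<inter> ?T -` (snd c' ` fst e'))"
    by (rule continuous_open_preimage[OF _ O c'(4)])
  moreover have "snd e ` (fst e \<inter> fst e') = (?O \<inter> ?T -` (snd c' ` fst e')) \<inter> snd c ` fst e"
  proof (intro equalityI subsetI)
    fix z assume "z \<in> snd e ` (fst e \<inter> fst e')"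
    then obtain q where "z = snd c q" "q \<in> fst e" "q \<in> fst e'" using c(3) by auto
    then show "z \<in> (?O \<inter> ?T -` (snd c' ` fst e')) \<inter> snd c ` fst e"
      using c(2) c'(2) transition_chart[OF atlas_inj[OF dA c(1)], of q c'] by auto
  next
    fix z assume z: "z \<in> (?O \<inter> ?T -` (snd c' ` fst e')) \<inter> snd c ` fst e"
    then obtain q where q: "z = snd c q" "q \<in> fst c" "q \<in> fst c'" by auto
    have "q \<in> fst e"
      using z q c(2) atlas_inj[OF dA c(1)] by (auto dest: inj_onD)
    moreover have "snd c' q \<in> snd c' ` fst e'"
      using z q transition_chart[OF atlas_inj[OF dA c(1)], of q c'] by auto
    then have "q \<in> fst e'"
      using q c'(2) atlas_inj[OF dA c'(1)] by (auto dest: inj_onD)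
    ultimately show "z \<in> snd e ` (fst e \<inter> fst e')"
      using q(1) c(3) by auto
  qed
  ultimately show opn: "open (snd e ` (fst e \<inter> fst e'))"
    using c(4) by (simp add: open_Int)
  have sub: "snd e ` (fst e \<inter> fst e') \<subseteq> ?O"
    using c(2,3) c'(2) by auto
  show "smooth_on (snd e ` (fst e \<inter> fst e')) (transition e e')"
  proof (rule smooth_on_cong[OF smooth_on_subset[OF T sub] opn])
    fix z assume "z \<in> snd e ` (fst e \<inter> fst e')"
    then obtain q where q: "z = snd e q" "q \<in> fst e" by auto
    then have "transition e e' z = snd c' q"
      using transition_chart[OF inj, of q e'] c'(3) by simp
    moreover have "?T z = snd c' q"
      using transition_chart[OF atlas_inj[OF dA c(1)], of q c'] q c(2,3) by auto
    ultimately show "?T z = transition e e' z" by simp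
  qed
qed

text \<open>This is where maximality of the atlas is used. Restricted charts carry local maps that are smooth
  only on a small neighbourhood.\<close>
lemma restricted_chart_in_atlas:
  assumes A: "smooth_manifold A" and c: "c \<in> A" and W: "W \<subseteq> fst c" "open (snd c ` W)"
  shows "(W, snd c) \<in> A"
proof -
  have sA: "smooth_atlas A" using A by (simp add: smooth_manifold_def)
  have "smooth_atlas (insert (W, snd c) A)"
  proof (rule smooth_atlas_restrictions[OF sA])
    fix e assume "e \<in> insert (W, snd c) A"
    then show "\<exists>c\<in>A. fst e \<subseteq> fst c \<and> snd e = snd c \<and> open (snd c ` fst e)"
      using c W atlas_open_image[OF smooth_atlas_imp_differentiable_atlas[OF sA]]
      by (metis fst_conv insertE order_refl snd_conv)
  qed
  then show ?thesis using A by (simp add: smooth_manifold_def)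
qed

lemma openin_manifold_topology:
  assumes A: "differentiable_atlas A"
  shows "openin (manifold_topology A) U \<longleftrightarrow>
    U \<subseteq> points A \<and> (\<forall>c\<in>A. open (snd c ` (U \<inter> fst c)))"
proof -
  have "istopology (\<lambda>U. U \<subseteq> points A \<and> (\<forall>c\<in>A. open (snd c ` (U \<inter> fst c))))"
    unfolding istopology_def
  proof (intro conjI allI impI ballI; (elim conjE)?)
    fix S T c
    assume "\<forall>c\<in>A. open (snd c ` (S \<inter> fst c))" "\<forall>c\<in>A. open (snd c ` (T \<inter> fst c))" "c \<in> A"
    moreover have "snd c ` (S \<inter> T \<inter> fst c) = snd c ` (S \<inter> fst c) \<inter> snd c ` (T \<inter> fst c)"
      if "c \<in> A" using atlas_inj[OF A that] by (auto dest: inj_onD)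
    ultimately show "open (snd c ` (S \<inter> T \<inter> fst c))" by (simp add: open_Int)
  next
    fix K c
    assume "\<forall>S\<in>K. S \<subseteq> points A \<and> (\<forall>c\<in>A. open (snd c ` (S \<inter> fst c)))" "c \<in> A"
    moreover have "snd c ` (\<Union> K \<inter> fst c) = (\<Union>S\<in>K. snd c ` (S \<inter> fst c))" by auto
    ultimately show "open (snd c ` (\<Union> K \<inter> fst c))" by auto
  qed auto
  then show ?thesis
    by (simp add: manifold_topology_def topology_inverse')
qed

lemma openin_chart_overlap:
  assumes A: "differentiable_atlas A" and "c \<in> A" "c' \<in> A"
  shows "openin (manifold_topology A) (fst c \<inter> fst c')"
  unfolding openin_manifold_topology[OF A]
proof (intro conjI ballI)
  show "fst c \<inter> fst c' \<subseteq> points A"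
    using assms by (auto simp: points_def)
  fix e assume e: "e \<in> A"
  have "snd e ` (fst c \<inter> fst c' \<inter> fst e) = snd e ` (fst e \<inter> fst c) \<inter> snd e ` (fst e \<inter> fst c')"
    using atlas_inj[OF A e] by (auto dest: inj_onD)
  then show "open (snd e ` (fst c \<inter> fst c' \<inter> fst e))"
    using atlas_open[OF A e] assms by (simp add: open_Int)
qed

lemma eventually_change_chart:
  assumes A: "differentiable_atlas A" and c: "c \<in> A" "c' \<in> A" "p \<in> fst c" "p \<in> fst c'"
    and ev: "\<forall>\<^sub>F z in nhds (snd c' p). P (chart_inv c' z)"
  shows "\<forall>\<^sub>F z in nhds (snd c p). P (chart_inv c z)"
proof -
  have "isCont (transition c c') (snd c p)"
    by (rule has_derivative_continuous[OF transition_has_derivative[OF A c]])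
  then have "filterlim (transition c c') (nhds (transition c c' (snd c p))) (nhds (snd c p))"
    by (simp only: isCont_def tendsto_at_iff_tendsto_nhds)
  then have "filterlim (transition c c') (nhds (snd c' p)) (nhds (snd c p))"
    using transition_chart[OF atlas_inj[OF A c(1)] c(3), of c'] by simp
  then have "\<forall>\<^sub>F z in nhds (snd c p). P (chart_inv c' (transition c c' z))"
    using ev unfolding filterlim_iff by blast
  moreover have "\<forall>\<^sub>F z in nhds (snd c p). z \<in> snd c ` (fst c \<inter> fst c')"
    using c by (intro eventually_nhds_in_open atlas_open[OF A]) auto
  ultimately show ?thesis
  proof eventually_elim
    case (elim z)
    then obtain q where "z = snd c q" "q \<in> fst c" "q \<in> fst c'" by auto
    then show ?case
      using elim(1) transition_chart[OF atlas_inj[OF A c(1)], of q c']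
        chart_inv_chart[OF atlas_inj[OF A c(1)], of q] chart_inv_chart[OF atlas_inj[OF A c(2)], of q]
      by simp
  qed
qed

text \<open>Smoothness at a point provides one pair of charts, and the conclusion is about every pair: the
  map stays in the given target chart near \<open>p\<close> by continuity, and the chart expressions are related by
  transition maps on both sides.\<close>
lemma smooth_at_local_representative:
  assumes A: "differentiable_atlas A" and B: "differentiable_atlas B" and s: "smooth_at A B s p"
    and c: "c \<in> A" "p \<in> fst c" and d: "d \<in> B" "s p \<in> fst d"
  shows "(snd d \<circ> s \<circ> chart_inv c) differentiable (at (snd c p))"
    and "\<forall>\<^sub>F z in nhds (snd c p). s (chart_inv c z) \<in> fst d"
proof -
  obtain c1 d1 where c1: "c1 \<in> A" "p \<in> fst c1" and d1: "d1 \<in> B" "s ` fst c1 \<subseteq> fst d1"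
    and sm: "smooth_on (snd c1 ` fst c1) (snd d1 \<circ> s \<circ> chart_inv c1)"
    using s unfolding smooth_at_def by blast
  let ?e = "snd d1 \<circ> s \<circ> chart_inv c1"
  have p1: "chart_inv c1 (snd c1 p) = p" "snd c1 p \<in> snd c1 ` fst c1"
    using chart_inv_chart[OF atlas_inj[OF A c1(1)] c1(2)] c1(2) by auto
  have sp: "s p \<in> fst d1" using d1(2) c1(2) by auto
  have de: "(?e has_derivative frechet_derivative ?e (at (snd c1 p))) (at (snd c1 p))"
    by (rule has_derivative_frechet[OF smooth_on_differentiable[OF sm p1(2)]])
  have "filterlim ?e (nhds (?e (snd c1 p))) (nhds (snd c1 p))"
    using has_derivative_continuous[OF de] by (simp only: isCont_def tendsto_at_iff_tendsto_nhds)
  then have "filterlim ?e (nhds (snd d1 (s p))) (nhds (snd c1 p))"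
    using p1(1) by simp
  moreover have "\<forall>\<^sub>F y in nhds (snd d1 (s p)). y \<in> snd d1 ` (fst d1 \<inter> fst d)"
    using d sp by (intro eventually_nhds_in_open atlas_open[OF B d1(1) d(1)]) auto
  ultimately have "\<forall>\<^sub>F z in nhds (snd c1 p). ?e z \<in> snd d1 ` (fst d1 \<inter> fst d)"
    unfolding filterlim_iff by blast
  moreover have "\<forall>\<^sub>F z in nhds (snd c1 p). z \<in> snd c1 ` fst c1"
    using c1 by (intro eventually_nhds_in_open atlas_open_image[OF A]) auto
  ultimately have near1: "\<forall>\<^sub>F z in nhds (snd c1 p).
      s (chart_inv c1 z) \<in> fst d1 \<and> s (chart_inv c1 z) \<in> fst d"
  proof eventually_elim
    case (elim z)
    then obtain q where q: "z = snd c1 q" "q \<in> fst c1" by auto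
    then have iq: "chart_inv c1 z = q" by (simp add: chart_inv_chart[OF atlas_inj[OF A c1(1)]])
    then have "s q \<in> fst d1" using q d1(2) by auto
    moreover have "snd d1 (s q) \<in> snd d1 ` (fst d1 \<inter> fst d)" using elim(1) iq by simp
    ultimately have "s q \<in> fst d" using atlas_inj[OF B d1(1)] by (auto dest: inj_onD)
    with \<open>s q \<in> fst d1\<close> show ?case using iq by simp
  qed
  then have "\<forall>\<^sub>F z in nhds (snd c1 p). s (chart_inv c1 z) \<in> fst d"
    by (rule eventually_mono) simp
  then show "\<forall>\<^sub>F z in nhds (snd c p). s (chart_inv c z) \<in> fst d"
    by (rule eventually_change_chart[OF A c(1) c1(1) c(2) c1(2)])
  have "(transition d1 d has_derivative dtrans d1 d (s p)) (at (?e (snd c1 p)))"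
    using transition_has_derivative[OF B d1(1) d(1) sp d(2)] p1(1) by simp
  then have "(transition d1 d \<circ> ?e has_derivative
      (dtrans d1 d (s p) \<circ> frechet_derivative ?e (at (snd c1 p)))) (at (snd c1 p))"
    by (rule diff_chain_at[OF de])
  moreover have "\<forall>\<^sub>F z in nhds (snd c1 p). (transition d1 d \<circ> ?e) z = (snd d \<circ> s \<circ> chart_inv c1) z"
    using near1 by (rule eventually_mono) (simp add: transition_chart[OF atlas_inj[OF B d1(1)]])
  then have "\<forall>\<^sub>F z in at (snd c1 p). (transition d1 d \<circ> ?e) z = (snd d \<circ> s \<circ> chart_inv c1) z"
    and "(transition d1 d \<circ> ?e) (snd c1 p) = (snd d \<circ> s \<circ> chart_inv c1) (snd c1 p)"
    by (auto simp: eventually_nhds_conv_at)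
  ultimately have "(snd d \<circ> s \<circ> chart_inv c1 has_derivative
      (dtrans d1 d (s p) \<circ> frechet_derivative ?e (at (snd c1 p)))) (at (snd c1 p))"
    by (rule has_derivative_transform_eventually) auto
  from has_derivative_change_chart[OF A c(1) c1(1) c(2) c1(2) this]
  show "(snd d \<circ> s \<circ> chart_inv c) differentiable (at (snd c p))"
    unfolding differentiable_def by blast
qed

section \<open>The transformation law of a linear connection\<close>

text \<open>The Jacobian as a function of the point, so that it can be differentiated once more.\<close>
definition jacobian_field :: "(real^'n \<Rightarrow> real^'m) \<Rightarrow> real^'n \<Rightarrow> real^'n^'m"
  where "jacobian_field f x = jacobian f (at x)"

lemma jacobian_mult:
  "f differentiable (at x) \<Longrightarrow> jacobian_field f x *v w = frechet_derivative f (at x) w"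
  unfolding jacobian_field_def jacobian_def
  by (simp add: linear_frechet_derivative matrix_works linear_matrix_vector_mul_eq)

lemma differentiable_vec:
  fixes f :: "'c::real_normed_vector \<Rightarrow> 'a::euclidean_space^'b"
  assumes "\<And>i. (\<lambda>x. f x $ i) differentiable (at x)"
  shows "f differentiable (at x)"
proof (subst differentiable_componentwise_within, intro ballI)
  fix b :: "'a ^ 'b" assume "b \<in> Basis"
  then obtain i u where b: "b = axis i u" "u \<in> Basis" by (auto simp: Basis_vec_def)
  then have "(\<lambda>x. f x \<bullet> b) = (\<lambda>x. f x $ i \<bullet> u)" by (auto simp: inner_axis)
  then show "(\<lambda>x. f x \<bullet> b) differentiable (at x)"
    using bounded_linear_imp_differentiable
      differentiable_chain_at[OF assms[of i], of "\<lambda>y. y \<bullet> u"] bounded_linear_inner_left[of u]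
    by (simp add: o_def)
qed

lemma jacobian_has_derivative:
  assumes "smooth_on S f" "open S" "x \<in> S"
  shows "(jacobian_field f has_derivative frechet_derivative (jacobian_field f) (at x)) (at x)"
proof (rule has_derivative_frechet, intro differentiable_vec)
  fix i j
  have "(\<lambda>z. frechet_derivative f (at z) (axis j 1)) differentiable (at x)"
    by (rule smooth_on_differentiable[OF smooth_on_frechet_derivative[OF assms(1)] assms(3)])
  then have "(\<lambda>z. frechet_derivative f (at z) (axis j 1) $ i) differentiable (at x)"
    using differentiable_def bounded_linear.has_derivative[OF bounded_linear_vec_nth] by metis
  then show "(\<lambda>z. jacobian_field f z $ i $ j) differentiable (at x)"
    by (simp add: jacobian_field_def jacobian_def matrix_def)
qed

lemma dtrans_eq_jacobian:
  assumes A: "differentiable_atlas A" and c: "c \<in> A" "c' \<in> A" "p \<in> fst c" "p \<in> fst c'"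
  shows "dtrans c c' p = (*v) (jacobian_field (transition c c') (snd c p))"
proof -
  have "transition c c' differentiable (at (snd c p))"
    using transition_has_derivative[OF A c] unfolding differentiable_def by blast
  from jacobian_mult[OF this] show ?thesis by (intro ext) simp
qed

lemma jacobian_inverse:
  assumes A: "differentiable_atlas A" and c: "c \<in> A" "c' \<in> A" "p \<in> fst c" "p \<in> fst c'"
  shows "jacobian_field (transition c c') (snd c p) ** jacobian_field (transition c' c) (snd c' p) = mat 1"
  unfolding matrix_eq
proof
  fix w
  have "dtrans c c' p (dtrans c' c p w) = w"
    using dtrans_compose[OF A c(2,1,2,4,3,4)] dtrans_same[OF A c(2,4)] by simp
  then show "(jacobian_field (transition c c') (snd c p) **
      jacobian_field (transition c' c) (snd c' p)) *v w = mat 1 *v w"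
    by (simp add: matrix_vector_mul_assoc[symmetric] dtrans_eq_jacobian[OF A c]
        dtrans_eq_jacobian[OF A c(2,1,4,3)])
qed

text \<open>The matrix of connection one-forms evaluated on a direction: with it, the covariant derivative of
  a field with components \<open>w\<close> is the derivative of \<open>w\<close> plus this matrix applied to \<open>w\<close>.\<close>
definition connection_matrix ::
  "('p, real^'k) chart set \<Rightarrow> ('p, real^'k) cov_deriv \<Rightarrow> ('p, real^'k) chart \<Rightarrow>
   'p \<Rightarrow> real^'k \<Rightarrow> real^'k^'k"
  where "connection_matrix A D c p v = (\<chi> k b. \<Sum>a\<in>UNIV. v $ a * christoffel A D c p a k b)"

lemma sum_fun_apply: "(\<Sum>i\<in>I. f i) x = (\<Sum>i\<in>I. f i x)"
  for f :: "'i \<Rightarrow> 'a \<Rightarrow> 'b::comm_monoid_add"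
  by (induction I rule: infinite_finite_induct) auto

lemma vector_fieldD: "\<lbrakk>Y \<in> vector_fields A U; p \<in> U\<rbrakk> \<Longrightarrow> Y p \<in> tangent_space A p"
  by (simp add: vector_fields_def)

lemma vector_fields_sum:
  assumes A: "differentiable_atlas A"
    and Y: "\<And>i. i \<in> I \<Longrightarrow> Y i \<in> vector_fields A U"
  shows "(\<lambda>q. \<Sum>i\<in>I. Y i q) \<in> vector_fields A U"
  unfolding vector_fields_def
proof (intro CollectI conjI ballI impI)
  fix p assume "p \<in> U"
  then show "(\<Sum>i\<in>I. Y i p) \<in> tangent_space A p"
    using Y by (intro subspace_sum[OF subspace_tangent_space[OF A]] vector_fieldD) auto
next
  fix c assume "c \<in> A" "fst c \<subseteq> U"
  then have "smooth_on (snd c ` fst c) (\<lambda>z. \<Sum>i\<in>I. Y i (chart_inv c z) c)"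
    using Y by (intro smooth_on_sum atlas_open_image[OF A]) (auto simp: vector_fields_def)
  then show "smooth_on (snd c ` fst c) (\<lambda>z. (\<Sum>i\<in>I. Y i (chart_inv c z)) c)"
    by (simp add: sum_fun_apply)
qed

lemma manifold_smooth_atlas: "smooth_manifold A \<Longrightarrow> smooth_atlas A"
  by (simp add: smooth_manifold_def)

lemma manifold_atlas: "smooth_manifold A \<Longrightarrow> differentiable_atlas A"
  by (rule smooth_atlas_imp_differentiable_atlas[OF manifold_smooth_atlas])

context
  fixes A :: "('p, real^'k) chart set"
  assumes A: "smooth_manifold A"
begin

lemma smooth_on_dtrans_compose:
  assumes "c \<in> A" "c' \<in> A" "e \<in> A" "fst e \<subseteq> fst c \<inter> fst c'"
  shows "smooth_on (snd e ` fst e) (\<lambda>z. dtrans c c' (chart_inv e z) w)"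
proof -
  note dA = manifold_atlas[OF A]
  have sm: "smooth_on (snd c ` (fst c \<inter> fst c')) (\<lambda>x. frechet_derivative (transition c c') (at x) w)"
    using manifold_smooth_atlas[OF A] assms(1,2)
    by (intro smooth_on_frechet_derivative) (simp add: smooth_atlas_def)
  have "smooth_on (snd e ` (fst e \<inter> fst c)) (transition e c)"
    using manifold_smooth_atlas[OF A] assms(1,3) by (simp add: smooth_atlas_def)
  moreover have "fst e \<inter> fst c = fst e" using assms(4) by auto
  ultimately have "smooth_on (snd e ` fst e) (transition e c)" by simp
  from smooth_on_compose[OF sm this atlas_open_image[OF dA assms(3)]]
  have "smooth_on (snd e ` fst e)
      (\<lambda>z. frechet_derivative (transition c c') (at (transition e c z)) w)"
    using assms(4) transition_chart[OF atlas_inj[OF dA assms(3)], of _ c] by fastforce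
  then show ?thesis by (simp add: transition_def)
qed

lemma tangent_of_coords_vector_field:
  assumes "c \<in> A" "U \<subseteq> fst c"
  shows "(\<lambda>q. tangent_of_coords A c q w) \<in> vector_fields A U"
  unfolding vector_fields_def
proof (intro CollectI conjI ballI impI)
  note dA = manifold_atlas[OF A]
  fix p assume "p \<in> U"
  then show "tangent_of_coords A c p w \<in> tangent_space A p"
    using assms by (intro tangent_of_coords_in_tangent_space[OF dA]) auto
next
  note dA = manifold_atlas[OF A]
  fix e assume e: "e \<in> A" "fst e \<subseteq> U"
  have "smooth_on (snd e ` fst e) (\<lambda>z. dtrans c e (chart_inv e z) w)"
    using assms e by (intro smooth_on_dtrans_compose) auto
  then show "smooth_on (snd e ` fst e) (\<lambda>z. tangent_of_coords A c (chart_inv e z) w e)"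
  proof (rule smooth_on_cong[OF _ atlas_open_image[OF dA e(1)]])
    fix z assume "z \<in> snd e ` fst e"
    then show "dtrans c e (chart_inv e z) w = tangent_of_coords A c (chart_inv e z) w e"
      using e(1) chart_inv_chart[OF atlas_inj[OF dA e(1)]] by (auto simp: tangent_of_coords_def)
  qed
qed

lemma smooth_function_dtrans_component:
  assumes "c \<in> A" "c' \<in> A"
  shows "(\<lambda>q. dtrans c c' q w $ k) \<in> smooth_functions A (fst c \<inter> fst c')"
proof -
  note dA = manifold_atlas[OF A]
  \<comment> \<open>The function is smooth only on the overlap, so the chart witnessing smoothness is cut down to it.\<close>
  define e where "e = (fst c \<inter> fst c', snd c)"
  have e: "e \<in> A"
    unfolding e_def using assms by (intro restricted_chart_in_atlas[OF A] atlas_open[OF dA]) auto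
  have "smooth_on (snd e ` fst e) (\<lambda>z. dtrans c c' (chart_inv e z) w $ k)"
    using assms e by (intro smooth_on_linear[OF smooth_on_dtrans_compose _ bounded_linear_vec_nth]
        atlas_open_image[OF dA]) (auto simp: e_def)
  then show ?thesis
    unfolding smooth_functions_def smooth_at_def using e
    by (intro CollectI ballI bexI[of _ e] bexI[of _ "(UNIV, \<lambda>t. t)"]) (auto simp: o_def e_def)
qed

lemma smooth_multiple_vector_field:
  assumes "c \<in> A" "c' \<in> A"
  shows "(\<lambda>q. (dtrans c c' q w $ k) *\<^sub>R tangent_of_coords A c' q u) \<in>
    vector_fields A (fst c \<inter> fst c')"
  unfolding vector_fields_def
proof (intro CollectI conjI ballI impI)
  note dA = manifold_atlas[OF A]
  fix p assume "p \<in> fst c \<inter> fst c'"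
  then show "(dtrans c c' p w $ k) *\<^sub>R tangent_of_coords A c' p u \<in> tangent_space A p"
    using assms
    by (intro subspace_scale[OF subspace_tangent_space[OF dA]]
        tangent_of_coords_in_tangent_space[OF dA]) auto
next
  note dA = manifold_atlas[OF A]
  fix e assume e: "e \<in> A" "fst e \<subseteq> fst c \<inter> fst c'"
  have "smooth_on (snd e ` fst e) (\<lambda>z. dtrans c c' (chart_inv e z) w $ k)"
    using assms e by (intro smooth_on_linear[OF smooth_on_dtrans_compose _ bounded_linear_vec_nth]
        atlas_open_image[OF dA]) auto
  moreover have "smooth_on (snd e ` fst e) (\<lambda>z. tangent_of_coords A c' (chart_inv e z) u e)"
    using tangent_of_coords_vector_field[OF assms(2), of "fst c \<inter> fst c'" u] e
    by (auto simp: vector_fields_def)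
  ultimately have "smooth_on (snd e ` fst e) (\<lambda>z. (dtrans c c' (chart_inv e z) w $ k) *\<^sub>R
      tangent_of_coords A c' (chart_inv e z) u e)"
    by (rule smooth_on_scaleR[OF _ _ atlas_open_image[OF dA e(1)]])
  then show "smooth_on (snd e ` fst e) (\<lambda>z. ((dtrans c c' (chart_inv e z) w $ k) *\<^sub>R
      tangent_of_coords A c' (chart_inv e z) u) e)"
    by (simp add: scaleR_fun_def)
qed

end

context
  fixes A :: "('p, real^'k) chart set" and D :: "('p, real^'k) cov_deriv"
  assumes A: "smooth_manifold A" and D: "linear_connection A D"
begin

lemma
  assumes U: "openin (manifold_topology A) U" "p \<in> U" and v: "v \<in> tangent_space A p"
    and Y: "Y \<in> vector_fields A U"
  shows connection_in_tangent_space: "D p v Y \<in> tangent_space A p"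
    and connection_add_direction:
      "w \<in> tangent_space A p \<Longrightarrow> D p (v + w) Y = D p v Y + D p w Y"
    and connection_scale_direction: "D p (r *\<^sub>R v) Y = r *\<^sub>R D p v Y"
    and connection_add_field: "Z \<in> vector_fields A U \<Longrightarrow> D p v (Y + Z) = D p v Y + D p v Z"
    and connection_Leibniz: "f \<in> smooth_functions A U \<Longrightarrow>
      D p v (\<lambda>q. f q *\<^sub>R Y q) = dir_deriv A f p v *\<^sub>R Y p + f p *\<^sub>R D p v Y"
    and connection_local: "\<lbrakk>Z \<in> vector_fields A U; \<And>q. q \<in> U \<Longrightarrow> Y q = Z q\<rbrakk> \<Longrightarrow> D p v Y = D p v Z"
proof -
  note H = conjunct1[OF D[unfolded linear_connection_def, THEN spec, THEN mp, OF U(1)],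
      THEN bspec, OF Y, THEN bspec, OF U(2)]
  note H1 = H[THEN conjunct1] and H2 = H[THEN conjunct2, THEN conjunct1]
    and H3 = H[THEN conjunct2, THEN conjunct2, THEN conjunct1]
    and H4 = H[THEN conjunct2, THEN conjunct2, THEN conjunct2, THEN conjunct1]
    and H5 = H[THEN conjunct2, THEN conjunct2, THEN conjunct2, THEN conjunct2, THEN conjunct1]
    and H6 = H[THEN conjunct2, THEN conjunct2, THEN conjunct2, THEN conjunct2, THEN conjunct2]
  show "D p v Y \<in> tangent_space A p" by (rule H1[THEN bspec, OF v])
  show "D p (v + w) Y = D p v Y + D p w Y" if "w \<in> tangent_space A p"
    by (rule H2[THEN bspec, OF v, THEN bspec, OF that])
  show "D p (r *\<^sub>R v) Y = r *\<^sub>R D p v Y" by (rule H3[THEN spec, THEN bspec, OF v])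
  show "D p v (Y + Z) = D p v Y + D p v Z" if "Z \<in> vector_fields A U"
    by (rule H4[THEN bspec, OF v, THEN bspec, OF that])
  show "D p v (\<lambda>q. f q *\<^sub>R Y q) = dir_deriv A f p v *\<^sub>R Y p + f p *\<^sub>R D p v Y"
    if "f \<in> smooth_functions A U"
    by (rule H5[THEN bspec, OF v, THEN bspec, OF that])
  show "D p v Y = D p v Z" if "Z \<in> vector_fields A U" "\<And>q. q \<in> U \<Longrightarrow> Y q = Z q"
    using H6[THEN bspec, OF v, THEN bspec, OF that(1)] that(2) by simp
qed

lemma connection_sum_fields:
  assumes U: "openin (manifold_topology A) U" "p \<in> U" and v: "v \<in> tangent_space A p"
    and Y: "\<And>i. i \<in> I \<Longrightarrow> Y i \<in> vector_fields A U" and "finite I"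
  shows "D p v (\<lambda>q. \<Sum>i\<in>I. Y i q) = (\<Sum>i\<in>I. D p v (Y i))"
  using \<open>finite I\<close> Y
proof (induction I)
  case empty
  have Z: "(\<lambda>q. 0) \<in> vector_fields A U"
    using vector_fields_sum[OF manifold_atlas[OF A], of "{}" "\<lambda>i q. 0" U] by simp
  \<comment> \<open>Additivity alone yields the value at the zero field: it equals twice itself.\<close>
  then have "D p v ((\<lambda>q. 0) + (\<lambda>q. 0)) = D p v (\<lambda>q. 0) + D p v (\<lambda>q. 0)"
    by (rule connection_add_field[OF U v _ Z])
  moreover have "(\<lambda>q. 0) + (\<lambda>q. 0) = (\<lambda>q::'p. 0 :: ('p, real^'k) tvec)"
    by (simp add: fun_eq_iff)
  ultimately have "D p v (\<lambda>q. 0) = 0" by (metis add_cancel_right_right)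
  then show ?case by (simp only: sum.empty)
next
  case (insert i I)
  have "Y i \<in> vector_fields A U" using insert.prems by simp
  moreover have "(\<lambda>q. \<Sum>i\<in>I. Y i q) \<in> vector_fields A U"
    using insert.prems by (intro vector_fields_sum[OF manifold_atlas[OF A]]) simp
  ultimately have "D p v (Y i + (\<lambda>q. \<Sum>i\<in>I. Y i q)) = D p v (Y i) + D p v (\<lambda>q. \<Sum>i\<in>I. Y i q)"
    by (rule connection_add_field[OF U v])
  moreover have "Y i + (\<lambda>q. \<Sum>i\<in>I. Y i q) = (\<lambda>q. \<Sum>i\<in>insert i I. Y i q)"
    using insert.hyps by (simp add: fun_eq_iff)
  moreover have "D p v (\<lambda>q. \<Sum>i\<in>I. Y i q) = (\<Sum>i\<in>I. D p v (Y i))"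
    using insert.IH insert.prems by simp
  ultimately show ?case
    unfolding sum.insert[OF insert.hyps(1,2)] by (simp only:)
qed

lemma connection_sum_directions:
  assumes U: "openin (manifold_topology A) U" "p \<in> U" and Y: "Y \<in> vector_fields A U"
    and X: "\<And>i. i \<in> I \<Longrightarrow> X i \<in> tangent_space A p" and "finite I"
  shows "D p (\<Sum>i\<in>I. r i *\<^sub>R X i) Y = (\<Sum>i\<in>I. r i *\<^sub>R D p (X i) Y)"
proof -
  note sub = subspace_tangent_space[OF manifold_atlas[OF A], of p]
  have scale: "D p (r *\<^sub>R v) Y = r *\<^sub>R D p v Y" if "v \<in> tangent_space A p" for r v
    by (rule connection_scale_direction[OF U that Y])
  have add: "D p (v + w) Y = D p v Y + D p w Y"
    if "v \<in> tangent_space A p" "w \<in> tangent_space A p" for v w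
    by (rule connection_add_direction[OF U that(1) Y that(2)])
  show ?thesis
    using \<open>finite I\<close> X
  proof (induction I)
    case empty
    have "D p 0 Y = 0" using scale[OF subspace_0[OF sub], of 0] by (simp only: scaleR_zero_left)
    then show ?case by (simp only: sum.empty)
  next
    case (insert i I)
    have "r i *\<^sub>R X i \<in> tangent_space A p"
      using insert.prems by (intro subspace_scale[OF sub]) simp
    moreover have "(\<Sum>i\<in>I. r i *\<^sub>R X i) \<in> tangent_space A p"
      using insert.prems by (intro subspace_sum[OF sub] subspace_scale[OF sub]) simp
    moreover have "D p (r i *\<^sub>R X i) Y = r i *\<^sub>R D p (X i) Y"
      using insert.prems by (intro scale) simp
    moreover have "D p (\<Sum>i\<in>I. r i *\<^sub>R X i) Y = (\<Sum>i\<in>I. r i *\<^sub>R D p (X i) Y)"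
      using insert.IH insert.prems by simp
    ultimately show ?case
      unfolding sum.insert[OF insert.hyps(1,2)] using add by (simp only:)
  qed
qed

lemma connection_coord_field_component:
  assumes c: "c \<in> A" "p \<in> fst c" and v: "v \<in> tangent_space A p"
  shows "D p v (coord_field A c k) c = column k (connection_matrix A D c p (v c))"
proof -
  note dA = manifold_atlas[OF A]
  have X: "coord_field A c a p \<in> tangent_space A p" for a
    unfolding coord_field_def by (rule tangent_of_coords_in_tangent_space[OF dA c])
  have "v = (\<Sum>a\<in>UNIV. (v c $ a) *\<^sub>R coord_field A c a p)"
  proof (rule tangent_space_eqI[OF dA v _ c])
    show "(\<Sum>a\<in>UNIV. (v c $ a) *\<^sub>R coord_field A c a p) \<in> tangent_space A p"
      using X subspace_tangent_space[OF dA] by (intro subspace_sum subspace_scale) auto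
    show "v c = (\<Sum>a\<in>UNIV. (v c $ a) *\<^sub>R coord_field A c a p) c"
      using c by (simp add: sum_fun_apply scaleR_fun_def coord_field_def
          tangent_of_coords_same[OF dA] vec_eq_iff axis_def if_distrib cong: if_cong)
  qed
  moreover have "coord_field A c k \<in> vector_fields A (fst c)"
    unfolding coord_field_def[abs_def] using c by (intro tangent_of_coords_vector_field[OF A]) auto
  then have "D p (\<Sum>a\<in>UNIV. (v c $ a) *\<^sub>R coord_field A c a p) (coord_field A c k) =
      (\<Sum>a\<in>UNIV. (v c $ a) *\<^sub>R D p (coord_field A c a p) (coord_field A c k))"
    using openin_chart_overlap[OF dA c(1) c(1)] c X
    by (intro connection_sum_directions[of "fst c"]) auto
  ultimately have "D p v (coord_field A c k) c =
      (\<Sum>a\<in>UNIV. (v c $ a) *\<^sub>R D p (coord_field A c a p) (coord_field A c k) c)"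
    by (metis (no_types, lifting) scaleR_fun_def sum.cong sum_fun_apply)
  then show ?thesis
    by (simp add: vec_eq_iff column_def connection_matrix_def christoffel_def)
qed

text \<open>The field with constant components \<open>w\<close> in the chart \<open>c\<close> has the components \<open>J w\<close> in \<open>c'\<close>, where
  \<open>J\<close> is the Jacobian of the transition map. Expanding it in the coordinate fields of \<open>c'\<close> and applying
  the Leibniz rule gives one term with the derivative of \<open>J\<close> and one with the Christoffel symbols.\<close>
lemma connection_constant_field:
  assumes c: "c \<in> A" "p \<in> fst c" and c': "c' \<in> A" "p \<in> fst c'" and v: "v \<in> tangent_space A p"
  shows "D p v (\<lambda>q. tangent_of_coords A c q w) c' =
    frechet_derivative (jacobian_field (transition c c')) (at (snd c p)) (v c) *v w +
    connection_matrix A D c' p (v c') *v dtrans c c' p w"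
proof -
  note dA = manifold_atlas[OF A]
  let ?U = "fst c \<inter> fst c'" and ?T = "transition c c'"
  let ?f = "\<lambda>k q. dtrans c c' q w $ k" and ?Y = "coord_field A c'"
  have U: "openin (manifold_topology A) ?U" "p \<in> ?U"
    using openin_chart_overlap[OF dA c(1) c'(1)] c c' by auto
  have Y: "?Y k \<in> vector_fields A ?U" for k
    unfolding coord_field_def[abs_def] using c'(1) by (intro tangent_of_coords_vector_field[OF A]) auto
  have W: "(\<lambda>q. tangent_of_coords A c q w) \<in> vector_fields A ?U"
    using c(1) by (intro tangent_of_coords_vector_field[OF A]) auto
  have fY: "(\<lambda>q. ?f k q *\<^sub>R ?Y k q) \<in> vector_fields A ?U" for k
    unfolding coord_field_def[abs_def] by (rule smooth_multiple_vector_field[OF A c(1) c'(1)])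
  have f: "?f k \<in> smooth_functions A ?U" for k
    by (rule smooth_function_dtrans_component[OF A c(1) c'(1)])
  have expand: "tangent_of_coords A c q w = (\<Sum>k\<in>UNIV. ?f k q *\<^sub>R ?Y k q)" if q: "q \<in> ?U" for q
  proof (rule tangent_space_eqI[OF dA])
    show "tangent_of_coords A c q w \<in> tangent_space A q" using W q by (rule vector_fieldD)
    show "(\<Sum>k\<in>UNIV. ?f k q *\<^sub>R ?Y k q) \<in> tangent_space A q"
      using fY q by (intro subspace_sum[OF subspace_tangent_space[OF dA]]) (rule vector_fieldD)
    show "c' \<in> A" "q \<in> fst c'" using c' q by auto
    then show "tangent_of_coords A c q w c' = (\<Sum>k\<in>UNIV. ?f k q *\<^sub>R ?Y k q) c'"
      by (simp add: sum_fun_apply scaleR_fun_def coord_field_def tangent_of_coords_same[OF dA]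
          vec_eq_iff axis_def if_distrib tangent_of_coords_def[of A c] cong: if_cong)
  qed
  have "D p v (\<lambda>q. tangent_of_coords A c q w) = D p v (\<lambda>q. \<Sum>k\<in>UNIV. ?f k q *\<^sub>R ?Y k q)"
    by (rule connection_local[OF U v W vector_fields_sum[OF dA fY] expand])
  also have "\<dots> = (\<Sum>k\<in>UNIV. D p v (\<lambda>q. ?f k q *\<^sub>R ?Y k q))"
    using fY by (intro connection_sum_fields[OF U v]) auto
  also have "\<dots> = (\<Sum>k\<in>UNIV. dir_deriv A (?f k) p v *\<^sub>R ?Y k p + ?f k p *\<^sub>R D p v (?Y k))"
    by (intro sum.cong refl connection_Leibniz[OF U v Y f])
  finally have eq: "D p v (\<lambda>q. tangent_of_coords A c q w) c' =
      (\<Sum>k\<in>UNIV. dir_deriv A (?f k) p v *\<^sub>R axis k 1 +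
        ?f k p *\<^sub>R column k (connection_matrix A D c' p (v c')))"
    using c' v by (simp add: sum_fun_apply scaleR_fun_def connection_coord_field_component[OF c']
        coord_field_def[THEN fun_cong, of A c' _ p] tangent_of_coords_same[OF dA])
  have dir: "dir_deriv A (?f k) p v =
      (frechet_derivative (jacobian_field ?T) (at (snd c p)) (v c) *v w) $ k" for k
  proof (rule dir_deriv_eq[OF dA c v])
    let ?O = "snd c ` ?U" and ?L = "frechet_derivative (jacobian_field ?T) (at (snd c p))"
    have sm: "smooth_on ?O ?T" "open ?O" "snd c p \<in> ?O"
      using manifold_smooth_atlas[OF A] c c' by (auto simp: smooth_atlas_def)
    have "bounded_linear (\<lambda>J :: real^'k^'k. (J *v w) $ k)"
      by (intro linear_conv_bounded_linear[THEN iffD1] linearI)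
        (simp_all add: matrix_vector_mult_add_rdistrib scaleR_matrix_vector_assoc[symmetric])
    from bounded_linear.has_derivative[OF this jacobian_has_derivative[OF sm]]
    have "((\<lambda>z. (jacobian_field ?T z *v w) $ k) has_derivative (\<lambda>h. (?L h *v w) $ k)) (at (snd c p))" .
    then show "(?f k \<circ> chart_inv c has_derivative (\<lambda>h. (?L h *v w) $ k)) (at (snd c p))"
    proof (rule has_derivative_transform_within_open[OF _ sm(2,3)])
      fix z assume z: "z \<in> ?O"
      then have "snd c (chart_inv c z) = z"
        using chart_inv_chart[OF atlas_inj[OF dA c(1)]] by auto
      then show "(jacobian_field ?T z *v w) $ k = (?f k \<circ> chart_inv c) z"
        using jacobian_mult[OF smooth_on_differentiable[OF sm(1) z]] by simp
    qed
  qed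
  have basis: "(\<Sum>k\<in>UNIV. x $ k *\<^sub>R axis k 1) = x" for x :: "real^'k"
    by (simp add: vec_eq_iff axis_def if_distrib cong: if_cong)
  show ?thesis
    unfolding eq dir sum.distrib basis by (simp add: matrix_mult_sum scalar_mult_eq_scaleR)
qed

text \<open>The classical law for Christoffel symbols in matrix form. The derivative of a field that is constant
  in \<open>c\<close> is computed in \<open>c'\<close> and in \<open>c\<close>, where the derivative of the Jacobian vanishes; the two
  results are components of one vector.\<close>
theorem connection_matrix_transformation:
  assumes c: "c \<in> A" "p \<in> fst c" and c': "c' \<in> A" "p \<in> fst c'"
  defines "J \<equiv> jacobian_field (transition c c')"
  shows "J (snd c p) ** connection_matrix A D c p v =
    frechet_derivative J (at (snd c p)) v +
    connection_matrix A D c' p (J (snd c p) *v v) ** J (snd c p)"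
  unfolding matrix_eq
proof
  fix w
  note dA = manifold_atlas[OF A]
  define V where "V = tangent_of_coords A c p v"
  define Z where "Z = D p V (\<lambda>q. tangent_of_coords A c q w)"
  have V: "V \<in> tangent_space A p" and Vc: "V c = v" and Vc': "V c' = dtrans c c' p v"
    unfolding V_def using tangent_of_coords_in_tangent_space[OF dA c]
      tangent_of_coords_same[OF dA c] c' by (simp_all add: tangent_of_coords_def)
  have J: "J (snd c p) *v u = dtrans c c' p u" for u
    unfolding J_def using transition_has_derivative[OF dA c(1) c'(1) c(2) c'(2)]
    by (intro jacobian_mult) (auto simp: differentiable_def)
  have "(\<lambda>q. tangent_of_coords A c q w) \<in> vector_fields A (fst c)"
    by (rule tangent_of_coords_vector_field[OF A c(1) order_refl])
  then have "Z \<in> tangent_space A p"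
    unfolding Z_def using V c openin_chart_overlap[OF dA c(1) c(1)]
    by (intro connection_in_tangent_space[of "fst c"]) auto
  then have "Z c' = J (snd c p) *v Z c"
    unfolding J by (rule tangent_space_component[OF dA _ c(1) c'(1) c(2) c'(2)])
  moreover have "Z c = connection_matrix A D c p v *v w"
  proof -
    \<comment> \<open>The transition from a chart to itself is the identity near the point, not everywhere.\<close>
    have "(jacobian_field (transition c c) has_derivative (\<lambda>h. 0)) (at (snd c p))"
    proof (rule has_derivative_transform_within_open[OF has_derivative_const atlas_open_image[OF dA c(1)]])
      show "snd c p \<in> snd c ` fst c" using c by simp
      fix z assume "z \<in> snd c ` fst c"
      then show "matrix (\<lambda>v. v) = jacobian_field (transition c c) z"
        using dtrans_same[OF dA c(1)] by (auto simp: jacobian_field_def jacobian_def intro!: arg_cong[where f = matrix])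
    qed
    then show ?thesis
      using connection_constant_field[OF c c V] Vc dtrans_same[OF dA c]
      by (simp add: Z_def frechet_derivative_eqI)
  qed
  moreover have "Z c' = frechet_derivative J (at (snd c p)) v *v w +
      connection_matrix A D c' p (J (snd c p) *v v) *v (J (snd c p) *v w)"
    using connection_constant_field[OF c c' V] Vc Vc' J by (simp add: Z_def J_def)
  ultimately show "(J (snd c p) ** connection_matrix A D c p v) *v w =
    (frechet_derivative J (at (snd c p)) v +
      connection_matrix A D c' p (J (snd c p) *v v) ** J (snd c p)) *v w"
    by (simp add: matrix_vector_mul_assoc matrix_vector_mult_add_rdistrib)
qed

end

section \<open>Slopes of matrices\<close>

lemma bounded_bilinear_matrix_mult:
  "bounded_bilinear (\<lambda>(B :: real^'n^'m) (C :: real^'k^'n). B ** C)"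
proof -
  have "bilinear (\<lambda>(B :: real^'n^'m) (C :: real^'k^'n). B ** C)"
    unfolding bilinear_def
    by (auto intro!: linearI simp: matrix_matrix_mult_def vec_eq_iff sum.distrib sum_distrib_left
        algebra_simps)
  then show ?thesis by (simp add: bilinear_conv_bounded_bilinear)
qed

lemmas has_derivative_matrix_mult =
  bounded_bilinear.FDERIV[OF bounded_bilinear_matrix_mult]

lemmas matrix_mult_simps =
  bounded_bilinear.add_left[OF bounded_bilinear_matrix_mult]
  bounded_bilinear.add_right[OF bounded_bilinear_matrix_mult]
  bounded_bilinear.diff_left[OF bounded_bilinear_matrix_mult]
  bounded_bilinear.diff_right[OF bounded_bilinear_matrix_mult]
  bounded_bilinear.minus_left[OF bounded_bilinear_matrix_mult]
  bounded_bilinear.minus_right[OF bounded_bilinear_matrix_mult]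
  bounded_bilinear.zero_left[OF bounded_bilinear_matrix_mult]
  bounded_bilinear.zero_right[OF bounded_bilinear_matrix_mult]
  matrix_mul_assoc

lemma differentiable_det:
  fixes f :: "'a::real_normed_vector \<Rightarrow> real^'n^'n"
  assumes "\<And>i j. (\<lambda>x. f x $ i $ j) differentiable (at x)"
  shows "(\<lambda>x. det (f x)) differentiable (at x)"
proof -
  have "(\<lambda>x. \<Prod>i\<in>UNIV. f x $ i $ p i) differentiable (at x)" for p
    using has_derivative_prod[of UNIV "\<lambda>i x. f x $ i $ p i"
        "\<lambda>i. frechet_derivative (\<lambda>x. f x $ i $ p i) (at x)" x UNIV]
      has_derivative_frechet[OF assms] by (auto simp: differentiable_def)
  then show ?thesis
    unfolding det_def by (intro differentiable_sum differentiable_mult) auto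
qed

lemma matrix_inv_eq:
  assumes "invertible A"
  shows "A ** matrix_inv A = mat 1" "matrix_inv A ** A = mat 1"
  using someI_ex[OF assms[unfolded invertible_def]] by (auto simp: matrix_inv_def)

lemma matrix_mult_right_cancel:
  assumes "A ** B = mat 1" "X ** A = Y ** A"
  shows "X = Y"
proof -
  have "(X ** A) ** B = (Y ** A) ** B" using assms(2) by simp
  then show ?thesis by (simp add: matrix_mul_assoc[symmetric] assms(1))
qed

lemma matrix_inv_entry:
  fixes A :: "real^'n^'n"
  assumes "invertible A"
  shows "matrix_inv A $ i $ j = det (\<chi> r s. if s = i then axis j 1 $ r else A $ r $ s) / det A"
proof -
  have "A *v (matrix_inv A *v axis j 1) = axis j 1"
    by (simp add: matrix_vector_mul_assoc matrix_inv_eq[OF assms])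
  then have "matrix_inv A *v axis j 1 =
      (\<chi> k. det (\<chi> r s. if s = k then axis j 1 $ r else A $ r $ s) / det A)"
    using cramer[of A] assms by (simp add: invertible_det_nz)
  then have "(matrix_inv A *v axis j 1) $ i =
      det (\<chi> r s. if s = i then axis j 1 $ r else A $ r $ s) / det A"
    by simp
  then show ?thesis
    by (simp add: matrix_vector_mult_basis column_def)
qed

lemma differentiable_entry: "(\<lambda>A :: real^'n^'m. A $ i $ j) differentiable (at x)"
  by (intro bounded_linear_imp_differentiable bounded_linear_intros)
    (simp add: bounded_linear_compose[OF bounded_linear_vec_nth bounded_linear_vec_nth])

lemma continuous_det: "continuous_on UNIV (det :: real^'n^'n \<Rightarrow> real)"
  using differentiable_det[of "\<lambda>A. A", OF differentiable_entry]
  by (intro differentiable_imp_continuous_on)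
    (auto simp: differentiable_on_def)

lemma open_invertible: "open {A :: real^'n^'n. invertible A}"
proof -
  have "open ((det :: real^'n^'n \<Rightarrow> real) -` (- {0}))"
    by (rule open_vimage[OF _ continuous_det]) auto
  then show ?thesis by (simp add: invertible_det_nz vimage_def)
qed

text \<open>By Cramer's rule the entries of the inverse are quotients of determinants, which are polynomials
  in the entries.\<close>
lemma differentiable_matrix_inv:
  fixes A :: "real^'n^'n"
  assumes "invertible A"
  shows "matrix_inv differentiable (at A)"
proof (intro differentiable_vec)
  fix i j
  have "(\<lambda>A :: real^'n^'n. (\<chi> r s. if s = i then axis j 1 $ r else A $ r $ s) $ r $ s)
      differentiable (at A)" for r s
    by (cases "s = i") (simp_all add: differentiable_entry)
  then have "(\<lambda>A :: real^'n^'n. det (\<chi> r s. if s = i then axis j 1 $ r else A $ r $ s) / det A)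
      differentiable (at A)"
    using assms by (intro differentiable_divide differentiable_det differentiable_entry)
      (simp_all add: invertible_det_nz)
  then show "(\<lambda>A. matrix_inv A $ i $ j) differentiable (at A)"
    by (rule differentiable_cong_open[OF _ open_invertible])
      (use assms in \<open>simp_all add: matrix_inv_entry\<close>)
qed

definition top_block :: "real^'k^('n::finite + 'm::finite) \<Rightarrow> real^'k^'n"
  where "top_block U = (\<chi> i. U $ Inl i)"

definition bottom_block :: "real^'k^('n::finite + 'm::finite) \<Rightarrow> real^'k^'m"
  where "bottom_block U = (\<chi> i. U $ Inr i)"

text \<open>Its columns are the vectors \<open>\<partial>\<^sub>l + \<Sum>\<^sub>j u\<^sub>j\<^sub>l \<partial>\<^sub>j\<close>; its range is the graph of \<open>u\<close>.\<close>
definition graph_matrix :: "real^'n::finite^'m::finite \<Rightarrow> real^'n^('n + 'm)"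
  where "graph_matrix u = (\<chi> a. case a of Inl l \<Rightarrow> mat 1 $ l | Inr j \<Rightarrow> u $ j)"

text \<open>The range of \<open>U\<close> is the graph of this matrix when the upper block is invertible.\<close>
definition slope :: "real^'n::finite^('n + 'm::finite) \<Rightarrow> real^'n^'m"
  where "slope U = bottom_block U ** matrix_inv (top_block U)"

text \<open>The identification of the ambient space modulo the graph of \<open>u\<close> with the last coordinates: it
  kills exactly the matrices whose columns lie in the graph.\<close>
definition vertical_part :: "real^'n::finite^'m::finite \<Rightarrow> real^'k^('n + 'm) \<Rightarrow> real^'k^'m"
  where "vertical_part u Z = bottom_block Z - u ** top_block Z"

lemma block_eqI:
  assumes "top_block U = top_block V" "bottom_block U = bottom_block V"
  shows "U = V"
  unfolding vec_eq_iff[of U V]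
proof
  fix a
  show "U $ a = V $ a"
  proof (cases a)
    case (Inl l)
    then show ?thesis using arg_cong[OF assms(1), of "\<lambda>M. M $ l"] by (simp add: top_block_def)
  next
    case (Inr l)
    then show ?thesis using arg_cong[OF assms(2), of "\<lambda>M. M $ l"] by (simp add: bottom_block_def)
  qed
qed

lemma top_block_mult [simp]: "top_block (U ** V) = top_block U ** V"
  by (simp add: top_block_def matrix_matrix_mult_def vec_eq_iff)

lemma bottom_block_mult [simp]: "bottom_block (U ** V) = bottom_block U ** V"
  by (simp add: bottom_block_def matrix_matrix_mult_def vec_eq_iff)

lemma top_block_graph [simp]: "top_block (graph_matrix u) = mat 1"
  by (simp add: top_block_def graph_matrix_def vec_eq_iff)

lemma bottom_block_graph [simp]: "bottom_block (graph_matrix u) = u"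
  by (simp add: bottom_block_def graph_matrix_def vec_eq_iff)

lemma bounded_linear_top_block: "bounded_linear top_block"
  by (intro linear_conv_bounded_linear[THEN iffD1] linearI)
    (simp_all add: top_block_def vec_eq_iff)

lemma bounded_linear_bottom_block: "bounded_linear bottom_block"
  by (intro linear_conv_bounded_linear[THEN iffD1] linearI)
    (simp_all add: bottom_block_def vec_eq_iff)

lemma bounded_linear_vertical_part: "bounded_linear (vertical_part u)"
  unfolding vertical_part_def
  by (intro bounded_linear_sub bounded_linear_bottom_block
      bounded_linear_compose[OF bounded_bilinear.bounded_linear_right[OF bounded_bilinear_matrix_mult]]
      bounded_linear_top_block)

lemma vertical_part_mult: "vertical_part u (Z ** X) = vertical_part u Z ** X"
  by (simp add: vertical_part_def matrix_mult_simps)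

lemma vertical_part_graph [simp]: "vertical_part u (graph_matrix u) = 0"
  by (simp add: vertical_part_def)

lemma graph_matrix_slope:
  assumes "invertible (top_block U)"
  shows "U = graph_matrix (slope U) ** top_block U"
  by (rule block_eqI) (simp_all add: slope_def matrix_mul_assoc[symmetric] matrix_inv_eq[OF assms])

text \<open>Obtained by differentiating \<open>slope U ** top_block U = bottom_block U\<close>.\<close>
lemma slope_has_derivative:
  assumes "invertible (top_block U)"
  shows "(slope has_derivative (\<lambda>H. vertical_part (slope U) H ** matrix_inv (top_block U))) (at U)"
proof -
  let ?P = "top_block U"
  note top = bounded_linear.has_derivative[OF bounded_linear_top_block has_derivative_ident]
    and bot = bounded_linear.has_derivative[OF bounded_linear_bottom_block has_derivative_ident]
  have "(matrix_inv has_derivative frechet_derivative matrix_inv (at ?P)) (at ?P)"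
    by (rule has_derivative_frechet[OF differentiable_matrix_inv[OF assms]])
  from has_derivative_matrix_mult[OF bot diff_chain_at[OF top this, unfolded o_def]]
  obtain L where L: "(slope has_derivative L) (at U)"
    unfolding slope_def[abs_def] by blast
  have "((\<lambda>V. slope V ** top_block V) has_derivative
      (\<lambda>H. slope U ** top_block H + L H ** top_block U)) (at U)"
    by (rule has_derivative_matrix_mult[OF L top])
  moreover have "((\<lambda>V. slope V ** top_block V) has_derivative bottom_block) (at U)"
  proof (rule has_derivative_transform_within_open[OF bot])
    show "open (top_block -` {A :: real^'a^'a. invertible A})"
      by (intro open_vimage open_invertible linear_continuous_on bounded_linear_top_block)
    show "U \<in> top_block -` {A. invertible A}" using assms by simp
    fix V assume "V \<in> top_block -` {A :: real^'a^'a. invertible A}"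
    then show "bottom_block V = slope V ** top_block V"
      by (simp add: slope_def matrix_mul_assoc[symmetric] matrix_inv_eq)
  qed
  ultimately have "(\<lambda>H. slope U ** top_block H + L H ** top_block U) = bottom_block"
    by (rule has_derivative_unique)
  then have "slope U ** top_block H + L H ** top_block U = bottom_block H" for H
    by (rule fun_cong)
  then have "L H ** top_block U = vertical_part (slope U) H" for H
    by (simp add: vertical_part_def algebra_simps)
  then have "L H = vertical_part (slope U) H ** matrix_inv (top_block U)" for H
    by (metis assms matrix_inv_eq(1) matrix_mul_assoc matrix_mul_rid)
  then show ?thesis using L by presburger
qed

text \<open>A subspace is a graph over the first coordinates iff it projects onto them isomorphically, and the
  function is then read off. Both the domain and the values of a Grassmann chart come from here.\<close>
lemma range_eq_range_graph_iff:
  fixes U :: "real^'n::finite^('n + 'm::finite)"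
  shows "range ((*v) U) = range ((*v) (graph_matrix u)) \<longleftrightarrow>
    invertible (top_block U) \<and> u = slope U"
proof
  have top: "top_block V *v x = (\<chi> i. (V *v x) $ Inl i)"
    and bot: "bottom_block V *v x = (\<chi> i. (V *v x) $ Inr i)" for V :: "real^'n^('n + 'm)" and x
    by (simp_all add: top_block_def bottom_block_def matrix_vector_mult_def vec_eq_iff)
  assume eq: "range ((*v) U) = range ((*v) (graph_matrix u))"
  have "\<exists>y. top_block U *v y = x" for x
  proof -
    obtain y where "U *v y = graph_matrix u *v x" using eq by (metis rangeE rangeI)
    then have "top_block U *v y = top_block (graph_matrix u) *v x" by (simp only: top)
    then show ?thesis by auto
  qed
  then have inv: "invertible (top_block U)"
    by (metis surj_def invertible_right_inverse matrix_right_invertible_surjective)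
  have "bottom_block U *v x = (u ** top_block U) *v x" for x
  proof -
    obtain y where y: "U *v x = graph_matrix u *v y" using eq by (metis rangeE rangeI)
    then have "top_block U *v x = top_block (graph_matrix u) *v y" by (simp only: top)
    moreover have "bottom_block U *v x = bottom_block (graph_matrix u) *v y" using y by (simp only: bot)
    ultimately show ?thesis by (simp add: matrix_vector_mul_assoc[symmetric])
  qed
  then have "bottom_block U = u ** top_block U" by (simp add: matrix_eq)
  then show "invertible (top_block U) \<and> u = slope U"
    using inv by (simp add: slope_def matrix_mul_assoc[symmetric] matrix_inv_eq)
next
  assume a: "invertible (top_block U) \<and> u = slope U"
  then have "U *v x = graph_matrix u *v (top_block U *v x)" for x
    using graph_matrix_slope[of U] by (metis matrix_vector_mul_assoc)
  moreover have "surj ((*v) (top_block U))"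
    using a by (metis invertible_right_inverse matrix_right_invertible_surjective)
  moreover from calculation(1) have "(*v) U = (*v) (graph_matrix u) \<circ> (*v) (top_block U)"
    unfolding o_def by (rule ext)
  ultimately show "range ((*v) U) = range ((*v) (graph_matrix u))"
    by (metis image_comp)
qed

definition vertical_lift :: "real^'k^'m::finite \<Rightarrow> real^'k^('n::finite + 'm)"
  where "vertical_lift w = (\<chi> a. case a of Inl l \<Rightarrow> 0 | Inr j \<Rightarrow> w $ j)"

lemma top_block_vertical_lift [simp]: "top_block (vertical_lift w) = 0"
  by (simp add: top_block_def vertical_lift_def vec_eq_iff)

lemma bottom_block_vertical_lift [simp]: "bottom_block (vertical_lift w) = w"
  by (simp add: bottom_block_def vertical_lift_def vec_eq_iff)

lemma bounded_linear_vertical_lift: "bounded_linear vertical_lift"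
  by (intro linear_conv_bounded_linear[THEN iffD1] linearI block_eqI)
    (simp_all add: linear_add[OF bounded_linear.linear[OF bounded_linear_top_block]]
      linear_add[OF bounded_linear.linear[OF bounded_linear_bottom_block]]
      linear_scale[OF bounded_linear.linear[OF bounded_linear_top_block]]
      linear_scale[OF bounded_linear.linear[OF bounded_linear_bottom_block]])

text \<open>A matrix and its lifted vertical part differ by a matrix with columns in the graph of \<open>u\<close>, so
  \<open>vertical_part u\<close> does not distinguish them.\<close>
lemma vertical_lift_vertical_part:
  "vertical_lift (vertical_part u Z) = Z - graph_matrix u ** top_block Z"
  by (rule block_eqI)
    (simp_all add: linear_diff[OF bounded_linear.linear[OF bounded_linear_top_block]]
      linear_diff[OF bounded_linear.linear[OF bounded_linear_bottom_block]] vertical_part_def)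

lemma graph_matrix_has_derivative: "(graph_matrix has_derivative vertical_lift) (at u)"
proof -
  have eq: "graph_matrix = (\<lambda>u. graph_matrix 0 + vertical_lift u)"
    by (intro ext block_eqI)
      (simp_all add: linear_add[OF bounded_linear.linear[OF bounded_linear_top_block]]
        linear_add[OF bounded_linear.linear[OF bounded_linear_bottom_block]])
  have "((\<lambda>u. graph_matrix 0 + vertical_lift u) has_derivative (\<lambda>h. 0 + vertical_lift h)) (at u)"
    by (rule has_derivative_add[OF has_derivative_const
          bounded_linear_imp_has_derivative[OF bounded_linear_vertical_lift]])
  then show ?thesis by (subst eq) simp
qed

section \<open>Jets and their coordinates\<close>

lemma jet_rep_in: "s \<in> snd j \<Longrightarrow> jet_rep j \<in> snd j"
  unfolding jet_rep_def by (rule someI[of "\<lambda>s. s \<in> snd j"])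

context
  fixes M :: "('p, real^'n) chart set" and E :: "('q, real^'k) chart set"
  assumes M: "smooth_manifold M" and E: "smooth_manifold E"
begin

lemma jet_bundle_rep:
  assumes "j \<in> jet_bundle M E"
  shows "smooth_at M E (jet_rep j) (fst j)" "j = jet M E (jet_rep j) (fst j)"
proof -
  obtain s x where s: "j = jet M E s x" "smooth_at M E s x"
    using assms by (auto simp: jet_bundle_def)
  then have "s \<in> snd j" by (simp add: jet_def)
  then have rep: "jet_rep j \<in> snd j" by (rule jet_rep_in)
  then show "smooth_at M E (jet_rep j) (fst j)" using s by (simp add: jet_def)
  show "j = jet M E (jet_rep j) (fst j)"
    using rep unfolding s(1) by (auto simp: jet_def)
qed

text \<open>The members of a jet have the same tangent map at the source, and its components in charts are the
  derivatives of the local expressions; so the coordinates may be computed from any representative.\<close>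
lemma
  assumes s: "smooth_at M E s x" and x: "x \<in> points M"
  shows jet_in_jet_bundle: "jet M E s x \<in> jet_bundle M E"
    and jet_target_jet: "jet_target (jet M E s x) = s x"
    and jet_coord_jet: "\<lbrakk>c \<in> M; x \<in> fst c; d \<in> E; s x \<in> fst d\<rbrakk> \<Longrightarrow>
      jet_coord c d (jet M E s x) = jacobian_field (snd d \<circ> s \<circ> chart_inv c) (snd c x)"
proof -
  let ?j = "jet M E s x"
  define t where "t = jet_rep ?j"
  show "?j \<in> jet_bundle M E" using assms by (auto simp: jet_bundle_def)
  have "s \<in> snd ?j" using s by (simp add: jet_def)
  then have "t \<in> snd ?j" unfolding t_def by (rule jet_rep_in)
  then have t: "smooth_at M E t x" "t x = s x"
    and T: "\<And>v. v \<in> tangent_space M x \<Longrightarrow> tangent_map M E t (x, v) = tangent_map M E s (x, v)"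
    by (simp_all add: jet_def)
  show "jet_target ?j = s x"
    using t(2) by (simp add: jet_target_def t_def jet_def)
  assume c: "c \<in> M" "x \<in> fst c" and d: "d \<in> E" "s x \<in> fst d"
  let ?f = "\<lambda>s. snd d \<circ> s \<circ> chart_inv c"
  have fs: "?f s differentiable (at (snd c x))"
    by (rule smooth_at_local_representative(1)[OF manifold_atlas[OF M] manifold_atlas[OF E] s c d])
  have ft: "?f t differentiable (at (snd c x))"
    using smooth_at_local_representative(1)[OF manifold_atlas[OF M] manifold_atlas[OF E] t(1) c d(1)] d(2) t(2) by simp
  have "jacobian_field (?f t) (snd c x) *v w = jacobian_field (?f s) (snd c x) *v w" for w
  proof -
    define v where "v = tangent_of_coords M c x w"
    have v: "v \<in> tangent_space M x" "v c = w"
      unfolding v_def by (rule tangent_of_coords_in_tangent_space[OF manifold_atlas[OF M] c],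
          rule tangent_of_coords_same[OF manifold_atlas[OF M] c])
    have "frechet_derivative (?f t) (at (snd c x)) (v c) = snd (tangent_map M E t (x, v)) d"
      using d(2) t(2)
      by (intro tangent_map_component[OF manifold_atlas[OF M] c v(1) d(1) _ has_derivative_frechet[OF ft],
            symmetric]) simp
    also have "\<dots> = frechet_derivative (?f s) (at (snd c x)) (v c)"
      unfolding T[OF v(1)]
      by (rule tangent_map_component[OF manifold_atlas[OF M] c v(1) d has_derivative_frechet[OF fs]])
    finally show ?thesis by (simp add: jacobian_mult[OF fs] jacobian_mult[OF ft] v(2))
  qed
  then have "jacobian_field (?f t) (snd c x) = jacobian_field (?f s) (snd c x)"
    by (simp add: matrix_eq)
  moreover have "jet_coord c d ?j = jacobian_field (?f t) (snd c x)"
    by (simp add: jet_coord_def jacobian_field_def jacobian_def matrix_def t_def jet_def)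
  ultimately show "jet_coord c d ?j = jacobian_field (?f s) (snd c x)" by simp
qed

lemma jet_map_properties:
  assumes j: "j \<in> jet_bundle M E" and v: "v \<in> tangent_space M (fst j)"
    and c: "c \<in> M" "fst j \<in> fst c" and d: "d \<in> E" "jet_target j \<in> fst d"
  shows "jet_map M E j v d = jet_coord c d j *v v c"
    and "jet_map M E j v \<in> tangent_space E (jet_target j)"
proof -
  let ?s = "jet_rep j"
  note s = jet_bundle_rep(1)[OF j]
  have tgt: "jet_target j = ?s (fst j)" by (simp add: jet_target_def)
  have coord: "jet_coord c d j = jacobian_field (snd d \<circ> ?s \<circ> chart_inv c) (snd c (fst j))"
    by (simp add: jet_coord_def jacobian_field_def jacobian_def matrix_def)
  note loc = smooth_at_local_representative[OF manifold_atlas[OF M] manifold_atlas[OF E] s c]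
  have f: "snd d \<circ> ?s \<circ> chart_inv c differentiable (at (snd c (fst j)))"
    using loc(1)[OF d(1)] d(2) tgt by simp
  show "jet_map M E j v d = jet_coord c d j *v v c"
    unfolding jet_map_def coord jacobian_mult[OF f]
    using d tgt by (intro tangent_map_component[OF manifold_atlas[OF M] c v _ _ has_derivative_frechet[OF f]]) auto
  show "jet_map M E j v \<in> tangent_space E (jet_target j)"
    unfolding jet_map_def tgt
    by (rule tangent_map_in_tangent_space[OF manifold_atlas[OF M] manifold_atlas[OF E] c v loc])
qed

lemma jet_eqI:
  assumes j: "j \<in> jet_bundle M E" "j' \<in> jet_bundle M E"
    and c: "c \<in> M" "fst j \<in> fst c" and d: "d \<in> E" "jet_target j \<in> fst d"
    and eq: "fst j = fst j'" "jet_target j = jet_target j'" "jet_coord c d j = jet_coord c d j'"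
  shows "j = j'"
proof -
  have tgt: "jet_rep j (fst j) = jet_rep j' (fst j)"
    using eq(1,2) by (simp add: jet_target_def)
  have "tangent_map M E (jet_rep j) (fst j, v) = tangent_map M E (jet_rep j') (fst j, v)"
    if v: "v \<in> tangent_space M (fst j)" for v
  proof (rule prod_eqI)
    show "fst (tangent_map M E (jet_rep j) (fst j, v)) = fst (tangent_map M E (jet_rep j') (fst j, v))"
      using tgt by (simp add: fst_tangent_map)
    have "jet_map M E j v = jet_map M E j' v"
    proof (rule tangent_space_eqI[OF manifold_atlas[OF E] _ _ d])
      show "jet_map M E j v \<in> tangent_space E (jet_target j)"
        by (rule jet_map_properties(2)[OF j(1) v c d])
      show "jet_map M E j' v \<in> tangent_space E (jet_target j)"
        using jet_map_properties(2)[OF j(2) _ c(1) _ d(1), of v] v c d eq by simp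
      show "jet_map M E j v d = jet_map M E j' v d"
        using jet_map_properties(1)[OF j(2) _ c(1) _ d(1), of v]
          jet_map_properties(1)[OF j(1) v c d] v c d eq by simp
    qed
    then show "snd (tangent_map M E (jet_rep j) (fst j, v)) = snd (tangent_map M E (jet_rep j') (fst j, v))"
      using eq(1) by (simp add: jet_map_def)
  qed
  then have "jet M E (jet_rep j) (fst j) = jet M E (jet_rep j') (fst j)"
    using tgt by (auto simp: jet_def)
  then show ?thesis
    using jet_bundle_rep(2)[OF j(1)] jet_bundle_rep(2)[OF j(2)] eq(1) by simp
qed

text \<open>The affine map with the prescribed value and derivative represents the jet. It takes values in
  the target chart only near \<open>x\<close>, so its source chart has to be cut down.\<close>
lemma jet_with_coordinates:
  assumes c: "c \<in> M" "x \<in> fst c" and d: "d \<in> E" "y \<in> fst d"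
  obtains j where "j \<in> jet_bundle M E" "fst j = x" "jet_target j = y" "jet_coord c d j = U"
proof -
  define g where "g = (\<lambda>z. U *v z + (snd d y - U *v snd c x))"
  define V where "V = snd c ` fst c \<inter> g -` (snd d ` fst d)"
  \<comment> \<open>\<open>W\<close> is the part of the source chart on which the affine map \<open>g\<close> takes values in the target chart.\<close>
  define W where "W = {q \<in> fst c. snd c q \<in> V}"
  define t where "t = (\<lambda>q. chart_inv d (g (snd c q)))"
  have lin: "bounded_linear ((*v) U)" by (simp add: linear_linear)
  have dg: "(g has_derivative (*v) U) (at z)" for z
    unfolding g_def using bounded_linear_imp_has_derivative[OF lin] by (intro has_derivative_eq_rhs[OF
        has_derivative_add[OF _ has_derivative_const]]) auto
  then have "continuous_on UNIV g"
    by (meson continuous_at_imp_continuous_on has_derivative_continuous)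
  then have V: "open V"
    unfolding V_def by (intro open_Int atlas_open_image[OF manifold_atlas[OF M] c(1)]
        open_vimage[OF atlas_open_image[OF manifold_atlas[OF E] d(1)]])
  have xV: "snd c x \<in> V" using c d by (simp add: V_def g_def)
  have cW: "snd c ` W = V" by (auto simp: W_def V_def)
  have e: "(W, snd c) \<in> M"
    using V cW by (intro restricted_chart_in_atlas[OF M c(1)]) (auto simp: W_def)
  have gt: "snd d (t q) = g (snd c q)" "t q \<in> fst d" if "q \<in> W" for q
  proof -
    have "g (snd c q) \<in> snd d ` fst d" using that by (auto simp: W_def V_def)
    then show "snd d (t q) = g (snd c q)" "t q \<in> fst d"
      unfolding t_def chart_inv_def by (auto intro: f_inv_into_f inv_into_into)
  qed
  have injW: "inj_on (snd c) W"
    by (rule inj_on_subset[OF atlas_inj[OF manifold_atlas[OF M] c(1)]]) (auto simp: W_def)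
  have "smooth_on V (snd d \<circ> t \<circ> chart_inv (W, snd c))"
  proof (rule smooth_on_cong[OF smooth_on_affine[OF V lin] V])
    fix z assume "z \<in> V"
    then obtain q where q: "z = snd c q" "q \<in> W" using cW by auto
    then have "chart_inv (W, snd c) z = q"
      using chart_inv_chart[of "(W, snd c)" q] injW by simp
    then show "U *v z + (snd d y - U *v snd c x) = (snd d \<circ> t \<circ> chart_inv (W, snd c)) z"
      using gt[OF q(2)] q by (simp add: g_def)
  qed
  then have sm: "smooth_at M E t x"
    unfolding smooth_at_def using e d(1) gt(2) cW c(2) xV
    by (intro bexI[OF _ e] bexI[OF _ d(1)]) (auto simp: W_def)
  have tx: "t x = y"
    using chart_inv_chart[OF atlas_inj[OF manifold_atlas[OF E] d(1)] d(2)] by (simp add: t_def g_def)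
  have xM: "x \<in> points M" using c by (auto simp: points_def)
  have "(snd d \<circ> t \<circ> chart_inv c has_derivative (*v) U) (at (snd c x))"
  proof (rule has_derivative_transform_within_open[OF dg V xV])
    fix z assume "z \<in> V"
    then obtain q where q: "z = snd c q" "q \<in> W" using cW by auto
    then have "chart_inv c z = q"
      using chart_inv_chart[OF atlas_inj[OF manifold_atlas[OF M] c(1)], of q] by (simp add: W_def)
    then show "g z = (snd d \<circ> t \<circ> chart_inv c) z"
      using gt[OF q(2)] q by simp
  qed
  then have "jet_coord c d (jet M E t x) = U"
    using jet_coord_jet[OF sm xM c d(1)] d(2) tx
    by (simp add: jacobian_field_def jacobian_def frechet_derivative_eqI)
  then show thesis
    using that[of "jet M E t x"] jet_in_jet_bundle[OF sm xM] jet_target_jet[OF sm xM] tx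
    by (simp add: jet_def)
qed

lemma jet_coord_change:
  assumes j: "j \<in> jet_bundle M E"
    and c: "c \<in> M" "fst j \<in> fst c" "c' \<in> M" "fst j \<in> fst c'"
    and d: "d \<in> E" "jet_target j \<in> fst d" "d' \<in> E" "jet_target j \<in> fst d'"
  shows "jet_coord c' d' j = jacobian_field (transition d d') (snd d (jet_target j)) **
    jet_coord c d j ** jacobian_field (transition c' c) (snd c' (fst j))"
  unfolding matrix_eq
proof
  fix w
  define v where "v = tangent_of_coords M c' (fst j) w"
  have v: "v \<in> tangent_space M (fst j)" "v c' = w"
    unfolding v_def by (rule tangent_of_coords_in_tangent_space[OF manifold_atlas[OF M] c(3,4)],
        rule tangent_of_coords_same[OF manifold_atlas[OF M] c(3,4)])
  have "v c = dtrans c' c (fst j) w"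
    using tangent_space_component[OF manifold_atlas[OF M] v(1) c(3,1,4,2)] v(2) by simp
  also have "\<dots> = jacobian_field (transition c' c) (snd c' (fst j)) *v w"
    by (rule jacobian_mult[symmetric])
      (use transition_has_derivative[OF manifold_atlas[OF M] c(3,1,4,2)] in \<open>auto simp: differentiable_def\<close>)
  finally have vc: "v c = jacobian_field (transition c' c) (snd c' (fst j)) *v w" .
  have "jet_coord c' d' j *v w = jet_map M E j v d'"
    using jet_map_properties(1)[OF j v(1) c(3,4) d(3,4)] v(2) by simp
  also have "\<dots> = dtrans d d' (jet_target j) (jet_map M E j v d)"
    by (rule tangent_space_component[OF manifold_atlas[OF E] jet_map_properties(2)[OF j v(1) c(1,2) d(1,2)]
          d(1,3,2,4)])
  also have "\<dots> = jacobian_field (transition d d') (snd d (jet_target j)) *v (jet_map M E j v d)"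
    by (rule jacobian_mult[symmetric])
      (use transition_has_derivative[OF manifold_atlas[OF E] d(1,3,2,4)] in \<open>auto simp: differentiable_def\<close>)
  also have "jet_map M E j v d = jet_coord c d j *v v c"
    by (rule jet_map_properties(1)[OF j v(1) c(1,2) d(1,2)])
  finally show "jet_coord c' d' j *v w = (jacobian_field (transition d d') (snd d (jet_target j)) **
    jet_coord c d j ** jacobian_field (transition c' c) (snd c' (fst j))) *v w"
    unfolding vc by (simp add: matrix_vector_mul_assoc matrix_mul_assoc)
qed

end

section \<open>Jet charts and their transition maps\<close>

lemma jet_atlas_eq: "jet_atlas M E = (\<lambda>(c, d). jet_chart M E c d) ` (M \<times> E)"
  by (auto simp: jet_atlas_def)

lemma in_jet_chart_iff:
  "j \<in> fst (jet_chart M E c d) \<longleftrightarrow> j \<in> jet_bundle M E \<and> fst j \<in> fst c \<and> jet_target j \<in> fst d"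
  by (simp add: jet_chart_def)

lemma jet_chart_apply:
  "snd (jet_chart M E c d) j = (snd c (fst j), snd d (jet_target j), jet_coord c d j)"
  by (simp add: jet_chart_def)

context
  fixes M :: "('p, real^'n) chart set" and E :: "('q, real^'k) chart set"
  assumes M: "smooth_manifold M" and E: "smooth_manifold E"
begin

lemma jet_chart_inj:
  assumes "c \<in> M" "d \<in> E"
  shows "inj_on (snd (jet_chart M E c d)) (fst (jet_chart M E c d))"
proof (rule inj_onI)
  fix j j' assume j: "j \<in> fst (jet_chart M E c d)" "j' \<in> fst (jet_chart M E c d)"
    "snd (jet_chart M E c d) j = snd (jet_chart M E c d) j'"
  then have "fst j = fst j'" "jet_target j = jet_target j'"
    using atlas_inj[OF manifold_atlas[OF M] assms(1)] atlas_inj[OF manifold_atlas[OF E] assms(2)]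
    by (auto simp: in_jet_chart_iff jet_chart_apply dest: inj_onD)
  then show "j = j'"
    using j assms by (intro jet_eqI[OF M E _ _ assms(1) _ assms(2)])
      (auto simp: in_jet_chart_iff jet_chart_apply)
qed

lemma jet_chart_overlap_image:
  assumes "c \<in> M" "d \<in> E" "c' \<in> M" "d' \<in> E"
  shows "snd (jet_chart M E c d) ` (fst (jet_chart M E c d) \<inter> fst (jet_chart M E c' d')) =
    (snd c ` (fst c \<inter> fst c')) \<times> (snd d ` (fst d \<inter> fst d')) \<times> UNIV"
proof (intro equalityI subsetI)
  fix z assume "z \<in> snd (jet_chart M E c d) ` (fst (jet_chart M E c d) \<inter> fst (jet_chart M E c' d'))"
  then show "z \<in> (snd c ` (fst c \<inter> fst c')) \<times> (snd d ` (fst d \<inter> fst d')) \<times> UNIV"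
    by (auto simp: in_jet_chart_iff jet_chart_apply)
next
  fix z :: "(real^'n) \<times> (real^'k) \<times> (real^'n^'k)"
  assume "z \<in> (snd c ` (fst c \<inter> fst c')) \<times> (snd d ` (fst d \<inter> fst d')) \<times> UNIV"
  then obtain x y U where z: "z = (snd c x, snd d y, U)" "x \<in> fst c" "x \<in> fst c'" "y \<in> fst d" "y \<in> fst d'"
    by auto
  obtain j where "j \<in> jet_bundle M E" "fst j = x" "jet_target j = y" "jet_coord c d j = U"
    by (rule jet_with_coordinates[OF M E assms(1) z(2) assms(2) z(4)])
  then show "z \<in> snd (jet_chart M E c d) ` (fst (jet_chart M E c d) \<inter> fst (jet_chart M E c' d'))"
    using z by (intro image_eqI[of _ _ j]) (auto simp: in_jet_chart_iff jet_chart_apply)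
qed

lemma jet_transition:
  assumes c: "c \<in> M" "c' \<in> M" and d: "d \<in> E" "d' \<in> E"
    and x: "x \<in> snd c ` (fst c \<inter> fst c')" and y: "y \<in> snd d ` (fst d \<inter> fst d')"
  shows "transition (jet_chart M E c d) (jet_chart M E c' d') (x, y, U) =
    (transition c c' x, transition d d' y,
      jacobian_field (transition d d') y ** U ** jacobian_field (transition c' c) (transition c c' x))"
proof -
  have "(x, y, U) \<in> snd (jet_chart M E c d) ` (fst (jet_chart M E c d) \<inter> fst (jet_chart M E c' d'))"
    using x y by (simp add: jet_chart_overlap_image[OF c(1) d(1) c(2) d(2)])
  then obtain j where j: "j \<in> fst (jet_chart M E c d)" "j \<in> fst (jet_chart M E c' d')"
    "snd (jet_chart M E c d) j = (x, y, U)" by auto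
  then have jj: "j \<in> jet_bundle M E" "fst j \<in> fst c" "fst j \<in> fst c'" "jet_target j \<in> fst d"
      "jet_target j \<in> fst d'" "x = snd c (fst j)" "y = snd d (jet_target j)" "U = jet_coord c d j"
    by (auto simp: in_jet_chart_iff jet_chart_apply)
  have "transition (jet_chart M E c d) (jet_chart M E c' d') (x, y, U) =
      snd (jet_chart M E c' d') j"
    using transition_chart[OF jet_chart_inj[OF c(1) d(1)] j(1), of "jet_chart M E c' d'"] j(3) by simp
  then show ?thesis
    using jet_coord_change[OF M E jj(1) c(1) jj(2) c(2) jj(3) d(1) jj(4) d(2) jj(5)]
      transition_chart[OF atlas_inj[OF manifold_atlas[OF M] c(1)] jj(2), of c']
      transition_chart[OF atlas_inj[OF manifold_atlas[OF E] d(1)] jj(4), of d']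
    by (simp add: jet_chart_apply jj(6-8))
qed

text \<open>The new coordinate matrix \<open>T\<close> satisfies \<open>T ** J = K ** U\<close> with the Jacobians \<open>J\<close> and \<open>K\<close> of the two
  transition maps. Once \<open>T\<close> is known to be differentiable, differentiating this identity determines its
  derivative \<open>R\<close> without the derivative of an inverse matrix.\<close>
lemma jet_transition_has_derivative:
  assumes c: "c \<in> M" "c' \<in> M" and d: "d \<in> E" "d' \<in> E"
    and j: "j \<in> fst (jet_chart M E c d)" "j \<in> fst (jet_chart M E c' d')"
  defines "x \<equiv> snd c (fst j)" and "y \<equiv> snd d (jet_target j)"
    and "J \<equiv> jacobian_field (transition c c')" and "K \<equiv> jacobian_field (transition d d')"
  shows "\<exists>R. (transition (jet_chart M E c d) (jet_chart M E c' d') has_derivative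
      (\<lambda>(dx, du, dU). (J x *v dx, K y *v du, R (dx, du, dU)))) (at (snd (jet_chart M E c d) j)) \<and>
    (\<forall>dx du dU. R (dx, du, dU) ** J x =
      frechet_derivative K (at y) du ** jet_coord c d j + K y ** dU -
      jet_coord c' d' j ** frechet_derivative J (at x) dx)"
proof -
  note sA = manifold_atlas[OF M] and tA = manifold_atlas[OF E]
  let ?\<phi> = "transition c c'" and ?\<psi> = "transition d d'" and ?J' = "jacobian_field (transition c' c)"
  let ?Ox = "snd c ` (fst c \<inter> fst c')" and ?Oy = "snd d ` (fst d \<inter> fst d')"
  have jj: "j \<in> jet_bundle M E" "fst j \<in> fst c" "fst j \<in> fst c'" "jet_target j \<in> fst d"
      "jet_target j \<in> fst d'"
    using j by (auto simp: in_jet_chart_iff)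
  let ?z = "(x, y, jet_coord c d j)"
  have z: "snd (jet_chart M E c d) j = ?z"
    by (simp add: jet_chart_apply x_def y_def)
  have x: "x \<in> ?Ox" "open ?Ox" and y: "y \<in> ?Oy" "open ?Oy"
    using jj atlas_open[OF sA c] atlas_open[OF tA d] by (auto simp: x_def y_def)
  have phi_x: "?\<phi> x = snd c' (fst j)"
    using transition_chart[OF atlas_inj[OF sA c(1)] jj(2), of c'] by (simp add: x_def)
  have \<phi>: "(?\<phi> has_derivative (*v) (J x)) (at x)"
    using transition_has_derivative[OF sA c jj(2,3)] dtrans_eq_jacobian[OF sA c jj(2,3)]
    by (simp add: x_def J_def)
  have \<psi>: "(?\<psi> has_derivative (*v) (K y)) (at y)"
    using transition_has_derivative[OF tA d jj(4,5)] dtrans_eq_jacobian[OF tA d jj(4,5)]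
    by (simp add: y_def K_def)
  have J: "(J has_derivative frechet_derivative J (at x)) (at x)"
    unfolding J_def using manifold_smooth_atlas[OF M] c x
    by (intro jacobian_has_derivative[of ?Ox]) (auto simp: smooth_atlas_def)
  have K: "(K has_derivative frechet_derivative K (at y)) (at y)"
    unfolding K_def using manifold_smooth_atlas[OF E] d y
    by (intro jacobian_has_derivative[of ?Oy]) (auto simp: smooth_atlas_def)
  have J': "(?J' has_derivative frechet_derivative ?J' (at (?\<phi> x))) (at (?\<phi> x))"
    unfolding phi_x using manifold_smooth_atlas[OF M] c jj atlas_open[OF sA c(2,1)]
    by (intro jacobian_has_derivative[of "snd c' ` (fst c' \<inter> fst c)"]) (auto simp: smooth_atlas_def)
  have pr: "((\<lambda>z :: (real^'n) \<times> (real^'k) \<times> (real^'n^'k). fst z) has_derivative fst) (at ?z)"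
    "((\<lambda>z :: (real^'n) \<times> (real^'k) \<times> (real^'n^'k). fst (snd z)) has_derivative (\<lambda>z. fst (snd z))) (at ?z)"
    "((\<lambda>z :: (real^'n) \<times> (real^'k) \<times> (real^'n^'k). snd (snd z)) has_derivative (\<lambda>z. snd (snd z))) (at ?z)"
    by (auto intro!: derivative_eq_intros)
  have \<phi>z: "((\<lambda>z. ?\<phi> (fst z)) has_derivative (\<lambda>h. J x *v fst h)) (at ?z)"
    using has_derivative_compose[OF pr(1), of ?\<phi>] \<phi> by simp
  have \<psi>z: "((\<lambda>z. ?\<psi> (fst (snd z))) has_derivative (\<lambda>h. K y *v fst (snd h))) (at ?z)"
    using has_derivative_compose[OF pr(2), of ?\<psi>] \<psi> by simp
  have Jz: "((\<lambda>z. J (fst z)) has_derivative (\<lambda>h. frechet_derivative J (at x) (fst h))) (at ?z)"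
    using has_derivative_compose[OF pr(1), of J] J by simp
  have Kz: "((\<lambda>z. K (fst (snd z))) has_derivative (\<lambda>h. frechet_derivative K (at y) (fst (snd h)))) (at ?z)"
    using has_derivative_compose[OF pr(2), of K] K by simp
  have J'z: "((\<lambda>z. ?J' (?\<phi> (fst z))) has_derivative
      (\<lambda>h. frechet_derivative ?J' (at (?\<phi> x)) (J x *v fst h))) (at ?z)"
    using has_derivative_compose[OF \<phi>z, of ?J'] J' by simp
  let ?T = "\<lambda>z. K (fst (snd z)) ** snd (snd z) ** ?J' (?\<phi> (fst z))"
  obtain R where R: "(?T has_derivative R) (at ?z)"
    using has_derivative_matrix_mult[OF has_derivative_matrix_mult[OF Kz pr(3)] J'z] by blast
  let ?O = "?Ox \<times> ?Oy \<times> (UNIV :: (real^'n^'k) set)"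
  have O: "open ?O" "?z \<in> ?O" using x y by (auto intro: open_Times)
  have inv: "?J' (?\<phi> x) ** J x = mat 1" if "x \<in> ?Ox" for x
    using that jacobian_inverse[OF sA c(2,1)] transition_chart[OF atlas_inj[OF sA c(1)], of _ c']
    by (auto simp: J_def)
  have Tz: "?T ?z = jet_coord c' d' j"
    using jet_coord_change[OF M E jj(1) c(1) jj(2) c(2) jj(3) d(1) jj(4) d(2) jj(5)] phi_x
    by (simp add: K_def x_def y_def)
  have "((\<lambda>z. K (fst (snd z)) ** snd (snd z)) has_derivative
      (\<lambda>h. ?T ?z ** frechet_derivative J (at x) (fst h) + R h ** J x)) (at ?z)"
  proof (rule has_derivative_transform_within_open[OF _ O])
    show "((\<lambda>z. ?T z ** J (fst z)) has_derivative
      (\<lambda>h. ?T ?z ** frechet_derivative J (at x) (fst h) + R h ** J x)) (at ?z)"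
      using has_derivative_matrix_mult[OF R Jz] by simp
    fix z assume "z \<in> ?O"
    then show "?T z ** J (fst z) = K (fst (snd z)) ** snd (snd z)"
      using inv[of "fst z"] by (auto simp: matrix_mul_assoc[symmetric])
  qed
  note unique = has_derivative_unique[OF this has_derivative_matrix_mult[OF Kz pr(3)]]
  have "?T ?z ** frechet_derivative J (at x) (fst h) + R h ** J x =
      K y ** snd (snd h) + frechet_derivative K (at y) (fst (snd h)) ** jet_coord c d j" for h
    using fun_cong[OF unique, of h] by simp
  then have Req: "R (dx, du, dU) ** J x =
      frechet_derivative K (at y) du ** jet_coord c d j + K y ** dU -
      jet_coord c' d' j ** frechet_derivative J (at x) dx" for dx du dU
    unfolding Tz by (metis (no_types, lifting) add.commute add_diff_cancel_left' fst_conv snd_conv)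
  have "((\<lambda>z. (?\<phi> (fst z), ?\<psi> (fst (snd z)), ?T z)) has_derivative
      (\<lambda>h. (J x *v fst h, K y *v fst (snd h), R h))) (at ?z)"
    by (intro has_derivative_Pair \<phi>z \<psi>z R)
  then have "(transition (jet_chart M E c d) (jet_chart M E c' d') has_derivative
      (\<lambda>h. (J x *v fst h, K y *v fst (snd h), R h))) (at ?z)"
  proof (rule has_derivative_transform_within_open[OF _ O])
    fix z assume "z \<in> ?O"
    then show "(?\<phi> (fst z), ?\<psi> (fst (snd z)), ?T z) =
        transition (jet_chart M E c d) (jet_chart M E c' d') z"
      using jet_transition[OF c d, of "fst z" "fst (snd z)" "snd (snd z)"]
      by (auto simp: K_def)
  qed
  then show ?thesis
    unfolding z using Req by (intro exI[of _ R]) (simp add: case_prod_unfold)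
qed

lemma jet_atlas_differentiable: "differentiable_atlas (jet_atlas M E)"
proof -
  note sA = manifold_atlas[OF M] and tA = manifold_atlas[OF E]
  have "open (snd (jet_chart M E c d) ` (fst (jet_chart M E c d) \<inter> fst (jet_chart M E c' d')))"
    if "c \<in> M" "d \<in> E" "c' \<in> M" "d' \<in> E" for c d c' d'
    unfolding jet_chart_overlap_image[OF that]
    by (intro open_Times open_UNIV atlas_open[OF sA] atlas_open[OF tA] that)
  moreover have "transition (jet_chart M E c d) (jet_chart M E c' d') differentiable
      (at (snd (jet_chart M E c d) j))"
    if "c \<in> M" "d \<in> E" "c' \<in> M" "d' \<in> E"
      "j \<in> fst (jet_chart M E c d)" "j \<in> fst (jet_chart M E c' d')" for c d c' d' j
    using jet_transition_has_derivative[OF that(1,3,2,4,5,6)] unfolding differentiable_def by blast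
  ultimately show ?thesis
    unfolding differentiable_atlas_def jet_atlas_def
    by (intro conjI ballI; (elim CollectE exE conjE)?; (elim IntE)?) (simp_all add: jet_chart_inj)
qed

end

section \<open>The connection on the jet bundle\<close>

text \<open>The index sums of the horizontal projection collected into matrix products, so that its
  compatibility with transition maps becomes an identity between matrices.\<close>
definition jet_horizontal ::
  "('p, real^'n) chart set \<Rightarrow> ('q, real^'k) chart set \<Rightarrow>
   ('p, real^'n) cov_deriv \<Rightarrow> ('q, real^'k) cov_deriv \<Rightarrow>
   ('p, real^'n) chart \<Rightarrow> ('q, real^'k) chart \<Rightarrow> ('p, 'q) jet \<Rightarrow>
   (real^'n) \<times> (real^'k) \<times> (real^'n^'k) \<Rightarrow> (real^'n) \<times> (real^'k) \<times> (real^'n^'k)"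
  where "jet_horizontal M E \<Theta> \<Gamma> c d j = (\<lambda>(dx, du, dU).
    (dx, du, jet_coord c d j ** connection_matrix M \<Theta> c (fst j) dx -
      connection_matrix E \<Gamma> d (jet_target j) du ** jet_coord c d j))"

lemma horizontal_matrix_entries:
  "(\<chi> C h.
      (\<Sum>l\<in>UNIV. dx $ l * (\<Sum>x\<in>UNIV. christoffel M \<Theta> c p l x h * U $ C $ x)) -
      (\<Sum>B\<in>UNIV. du $ B * (\<Sum>A\<in>UNIV. christoffel E \<Gamma> d y B C A * U $ A $ h))) =
    U ** connection_matrix M \<Theta> c p dx - connection_matrix E \<Gamma> d y du ** U"
proof -
  have "(\<Sum>l\<in>UNIV. dx $ l * (\<Sum>x\<in>UNIV. christoffel M \<Theta> c p l x h * U $ C $ x)) =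
      (U ** connection_matrix M \<Theta> c p dx) $ C $ h" for C h
    unfolding matrix_matrix_mult_def connection_matrix_def
    by (simp add: sum_distrib_left mult_ac) (rule sum.swap)
  moreover have "(\<Sum>B\<in>UNIV. du $ B * (\<Sum>A\<in>UNIV. christoffel E \<Gamma> d y B C A * U $ A $ h)) =
      (connection_matrix E \<Gamma> d y du ** U) $ C $ h" for C h
    unfolding matrix_matrix_mult_def connection_matrix_def
    by (simp add: sum_distrib_left sum_distrib_right mult_ac) (rule sum.swap)
  ultimately show ?thesis by (simp add: vec_eq_iff)
qed

text \<open>The inhomogeneous terms \<open>dJ\<close> and \<open>dK\<close> in the transformation laws of the two connections cancel
  those that come from differentiating \<open>U' ** J = K ** U\<close>.\<close>
lemma horizontal_cocycle_algebra:
  fixes U U' :: "real^'n^'k" and J T T' :: "real^'n^'n" and K G G' :: "real^'k^'k"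
  assumes T: "T' ** J = J ** T - dJ" and G: "G' ** K = K ** G - dK" and U: "U' ** J = K ** U"
  shows "(U' ** T' - G' ** U') ** J = dK ** U + K ** (U ** T - G ** U) - U' ** dJ"
proof -
  have "(U' ** T' - G' ** U') ** J = U' ** (T' ** J) - G' ** (U' ** J)"
    by (simp only: matrix_mult_simps)
  also have "\<dots> = (U' ** J) ** T - U' ** dJ - (G' ** K) ** U"
    unfolding T U by (simp only: matrix_mult_simps U)
  also have "\<dots> = K ** U ** T - U' ** dJ - (K ** G ** U - dK ** U)"
    unfolding G U by (simp only: matrix_mult_simps)
  also have "\<dots> = dK ** U + (K ** U ** T - K ** G ** U) - U' ** dJ"
    by (simp only: diff_diff_eq2 add_diff_eq diff_add_eq diff_diff_eq add.commute)
  also have "\<dots> = dK ** U + K ** (U ** T - G ** U) - U' ** dJ"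
    by (simp only: matrix_mult_simps)
  finally show ?thesis .
qed
context
  fixes M :: "('p, real^'n) chart set" and E :: "('q, real^'k) chart set"
    and \<Theta> :: "('p, real^'n) cov_deriv" and \<Gamma> :: "('q, real^'k) cov_deriv"
  assumes M: "smooth_manifold M" and E: "smooth_manifold E"
    and \<Gamma>: "linear_connection E \<Gamma>" and \<Theta>: "linear_connection M \<Theta>"
begin

text \<open>The last components are compared after multiplication by the invertible Jacobian \<open>J x\<close>, the form
  in which the derivative of the transition map is known.\<close>
lemma jet_horizontal_change_chart:
  assumes c: "c \<in> M" "c' \<in> M" and d: "d \<in> E" "d' \<in> E"
    and j: "j \<in> fst (jet_chart M E c d)" "j \<in> fst (jet_chart M E c' d')"
  shows "dtrans (jet_chart M E c d) (jet_chart M E c' d') j (jet_horizontal M E \<Theta> \<Gamma> c d j v) =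
    jet_horizontal M E \<Theta> \<Gamma> c' d' j (dtrans (jet_chart M E c d) (jet_chart M E c' d') j v)"
proof -
  note sA = manifold_atlas[OF M]
  define J where "J = jacobian_field (transition c c')"
  define K where "K = jacobian_field (transition d d')"
  define x where "x = snd c (fst j)"
  define y where "y = snd d (jet_target j)"
  define U U' where "U = jet_coord c d j" and "U' = jet_coord c' d' j"
  obtain dx du dU where v: "v = (dx, du, dU)" by (cases v)
  have jj: "j \<in> jet_bundle M E" "fst j \<in> fst c" "fst j \<in> fst c'" "jet_target j \<in> fst d"
      "jet_target j \<in> fst d'"
    using j by (auto simp: in_jet_chart_iff)
  have "\<exists>R. (transition (jet_chart M E c d) (jet_chart M E c' d') has_derivative
      (\<lambda>(dx, du, dU). (J x *v dx, K y *v du, R (dx, du, dU)))) (at (snd (jet_chart M E c d) j)) \<and>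
    (\<forall>dx du dU. R (dx, du, dU) ** J x =
      frechet_derivative K (at y) du ** U + K y ** dU - U' ** frechet_derivative J (at x) dx)"
    unfolding J_def K_def x_def y_def U_def U'_def
    by (rule jet_transition_has_derivative[OF M E c d j])
  then obtain R where R_prop: "(transition (jet_chart M E c d) (jet_chart M E c' d') has_derivative
      (\<lambda>(dx, du, dU). (J x *v dx, K y *v du, R (dx, du, dU)))) (at (snd (jet_chart M E c d) j)) \<and>
    (\<forall>dx du dU. R (dx, du, dU) ** J x =
      frechet_derivative K (at y) du ** U + K y ** dU - U' ** frechet_derivative J (at x) dx)" ..
  note R = conjunct1[OF R_prop] and RJ = conjunct2[OF R_prop, rule_format]
  let ?T = "connection_matrix M \<Theta> c (fst j) dx" and ?G = "connection_matrix E \<Gamma> d (jet_target j) du"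
  let ?T' = "connection_matrix M \<Theta> c' (fst j) (J x *v dx)"
  let ?G' = "connection_matrix E \<Gamma> d' (jet_target j) (K y *v du)"
  have T: "?T' ** J x = J x ** ?T - frechet_derivative J (at x) dx"
    using connection_matrix_transformation[OF M \<Theta> c(1) jj(2) c(2) jj(3), of dx]
    by (simp add: J_def x_def)
  have G: "?G' ** K y = K y ** ?G - frechet_derivative K (at y) du"
    using connection_matrix_transformation[OF E \<Gamma> d(1) jj(4) d(2) jj(5), of du]
    by (simp add: K_def y_def)
  have inv: "J x ** jacobian_field (transition c' c) (snd c' (fst j)) = mat 1"
    "jacobian_field (transition c' c) (snd c' (fst j)) ** J x = mat 1"
    using jacobian_inverse[OF sA c jj(2,3)] jacobian_inverse[OF sA c(2,1) jj(3,2)]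
    by (simp_all add: J_def x_def)
  have U: "U' ** J x = K y ** U"
    using jet_coord_change[OF M E jj(1) c(1) jj(2) c(2) jj(3) d(1) jj(4) d(2) jj(5)] inv(2)
    by (simp add: U_def U'_def K_def y_def matrix_mul_assoc[symmetric])
  have "(U' ** ?T' - ?G' ** U') ** J x = R (dx, du, U ** ?T - ?G ** U) ** J x"
    unfolding RJ by (rule horizontal_cocycle_algebra[OF T G U])
  then have "R (dx, du, U ** ?T - ?G ** U) = U' ** ?T' - ?G' ** U'"
    by (rule matrix_mult_right_cancel[OF inv(1), symmetric])
  then show ?thesis
    unfolding frechet_derivative_eqI[OF R] v
    by (simp add: jet_horizontal_def U_def U'_def)
qed

text \<open>The simultaneous description of the connection in all charts has exactly one solution, by the
  compatibility just shown.\<close>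
lemma jet_connection_properties:
  assumes v: "v \<in> tangent_space (jet_atlas M E) j"
  shows "jet_connection M E \<Theta> \<Gamma> j v \<in> tangent_space (jet_atlas M E) j"
    and "\<lbrakk>c \<in> M; d \<in> E; j \<in> fst (jet_chart M E c d)\<rbrakk> \<Longrightarrow>
      jet_connection M E \<Theta> \<Gamma> j v (jet_chart M E c d) =
      jet_horizontal M E \<Theta> \<Gamma> c d j (v (jet_chart M E c d))"
proof -
  let ?X = "\<lambda>(c, d). jet_chart M E c d" and ?S = "tangent_space (jet_atlas M E) j"
  let ?F = "\<lambda>(c, d). jet_horizontal M E \<Theta> \<Gamma> c d j (v (jet_chart M E c d))"
  let ?P = "\<lambda>w. w \<in> ?S \<and> (\<forall>c\<in>M. \<forall>d\<in>E. j \<in> fst (jet_chart M E c d) \<longrightarrow>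
    w (jet_chart M E c d) = jet_horizontal M E \<Theta> \<Gamma> c d j (v (jet_chart M E c d)))"
  have jA: "differentiable_atlas (?X ` (M \<times> E))"
    using jet_atlas_differentiable[OF M E] by (simp add: jet_atlas_eq)
  obtain w where w: "w \<in> ?S" "\<And>k. k \<in> M \<times> E \<Longrightarrow> j \<in> fst (?X k) \<Longrightarrow> w (?X k) = ?F k"
  proof (rule tangent_vector_with_components[OF jA, where p = j and F = ?F])
    fix k l assume kl: "k \<in> M \<times> E" "l \<in> M \<times> E" "j \<in> fst (?X k)" "j \<in> fst (?X l)"
    obtain c d c' d' where k: "k = (c, d)" "l = (c', d')" by (cases k, cases l)
    have "v (jet_chart M E c' d') = dtrans (jet_chart M E c d) (jet_chart M E c' d') j (v (jet_chart M E c d))"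
      using kl k by (intro tangent_space_component[OF jet_atlas_differentiable[OF M E] v])
        (auto simp: jet_atlas_eq)
    then show "dtrans (?X k) (?X l) j (?F k) = ?F l"
      using jet_horizontal_change_chart[of c c' d d' j "v (jet_chart M E c d)"] kl k by simp
  qed (auto simp: jet_atlas_eq)
  have Pw: "?P w"
    using w(1) w(2)[of "(c, d)" for c d] by simp
  have unique: "w' = w''" if P: "?P w'" "?P w''" for w' w''
  proof (rule tangent_space_eq_componentsI[OF conjunct1[OF P(1)] conjunct1[OF P(2)]])
    fix C assume "C \<in> jet_atlas M E" "j \<in> fst C"
    then obtain c d where C: "C = jet_chart M E c d" "c \<in> M" "d \<in> E" "j \<in> fst (jet_chart M E c d)"
      by (auto simp: jet_atlas_def)
    show "w' C = w'' C"
      unfolding C(1) conjunct2[OF P(1), rule_format, OF C(2-4)]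
        conjunct2[OF P(2), rule_format, OF C(2-4)] ..
  qed
  have ex1: "\<exists>!w. ?P w"
    by (rule ex1I[of ?P, OF Pw unique[OF _ Pw]])
  have eq: "jet_connection M E \<Theta> \<Gamma> j v = (THE w. ?P w)"
    unfolding jet_connection_def jet_horizontal_def horizontal_matrix_entries
    by (simp only: case_prod_unfold)
  have P: "?P (jet_connection M E \<Theta> \<Gamma> j v)"
    unfolding eq by (rule theI'[OF ex1])
  then show "jet_connection M E \<Theta> \<Gamma> j v \<in> ?S" by blast
  show "jet_connection M E \<Theta> \<Gamma> j v (jet_chart M E c d) =
      jet_horizontal M E \<Theta> \<Gamma> c d j (v (jet_chart M E c d))"
    if "c \<in> M" "d \<in> E" "j \<in> fst (jet_chart M E c d)"
    using P that by blast
qed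

lemma jet_vproj_tangent:
  assumes "v \<in> tangent_space (jet_atlas M E) j"
  shows "v - jet_connection M E \<Theta> \<Gamma> j v \<in> tangent_space (jet_atlas M E) j"
  by (rule subspace_diff[OF subspace_tangent_space[OF jet_atlas_differentiable[OF M E]] assms
        jet_connection_properties(1)[OF assms]])

text \<open>The horizontal projection keeps the components along \<open>M\<close> and \<open>E\<close>, so they vanish in the difference.\<close>
lemma jet_vproj_vertical:
  assumes Y: "Y \<in> tangent_bundle (jet_atlas M E)"
  shows "jet_vproj M E \<Theta> \<Gamma> Y \<in> vertical_bundle (jet_atlas M E) (prod_atlas M E) jet_proj"
proof -
  obtain j v where jv: "Y = (j, v)" "j \<in> points (jet_atlas M E)" "v \<in> tangent_space (jet_atlas M E) j"
    using Y by (auto simp: tangent_bundle_def)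
  let ?w = "v - jet_connection M E \<Theta> \<Gamma> j v"
  note jA = jet_atlas_differentiable[OF M E]
  have w: "?w \<in> tangent_space (jet_atlas M E) j" by (rule jet_vproj_tangent[OF jv(3)])
  have "snd (tangent_map (jet_atlas M E) (prod_atlas M E) jet_proj (j, ?w)) b = 0" for b
  proof (cases "b \<in> prod_atlas M E \<and> jet_proj j \<in> fst b")
    case True
    then obtain c d where cd: "c \<in> M" "d \<in> E" "b = (fst c \<times> fst d, \<lambda>(x, y). (snd c x, snd d y))"
      by (auto simp: prod_atlas_def)
    \<comment> \<open>A chart of the product determines an adapted jet chart, in which \<open>jet_proj\<close> is a projection.\<close>
    let ?C = "jet_chart M E c d"
    obtain C where "C \<in> jet_atlas M E" "j \<in> fst C" using jv(2) by (auto simp: points_def)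
    then have "j \<in> jet_bundle M E" unfolding jet_atlas_def using in_jet_chart_iff by blast
    then have j: "j \<in> fst ?C"
      using True cd(3) by (simp add: in_jet_chart_iff jet_proj_def)
    have C: "?C \<in> jet_atlas M E" unfolding jet_atlas_def using cd(1,2) by blast
    have "(snd b \<circ> jet_proj \<circ> chart_inv ?C has_derivative (\<lambda>h. (fst h, fst (snd h)))) (at (snd ?C j))"
    proof (rule has_derivative_transform_within_open[OF _ atlas_open_image[OF jA C]])
      show "((\<lambda>z. (fst z, fst (snd z))) has_derivative (\<lambda>h. (fst h, fst (snd h)))) (at (snd ?C j))"
        by (auto intro!: derivative_eq_intros)
      show "snd ?C j \<in> snd ?C ` fst ?C" using j by simp
      fix z assume "z \<in> snd ?C ` fst ?C"
      then obtain i where "i \<in> fst ?C" "z = snd ?C i" by auto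
      then show "(fst z, fst (snd z)) = (snd b \<circ> jet_proj \<circ> chart_inv ?C) z"
        using chart_inv_chart[OF atlas_inj[OF jA C], of i]
        by (simp add: cd(3) jet_proj_def jet_chart_apply)
    qed
    then have "snd (tangent_map (jet_atlas M E) (prod_atlas M E) jet_proj (j, ?w)) b =
        (fst (?w ?C), fst (snd (?w ?C)))"
      using tangent_map_component[OF jA C j w, where f = jet_proj] True by blast
    then show ?thesis
      using jet_connection_properties(2)[OF jv(3) cd(1,2) j]
      by (simp add: jet_horizontal_def case_prod_unfold zero_prod_def)
  next
    case False
    then show ?thesis by (rule tangent_map_outside)
  qed
  then have "tangent_map (jet_atlas M E) (prod_atlas M E) jet_proj (j, ?w) = (jet_proj j, 0)"
    by (intro prod_eqI) (auto simp: fst_tangent_map fun_eq_iff)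
  then show ?thesis
    using w jv by (simp add: vertical_bundle_def tangent_bundle_def jet_vproj_def)
qed

end

section \<open>Charts of the Grassmann bundle\<close>

text \<open>The column space of \<open>U\<close> in the chart \<open>d\<close>. Coordinate planes and images of jets both have this
  form, with a graph matrix and a jet coordinate matrix respectively.\<close>
definition plane_of_matrix ::
  "('q, real^'k) chart set \<Rightarrow> ('q, real^'k) chart \<Rightarrow> 'q \<Rightarrow> real^'n^'k \<Rightarrow> ('q, real^'k) tvec set"
  where "plane_of_matrix E d y U = {v \<in> tangent_space E y. v d \<in> range ((*v) U)}"

lemma plane_of_matrix_eq_iff:
  assumes E: "differentiable_atlas E" and d: "d \<in> E" "y \<in> fst d"
  shows "plane_of_matrix E d y U = plane_of_matrix E d y V \<longleftrightarrow> range ((*v) U) = range ((*v) V)"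
proof -
  have key: "w \<in> range ((*v) U) \<longleftrightarrow> tangent_of_coords E d y w \<in> plane_of_matrix E d y U" for w U
    using tangent_of_coords_in_tangent_space[OF E d, of w] tangent_of_coords_same[OF E d, of w]
    by (simp add: plane_of_matrix_def)
  show ?thesis
  proof
    assume "plane_of_matrix E d y U = plane_of_matrix E d y V"
    then have "w \<in> range ((*v) U) \<longleftrightarrow> w \<in> range ((*v) V)" for w
      by (simp only: key)
    then show "range ((*v) U) = range ((*v) V)" by (rule set_eqI)
  qed (simp add: plane_of_matrix_def)
qed

lemma plane_of_matrix_change_chart:
  assumes E: "differentiable_atlas E" and d: "d \<in> E" "d' \<in> E" "y \<in> fst d" "y \<in> fst d'"
  shows "plane_of_matrix E d y U =
    plane_of_matrix E d' y (jacobian_field (transition d d') (snd d y) ** U)"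
proof -
  let ?K = "jacobian_field (transition d d') (snd d y)"
  let ?K' = "jacobian_field (transition d' d) (snd d' y)"
  have "v d \<in> range ((*v) U) \<longleftrightarrow> v d' \<in> range ((*v) (?K ** U))" if v: "v \<in> tangent_space E y" for v
  proof -
    have vd': "v d' = ?K *v v d"
      using tangent_space_component[OF E v d] by (simp add: dtrans_eq_jacobian[OF E d])
    have vd: "v d = ?K' *v v d'"
      using tangent_space_component[OF E v d(2,1,4,3)]
      by (simp add: dtrans_eq_jacobian[OF E d(2,1,4,3)])
    have inv: "?K' ** ?K = mat 1" by (rule jacobian_inverse[OF E d(2,1,4,3)])
    show ?thesis
    proof
      assume "v d \<in> range ((*v) U)"
      then obtain w where "v d = U *v w" by auto
      then have "v d' = (?K ** U) *v w" using vd' by (simp add: matrix_vector_mul_assoc)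
      then show "v d' \<in> range ((*v) (?K ** U))" by simp
    next
      assume "v d' \<in> range ((*v) (?K ** U))"
      then obtain w where "v d' = (?K ** U) *v w" by auto
      then have "v d = (?K' ** (?K ** U)) *v w" using vd by (simp add: matrix_vector_mul_assoc)
      then show "v d \<in> range ((*v) U)" by (simp add: matrix_mul_assoc inv)
    qed
  qed
  then show ?thesis by (auto simp: plane_of_matrix_def)
qed

context
  fixes E :: "('q, real^('n::finite + 'm::finite)) chart set"
  assumes E: "differentiable_atlas E"
begin

definition plane_basis :: "('q, real^('n + 'm)) chart \<Rightarrow> 'q \<Rightarrow> real^'n^'m \<Rightarrow> 'n \<Rightarrow> ('q, real^('n + 'm)) tvec"
  where "plane_basis d y u l = coord_field E d (Inl l) y +
    (\<Sum>j\<in>UNIV. (u $ j $ l) *\<^sub>R coord_field E d (Inr j) y)"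

lemma
  assumes d: "d \<in> E" "y \<in> fst d"
  shows plane_basis_tangent: "plane_basis d y u l \<in> tangent_space E y"
    and plane_basis_component: "plane_basis d y u l d = graph_matrix u *v axis l 1"
proof -
  have coord: "coord_field E d a y \<in> tangent_space E y" "coord_field E d a y d = axis a 1" for a
    unfolding coord_field_def
    by (rule tangent_of_coords_in_tangent_space[OF E d], rule tangent_of_coords_same[OF E d])
  show "plane_basis d y u l \<in> tangent_space E y"
    unfolding plane_basis_def using subspace_tangent_space[OF E] coord(1)
    by (intro subspace_add subspace_sum subspace_scale) auto
  have "plane_basis d y u l d $ a = graph_matrix u $ a $ l" for a
    by (cases a) (simp_all add: plane_basis_def sum_fun_apply scaleR_fun_def coord(2) graph_matrix_def
        axis_def mat_def if_distrib cong: if_cong)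
  then show "plane_basis d y u l d = graph_matrix u *v axis l 1"
    by (simp add: vec_eq_iff matrix_vector_mult_basis column_def)
qed

lemma sum_plane_basis_component:
  assumes d: "d \<in> E" "y \<in> fst d"
  shows "(\<Sum>l\<in>UNIV. (w $ l) *\<^sub>R plane_basis d y u l) d = graph_matrix u *v w"
  by (simp add: sum_fun_apply scaleR_fun_def plane_basis_component[OF d] matrix_vector_mult_basis
      matrix_mult_sum[of _ w] scalar_mult_eq_scaleR)

lemma coord_plane_eq:
  assumes d: "d \<in> E" "y \<in> fst d"
  shows "coord_plane E d y u = plane_of_matrix E d y (graph_matrix u)"
proof
  have span: "coord_plane E d y u = span (range (plane_basis d y u))"
    by (simp add: coord_plane_def plane_basis_def[abs_def])
  have "subspace (plane_of_matrix E d y (graph_matrix u))"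
  proof (rule subspaceI)
    show "0 \<in> plane_of_matrix E d y (graph_matrix u)"
      using subspace_0[OF subspace_tangent_space[OF E]] matrix_vector_mult_0_right[of "graph_matrix u"]
      by (auto simp: plane_of_matrix_def intro!: range_eqI[of _ _ 0])
    fix v w assume v: "v \<in> plane_of_matrix E d y (graph_matrix u)"
    then obtain a where a: "v d = graph_matrix u *v a" by (auto simp: plane_of_matrix_def)
    show "r *\<^sub>R v \<in> plane_of_matrix E d y (graph_matrix u)" for r
      using v subspace_scale[OF subspace_tangent_space[OF E]] a
      by (auto simp: plane_of_matrix_def scaleR_fun_def matrix_vector_mult_scaleR[symmetric])
    assume w: "w \<in> plane_of_matrix E d y (graph_matrix u)"
    then obtain b where "w d = graph_matrix u *v b" by (auto simp: plane_of_matrix_def)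
    then show "v + w \<in> plane_of_matrix E d y (graph_matrix u)"
      using v w subspace_add[OF subspace_tangent_space[OF E]] a
      by (auto simp: plane_of_matrix_def matrix_vector_right_distrib[symmetric])
  qed
  moreover have "range (plane_basis d y u) \<subseteq> plane_of_matrix E d y (graph_matrix u)"
    using plane_basis_tangent[OF d] plane_basis_component[OF d] by (auto simp: plane_of_matrix_def)
  ultimately show "coord_plane E d y u \<subseteq> plane_of_matrix E d y (graph_matrix u)"
    unfolding span by (rule span_minimal[rotated])
  show "plane_of_matrix E d y (graph_matrix u) \<subseteq> coord_plane E d y u"
  proof
    fix v assume "v \<in> plane_of_matrix E d y (graph_matrix u)"
    then obtain w where v: "v \<in> tangent_space E y" and w: "v d = graph_matrix u *v w"
      by (auto simp: plane_of_matrix_def)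
    have "v = (\<Sum>l\<in>UNIV. (w $ l) *\<^sub>R plane_basis d y u l)"
    proof (rule tangent_space_eqI[OF E v _ d])
      show "(\<Sum>l\<in>UNIV. (w $ l) *\<^sub>R plane_basis d y u l) \<in> tangent_space E y"
        using subspace_tangent_space[OF E] plane_basis_tangent[OF d]
        by (intro subspace_sum subspace_scale) auto
    qed (simp only: w sum_plane_basis_component[OF d])
    also have "\<dots> \<in> span (range (plane_basis d y u))"
      by (intro span_sum span_scale span_base rangeI)
    finally show "v \<in> coord_plane E d y u" unfolding span .
  qed
qed

text \<open>The spanning vectors have the standard basis as their first components, hence are independent.\<close>
lemma dim_coord_plane:
  assumes d: "d \<in> E" "y \<in> fst d"
  shows "dim (coord_plane E d y u) = CARD('n)"
proof -
  let ?b = "plane_basis d y u"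
  have zero: "w = 0" if "(\<Sum>l\<in>UNIV. (w $ l) *\<^sub>R ?b l) = 0" for w
  proof -
    have "graph_matrix u *v w = 0"
      using sum_plane_basis_component[OF d, of w u] that by (metis zero_fun_apply)
    then have "top_block (graph_matrix u) *v w = 0"
      by (simp add: top_block_def matrix_vector_mult_def vec_eq_iff)
    then show "w = 0" by simp
  qed
  have inj: "inj ?b"
  proof (rule injI)
    fix l k assume "?b l = ?b k"
    then have "graph_matrix u *v axis l 1 = graph_matrix u *v axis k 1"
      using plane_basis_component[OF d] by metis
    then have "top_block (graph_matrix u) *v axis l 1 = top_block (graph_matrix u) *v axis k 1"
      by (simp add: top_block_def matrix_vector_mult_def vec_eq_iff)
    then show "l = k" by (simp add: axis_eq_axis)
  qed
  have "independent (range ?b)"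
  proof (rule independent_if_scalars_zero)
    fix f x assume "(\<Sum>x\<in>range ?b. f x *\<^sub>R x) = 0" and x: "x \<in> range ?b"
    then have "(\<Sum>l\<in>UNIV. ((\<chi> l. f (?b l)) $ l) *\<^sub>R ?b l) = 0"
      by (simp add: sum.reindex[OF inj])
    from zero[OF this] show "f x = 0" using x by (auto simp: vec_eq_iff)
  qed simp
  then have "dim (range ?b) = CARD('n)"
    by (simp add: dim_eq_card_independent card_image[OF inj])
  then show ?thesis
    by (simp add: coord_plane_def plane_basis_def[abs_def])
qed

lemma coord_plane_in_grassmann_bundle:
  assumes d: "d \<in> E" "y \<in> fst d"
  shows "(y, coord_plane E d y u) \<in> grassmann_bundle CARD('n) E"
proof -
  have "y \<in> points E" using d by (auto simp: points_def)
  moreover have "coord_plane E d y u \<subseteq> tangent_space E y"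
    by (auto simp: coord_plane_eq[OF d] plane_of_matrix_def)
  moreover have "subspace (coord_plane E d y u)" by (simp add: coord_plane_def)
  ultimately show ?thesis
    using dim_coord_plane[OF d] by (simp add: grassmann_bundle_def)
qed

lemma plane_eq_coord_plane_iff:
  fixes U :: "real^'n^('n + 'm)"
  assumes d: "d \<in> E" "y \<in> fst d"
  shows "plane_of_matrix E d y U = coord_plane E d y u \<longleftrightarrow> invertible (top_block U) \<and> u = slope U"
  unfolding coord_plane_eq[OF d] plane_of_matrix_eq_iff[OF E d] by (rule range_eq_range_graph_iff)

lemma in_grassmann_chart_iff:
  assumes d: "d \<in> E"
  shows "(y, W) \<in> fst (grassmann_chart E d) \<longleftrightarrow> y \<in> fst d \<and> (\<exists>u. W = coord_plane E d y u)"
  using coord_plane_in_grassmann_bundle[OF d] by (auto simp: grassmann_chart_def)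

lemma plane_in_grassmann_chart_iff:
  fixes U :: "real^'n^('n + 'm)"
  assumes d: "d \<in> E" "y \<in> fst d"
  shows "(y, plane_of_matrix E d y U) \<in> fst (grassmann_chart E d) \<longleftrightarrow> invertible (top_block U)"
  unfolding in_grassmann_chart_iff[OF d(1)] plane_eq_coord_plane_iff[OF d] using d(2) by simp

lemma grassmann_chart_plane:
  fixes U :: "real^'n^('n + 'm)"
  assumes d: "d \<in> E" "y \<in> fst d" and "invertible (top_block U)"
  shows "snd (grassmann_chart E d) (y, plane_of_matrix E d y U) = (snd d y, slope U)"
  using plane_eq_coord_plane_iff[OF d, of U] assms(3) by (simp add: grassmann_chart_def)

lemma grassmann_chart_coord_plane:
  assumes d: "d \<in> E" "y \<in> fst d"
  shows "snd (grassmann_chart E d) (y, coord_plane E d y u) = (snd d y, u)"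
  using grassmann_chart_plane[OF d, of "graph_matrix u"]
    plane_eq_coord_plane_iff[OF d, of "graph_matrix u" "u"]
  by (simp add: coord_plane_eq[OF d] slope_def invertible_def)

lemma grassmann_chart_inj:
  assumes d: "d \<in> E"
  shows "inj_on (snd (grassmann_chart E d)) (fst (grassmann_chart E d))"
proof (rule inj_onI)
  fix \<omega> \<omega>' assume \<omega>: "\<omega> \<in> fst (grassmann_chart E d)" "\<omega>' \<in> fst (grassmann_chart E d)"
    "snd (grassmann_chart E d) \<omega> = snd (grassmann_chart E d) \<omega>'"
  obtain y u where y: "\<omega> = (y, coord_plane E d y u)" "y \<in> fst d"
    using \<omega>(1) in_grassmann_chart_iff[OF d] by (cases \<omega>) auto
  obtain y' u' where y': "\<omega>' = (y', coord_plane E d y' u')" "y' \<in> fst d"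
    using \<omega>(2) in_grassmann_chart_iff[OF d] by (cases \<omega>') auto
  show "\<omega> = \<omega>'"
    using \<omega>(3) y y' atlas_inj[OF E d] grassmann_chart_coord_plane[OF d]
    by (auto dest: inj_onD)
qed

text \<open>In another chart the plane is the column space of \<open>V\<close>, so the chart condition and the new
  coordinates are those of a column space.\<close>
lemma coord_plane_in_chart_iff:
  fixes u :: "real^'n^'m"
  assumes d: "d \<in> E" "y \<in> fst d" and d': "d' \<in> E"
  defines "V \<equiv> jacobian_field (transition d d') (snd d y) ** graph_matrix u"
  shows "(y, coord_plane E d y u) \<in> fst (grassmann_chart E d') \<longleftrightarrow>
      y \<in> fst d' \<and> invertible (top_block V)"
    and "\<lbrakk>y \<in> fst d'; invertible (top_block V)\<rbrakk> \<Longrightarrow>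
      snd (grassmann_chart E d') (y, coord_plane E d y u) = (snd d' y, slope V)"
proof -
  have eq: "coord_plane E d y u = plane_of_matrix E d' y V" if "y \<in> fst d'"
    unfolding V_def coord_plane_eq[OF d]
    by (rule plane_of_matrix_change_chart[OF E d(1) d' d(2) that])
  show "(y, coord_plane E d y u) \<in> fst (grassmann_chart E d') \<longleftrightarrow>
      y \<in> fst d' \<and> invertible (top_block V)"
  proof (cases "y \<in> fst d'")
    case True
    then show ?thesis
      unfolding eq[OF True] plane_in_grassmann_chart_iff[OF d' True] by simp
  next
    case False
    then show ?thesis by (simp add: in_grassmann_chart_iff[OF d'])
  qed
  show "snd (grassmann_chart E d') (y, coord_plane E d y u) = (snd d' y, slope V)"
    if "y \<in> fst d'" "invertible (top_block V)"
    using eq[OF that(1)] grassmann_chart_plane[OF d' that] by simp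
qed

lemma grassmann_overlap_image:
  assumes d: "d \<in> E" "d' \<in> E"
  shows "snd (grassmann_chart E d) ` (fst (grassmann_chart E d) \<inter> fst (grassmann_chart E d')) =
    {(b, u). b \<in> snd d ` (fst d \<inter> fst d') \<and>
      invertible (top_block (jacobian_field (transition d d') b ** graph_matrix u))}" (is "?L = ?R")
proof (intro equalityI subsetI)
  fix z assume "z \<in> ?L"
  then obtain y W where yW: "z = snd (grassmann_chart E d) (y, W)"
    "(y, W) \<in> fst (grassmann_chart E d)" "(y, W) \<in> fst (grassmann_chart E d')" by auto
  then obtain u where u: "y \<in> fst d" "W = coord_plane E d y u"
    using in_grassmann_chart_iff[OF d(1)] by auto
  then show "z \<in> ?R"
    using yW coord_plane_in_chart_iff(1)[OF d(1) u(1) d(2)] grassmann_chart_coord_plane[OF d(1) u(1)]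
    by auto
next
  fix z assume "z \<in> ?R"
  then obtain y u where y: "z = (snd d y, u)" "y \<in> fst d" "y \<in> fst d'"
    "invertible (top_block (jacobian_field (transition d d') (snd d y) ** graph_matrix u))" by auto
  then show "z \<in> ?L"
    using coord_plane_in_chart_iff(1)[OF d(1) y(2) d(2)] grassmann_chart_coord_plane[OF d(1) y(2)]
      in_grassmann_chart_iff[OF d(1)]
    by (intro image_eqI[of _ _ "(y, coord_plane E d y u)"]) auto
qed

lemma grassmann_transition:
  assumes d: "d \<in> E" "d' \<in> E" and b: "b \<in> snd d ` (fst d \<inter> fst d')"
    and inv: "invertible (top_block (jacobian_field (transition d d') b ** graph_matrix u))"
  shows "transition (grassmann_chart E d) (grassmann_chart E d') (b, u) =
    (transition d d' b, slope (jacobian_field (transition d d') b ** graph_matrix u))"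
proof -
  obtain y where y: "b = snd d y" "y \<in> fst d" "y \<in> fst d'" using b by auto
  have "(y, coord_plane E d y u) \<in> fst (grassmann_chart E d)"
    using in_grassmann_chart_iff[OF d(1)] y by auto
  from transition_chart[OF grassmann_chart_inj[OF d(1)] this, of "grassmann_chart E d'"]
  show ?thesis
    using grassmann_chart_coord_plane[OF d(1) y(2), of u]
      coord_plane_in_chart_iff(2)[OF d(1) y(2) d(2) y(3)] inv y(1)
      transition_chart[OF atlas_inj[OF E d(1)] y(2), of d'] by simp
qed

end

section \<open>Transition maps of the Grassmann bundle\<close>

text \<open>The vertical projection in the chart \<open>d\<close>: the expression with \<open>dot_christoffel\<close> is the vertical part
  of the connection matrix applied to the graph.\<close>
definition grassmann_vertical ::
  "('q, real^('n::finite + 'm::finite)) chart set \<Rightarrow> ('q, real^('n + 'm)) cov_deriv \<Rightarrow>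
   ('q, real^('n + 'm)) chart \<Rightarrow> 'q \<times> ('q, real^('n + 'm)) tvec set \<Rightarrow>
   (real^('n + 'm)) \<times> (real^'n^'m) \<Rightarrow> (real^('n + 'm)) \<times> (real^'n^'m)"
  where "grassmann_vertical E \<Gamma> d \<omega> = (\<lambda>(du, dul).
    (0, dul + vertical_part (snd (snd (grassmann_chart E d) \<omega>))
      (connection_matrix E \<Gamma> d (fst \<omega>) du ** graph_matrix (snd (snd (grassmann_chart E d) \<omega>)))))"

lemma dot_christoffel_entries:
  fixes u dul :: "real^'n::finite^'m::finite" and du :: "real^('n + 'm)"
  shows "(\<chi> k x. dul $ k $ x +
      (\<Sum>A\<in>UNIV. dot_christoffel (christoffel E \<Gamma> d y) u A k x * du $ A)) =
    dul + vertical_part u (connection_matrix E \<Gamma> d y du ** graph_matrix u)"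
proof -
  define g where "g = (\<lambda>x A a. christoffel E \<Gamma> d y A a (Inl x) +
    (\<Sum>i\<in>UNIV. christoffel E \<Gamma> d y A a (Inr i) * u $ i $ x))"
  have split: "(\<Sum>B\<in>UNIV. f B) = (\<Sum>l\<in>UNIV. f (Inl l)) + (\<Sum>i\<in>UNIV. f (Inr i))"
    for f :: "'n + 'm \<Rightarrow> real"
    using sum.Plus[of "UNIV :: 'n set" "UNIV :: 'm set" f] by (simp add: o_def)
  have Z: "(connection_matrix E \<Gamma> d y du ** graph_matrix u) $ a $ x =
      (\<Sum>A\<in>UNIV. du $ A * g x A a)" for a x
  proof -
    have "(connection_matrix E \<Gamma> d y du ** graph_matrix u) $ a $ x =
        connection_matrix E \<Gamma> d y du $ a $ Inl x +
        (\<Sum>i\<in>UNIV. connection_matrix E \<Gamma> d y du $ a $ Inr i * u $ i $ x)"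
      by (simp add: matrix_matrix_mult_def split graph_matrix_def mat_def if_distrib cong: if_cong)
    also have "(\<Sum>i\<in>UNIV. connection_matrix E \<Gamma> d y du $ a $ Inr i * u $ i $ x) =
        (\<Sum>A\<in>UNIV. du $ A * (\<Sum>i\<in>UNIV. christoffel E \<Gamma> d y A a (Inr i) * u $ i $ x))"
      unfolding connection_matrix_def
      by (simp add: sum_distrib_left sum_distrib_right mult.assoc) (rule sum.swap)
    finally show ?thesis
      by (simp add: connection_matrix_def g_def distrib_left sum.distrib)
  qed
  have "(\<Sum>A\<in>UNIV. dot_christoffel (christoffel E \<Gamma> d y) u A k x * du $ A) =
      vertical_part u (connection_matrix E \<Gamma> d y du ** graph_matrix u) $ k $ x" for k x
  proof -
    have dot: "dot_christoffel (christoffel E \<Gamma> d y) u A k x =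
        g x A (Inr k) - (\<Sum>b\<in>UNIV. u $ k $ b * g x A (Inl b))" for A
      by (simp add: dot_christoffel_def g_def)
    have "(\<Sum>A\<in>UNIV. dot_christoffel (christoffel E \<Gamma> d y) u A k x * du $ A) =
        (\<Sum>A\<in>UNIV. du $ A * g x A (Inr k)) - (\<Sum>A\<in>UNIV. \<Sum>b\<in>UNIV. u $ k $ b * (du $ A * g x A (Inl b)))"
      by (simp add: dot right_diff_distrib sum_subtractf sum_distrib_left mult_ac)
    also have "(\<Sum>A\<in>UNIV. \<Sum>b\<in>UNIV. u $ k $ b * (du $ A * g x A (Inl b))) =
        (\<Sum>b\<in>UNIV. u $ k $ b * (\<Sum>A\<in>UNIV. du $ A * g x A (Inl b)))"
      unfolding sum_distrib_left by (rule sum.swap)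
    also have "(\<Sum>A\<in>UNIV. du $ A * g x A (Inr k)) -
        (\<Sum>b\<in>UNIV. u $ k $ b * (\<Sum>A\<in>UNIV. du $ A * g x A (Inl b))) =
        vertical_part u (connection_matrix E \<Gamma> d y du ** graph_matrix u) $ k $ x"
      unfolding Z[symmetric]
      by (simp add: vertical_part_def top_block_def bottom_block_def matrix_matrix_mult_def)
    finally show ?thesis .
  qed
  then show ?thesis by (simp add: vec_eq_iff)
qed

text \<open>In the image of a vertical vector under the transition, \<open>K\<close> applied to a lifted vertical part may be
  replaced by \<open>K\<close> applied to the matrix itself, since the correction has columns in the new plane. The
  term with \<open>dK\<close> from the transformation law is then the one in the derivative of the transition.\<close>
lemma grassmann_cocycle_algebra:
  fixes u :: "real^'n::finite^'m::finite" and V :: "real^'n^('n + 'm)"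
  assumes V: "V = K ** graph_matrix u" and inv: "invertible (top_block V)"
    and G: "K ** G = dK + G' ** K"
  shows "vertical_part (slope V) (K ** vertical_lift (w + vertical_part u (G ** graph_matrix u))) **
      matrix_inv (top_block V) =
    vertical_part (slope V) (dK ** graph_matrix u + K ** vertical_lift w) ** matrix_inv (top_block V) +
    vertical_part (slope V) (G' ** graph_matrix (slope V))"
proof -
  let ?s = "slope V" and ?Pi = "matrix_inv (top_block V)"
  note lin = linear_add[OF bounded_linear.linear[OF bounded_linear_vertical_part]]
    linear_diff[OF bounded_linear.linear[OF bounded_linear_vertical_part]]
  have Vs: "V = graph_matrix ?s ** top_block V" by (rule graph_matrix_slope[OF inv])
  have 0: "vertical_part ?s (V ** X) = 0" for X :: "real^'n^'n"
    by (subst Vs) (simp add: vertical_part_mult matrix_mult_simps)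
  have "K ** vertical_lift (w + vertical_part u (G ** graph_matrix u)) =
      K ** vertical_lift w + (K ** G ** graph_matrix u - V ** top_block (G ** graph_matrix u))"
    unfolding linear_add[OF bounded_linear.linear[OF bounded_linear_vertical_lift]]
      vertical_lift_vertical_part V
    by (simp only: matrix_mult_simps)
  also have "K ** G ** graph_matrix u = dK ** graph_matrix u + G' ** V"
    unfolding G V by (simp only: matrix_mult_simps)
  finally have "vertical_part ?s (K ** vertical_lift (w + vertical_part u (G ** graph_matrix u))) =
      vertical_part ?s (dK ** graph_matrix u + K ** vertical_lift w) + vertical_part ?s (G' ** V)"
    by (simp only: lin 0) simp
  moreover have "vertical_part ?s (G' ** V) ** ?Pi = vertical_part ?s (G' ** graph_matrix ?s)"
  proof -
    have "G' ** V = (G' ** graph_matrix ?s) ** top_block V"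
      using arg_cong[OF Vs, of "\<lambda>X. G' ** X"] by (simp only: matrix_mul_assoc)
    then have "vertical_part ?s (G' ** V) = vertical_part ?s (G' ** graph_matrix ?s) ** top_block V"
      by (simp only: vertical_part_mult)
    then show ?thesis
      by (simp add: matrix_mul_assoc[symmetric] matrix_inv_eq(1)[OF inv])
  qed
  ultimately show ?thesis by (simp only: matrix_mult_simps)
qed

context
  fixes E :: "('q, real^('n::finite + 'm::finite)) chart set"
  assumes E: "smooth_manifold E"
begin

lemma plane_transition_has_derivative:
  fixes u :: "real^'n^'m"
  assumes d: "d \<in> E" "d' \<in> E" and b: "b \<in> snd d ` (fst d \<inter> fst d')"
  defines "K \<equiv> jacobian_field (transition d d')"
  shows "((\<lambda>z. K (fst z) ** graph_matrix (snd z)) has_derivative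
    (\<lambda>h. K b ** vertical_lift (snd h) + frechet_derivative K (at b) (fst h) ** graph_matrix u))
    (at (b, u))"
proof -
  have sE: "smooth_atlas E" and dE: "differentiable_atlas E"
    by (rule manifold_smooth_atlas[OF E], rule manifold_atlas[OF E])
  have K: "(K has_derivative frechet_derivative K (at b)) (at b)"
    unfolding K_def using sE d b atlas_open[OF dE d]
    by (intro jacobian_has_derivative[of "snd d ` (fst d \<inter> fst d')"]) (auto simp: smooth_atlas_def)
  have pr: "((\<lambda>z :: (real^('n + 'm)) \<times> (real^'n^'m). fst z) has_derivative fst) (at (b, u))"
    "((\<lambda>z :: (real^('n + 'm)) \<times> (real^'n^'m). snd z) has_derivative snd) (at (b, u))"
    by (auto intro!: derivative_eq_intros)
  have Kz: "((\<lambda>z. K (fst z)) has_derivative (\<lambda>h. frechet_derivative K (at b) (fst h))) (at (b, u))"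
    using has_derivative_compose[OF pr(1), of K] K by simp
  have Gz: "((\<lambda>z. graph_matrix (snd z)) has_derivative (\<lambda>h. vertical_lift (snd h))) (at (b, u))"
    by (rule has_derivative_compose[OF pr(2) graph_matrix_has_derivative])
  show ?thesis
    using has_derivative_matrix_mult[OF Kz Gz] by simp
qed

lemma grassmann_overlap_open:
  assumes d: "d \<in> E" "d' \<in> E"
  shows "open (snd (grassmann_chart E d) ` (fst (grassmann_chart E d) \<inter> fst (grassmann_chart E d')))"
proof -
  have dE: "differentiable_atlas E"
    by (rule manifold_atlas[OF E])
  let ?O = "(snd d ` (fst d \<inter> fst d')) \<times> (UNIV :: (real^'n^'m) set)"
  let ?h = "\<lambda>z. top_block (jacobian_field (transition d d') (fst z) ** graph_matrix (snd z))"
  have "?h differentiable (at z)" if z: "z \<in> ?O" for z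
  proof -
    obtain b u where "z = (b, u)" "b \<in> snd d ` (fst d \<inter> fst d')" using z by auto
    then show ?thesis
      using bounded_linear.has_derivative[OF bounded_linear_top_block
          plane_transition_has_derivative[OF d, of b u]]
      unfolding differentiable_def by blast
  qed
  then have "continuous_on ?O ?h"
    by (intro differentiable_imp_continuous_on) (auto simp: differentiable_on_def intro: differentiable_at_withinI)
  then have "open (?O \<inter> ?h -` {P. invertible P})"
    by (intro continuous_open_preimage open_Times open_UNIV open_invertible atlas_open[OF dE d])
  moreover have "?O \<inter> ?h -` {P. invertible P} =
      snd (grassmann_chart E d) ` (fst (grassmann_chart E d) \<inter> fst (grassmann_chart E d'))"
    unfolding grassmann_overlap_image[OF dE d] by auto
  ultimately show ?thesis by simp
qed

text \<open>The transition takes \<open>u\<close> to the slope of the matrix \<open>K b ** graph_matrix u\<close>, so its derivative is that of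
  the slope composed with the product rule.\<close>
lemma grassmann_transition_has_derivative:
  fixes u :: "real^'n^'m"
  assumes d: "d \<in> E" "d' \<in> E" and b: "b \<in> snd d ` (fst d \<inter> fst d')"
  defines "K \<equiv> jacobian_field (transition d d')"
  assumes inv: "invertible (top_block (K b ** graph_matrix u))"
  shows "(transition (grassmann_chart E d) (grassmann_chart E d') has_derivative
    (\<lambda>(du, dul). (K b *v du,
      vertical_part (slope (K b ** graph_matrix u))
        (frechet_derivative K (at b) du ** graph_matrix u + K b ** vertical_lift dul) **
      matrix_inv (top_block (K b ** graph_matrix u))))) (at (b, u))"
proof -
  have dE: "differentiable_atlas E"
    by (rule manifold_atlas[OF E])
  let ?V = "K b ** graph_matrix u" and ?DK = "frechet_derivative K (at b)"
  let ?O = "snd (grassmann_chart E d) ` (fst (grassmann_chart E d) \<inter> fst (grassmann_chart E d'))"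
  have O: "(b, u) \<in> ?O" using b inv by (simp add: grassmann_overlap_image[OF dE d] K_def)
  obtain y where y: "b = snd d y" "y \<in> fst d" "y \<in> fst d'" using b by auto
  have T: "(transition d d' has_derivative (*v) (K b)) (at (fst (b, u)))"
    using transition_has_derivative[OF dE d y(2,3)] dtrans_eq_jacobian[OF dE d y(2,3)]
    by (simp add: K_def y(1))
  have \<psi>: "((\<lambda>z. transition d d' (fst z)) has_derivative (\<lambda>h. K b *v fst h)) (at (b, u))"
    by (rule has_derivative_compose[OF has_derivative_fst[OF has_derivative_ident] T])
  have h: "((\<lambda>z. K (fst z) ** graph_matrix (snd z)) has_derivative
      (\<lambda>h. K b ** vertical_lift (snd h) + ?DK (fst h) ** graph_matrix u)) (at (b, u))"
    unfolding K_def by (rule plane_transition_has_derivative[OF d b])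
  have "(slope has_derivative (\<lambda>H. vertical_part (slope ?V) H ** matrix_inv (top_block ?V)))
      (at (K (fst (b, u)) ** graph_matrix (snd (b, u))))"
    using slope_has_derivative[OF inv] by simp
  from has_derivative_Pair[OF \<psi> has_derivative_compose[OF h this]]
  have "((\<lambda>z. (transition d d' (fst z), slope (K (fst z) ** graph_matrix (snd z)))) has_derivative
    (\<lambda>h. (K b *v fst h, vertical_part (slope ?V) (K b ** vertical_lift (snd h) +
      ?DK (fst h) ** graph_matrix u) ** matrix_inv (top_block ?V)))) (at (b, u))" .
  then have "(transition (grassmann_chart E d) (grassmann_chart E d') has_derivative
    (\<lambda>h. (K b *v fst h, vertical_part (slope ?V) (K b ** vertical_lift (snd h) +
      ?DK (fst h) ** graph_matrix u) ** matrix_inv (top_block ?V)))) (at (b, u))"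
  proof (rule has_derivative_transform_within_open[OF _ grassmann_overlap_open[OF d] O])
    fix z assume "z \<in> ?O"
    then have "fst z \<in> snd d ` (fst d \<inter> fst d')" "invertible (top_block (K (fst z) ** graph_matrix (snd z)))"
      unfolding grassmann_overlap_image[OF dE d] by (auto simp: K_def)
    then show "(transition d d' (fst z), slope (K (fst z) ** graph_matrix (snd z))) =
        transition (grassmann_chart E d) (grassmann_chart E d') z"
      using grassmann_transition[OF dE d, of "fst z" "snd z"] by (simp add: K_def)
  qed
  then show ?thesis by (simp add: case_prod_unfold add.commute)
qed

lemma grassmann_overlap_coordinates:
  assumes d: "d \<in> E" "d' \<in> E"
    and \<omega>: "\<omega> \<in> fst (grassmann_chart E d)" "\<omega> \<in> fst (grassmann_chart E d')"
  obtains y u where "fst \<omega> = y" "y \<in> fst d" "y \<in> fst d'" "snd (grassmann_chart E d) \<omega> = (snd d y, u)"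
    "invertible (top_block (jacobian_field (transition d d') (snd d y) ** graph_matrix u))"
    "snd (grassmann_chart E d') \<omega> =
      (snd d' y, slope (jacobian_field (transition d d') (snd d y) ** graph_matrix u))"
proof -
  have dE: "differentiable_atlas E"
    by (rule manifold_atlas[OF E])
  obtain y W where yW: "\<omega> = (y, W)" by (cases \<omega>)
  obtain u where u: "y \<in> fst d" "W = coord_plane E d y u"
    using \<omega>(1) in_grassmann_chart_iff[OF dE d(1)] yW by auto
  note inv = coord_plane_in_chart_iff[OF dE d(1) u(1) d(2), of u]
  show thesis
    using that[of y u] u yW \<omega>(2) inv grassmann_chart_coord_plane[OF dE d(1) u(1), of u] by simp
qed

lemma grassmann_atlas_differentiable: "differentiable_atlas (grassmann_atlas E)"
proof -
  have dE: "differentiable_atlas E"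
    by (rule manifold_atlas[OF E])
  have "transition (grassmann_chart E d) (grassmann_chart E d') differentiable
      (at (snd (grassmann_chart E d) \<omega>))"
    if d: "d \<in> E" "d' \<in> E" and \<omega>: "\<omega> \<in> fst (grassmann_chart E d)" "\<omega> \<in> fst (grassmann_chart E d')"
    for d d' \<omega>
  proof -
    obtain y u where "fst \<omega> = y" "y \<in> fst d" "y \<in> fst d'" "snd (grassmann_chart E d) \<omega> = (snd d y, u)"
      "invertible (top_block (jacobian_field (transition d d') (snd d y) ** graph_matrix u))"
      by (rule grassmann_overlap_coordinates[OF d \<omega>])
    then show ?thesis
      using grassmann_transition_has_derivative[OF d, of "snd d y" u] unfolding differentiable_def by auto
  qed
  then show ?thesis
    unfolding differentiable_atlas_def grassmann_atlas_def
    using grassmann_chart_inj[OF dE] grassmann_overlap_open by simp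
qed

end

section \<open>The connection on the Grassmann bundle and the quotient map\<close>

context
  fixes E :: "('q, real^('n::finite + 'm::finite)) chart set"
    and \<Gamma> :: "('q, real^('n + 'm)) cov_deriv"
  assumes E: "smooth_manifold E" and \<Gamma>: "linear_connection E \<Gamma>"
begin

lemma grassmann_vertical_change_chart:
  assumes d: "d \<in> E" "d' \<in> E"
    and \<omega>: "\<omega> \<in> fst (grassmann_chart E d)" "\<omega> \<in> fst (grassmann_chart E d')"
  shows "dtrans (grassmann_chart E d) (grassmann_chart E d') \<omega> (grassmann_vertical E \<Gamma> d \<omega> v) =
    grassmann_vertical E \<Gamma> d' \<omega> (dtrans (grassmann_chart E d) (grassmann_chart E d') \<omega> v)"
proof -
  define K where "K = jacobian_field (transition d d')"
  obtain du dul where v: "v = (du, dul)" by (cases v)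
  obtain y u where y: "fst \<omega> = y" "y \<in> fst d" "y \<in> fst d'"
      and u: "snd (grassmann_chart E d) \<omega> = (snd d y, u)"
      and inv: "invertible (top_block (K (snd d y) ** graph_matrix u))"
      and u': "snd (grassmann_chart E d') \<omega> = (snd d' y, slope (K (snd d y) ** graph_matrix u))"
    unfolding K_def by (rule grassmann_overlap_coordinates[OF E d \<omega>])
  let ?b = "snd d y"
  let ?V = "K ?b ** graph_matrix u" and ?DK = "frechet_derivative K (at ?b)"
  let ?G = "connection_matrix E \<Gamma> d y du" and ?G' = "connection_matrix E \<Gamma> d' y (K ?b *v du)"
  have b: "?b \<in> snd d ` (fst d \<inter> fst d')" using y by auto
  have tr: "(transition (grassmann_chart E d) (grassmann_chart E d') has_derivative
    (\<lambda>(du, dul). (K ?b *v du, vertical_part (slope ?V) (?DK du ** graph_matrix u +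
      K ?b ** vertical_lift dul) ** matrix_inv (top_block ?V)))) (at (?b, u))"
    using grassmann_transition_has_derivative[OF E d b, of u] inv unfolding K_def by simp
  note D = frechet_derivative_eqI[OF tr]
  have law: "K ?b ** ?G = ?DK du + ?G' ** K ?b"
    using connection_matrix_transformation[OF E \<Gamma> d(1) y(2) d(2) y(3), of du] by (simp add: K_def)
  have sE: "smooth_atlas E" and dE: "differentiable_atlas E"
    by (rule manifold_smooth_atlas[OF E], rule manifold_atlas[OF E])
  have "(K has_derivative ?DK) (at ?b)"
    unfolding K_def using sE d b atlas_open[OF dE d]
    by (intro jacobian_has_derivative[of "snd d ` (fst d \<inter> fst d')"]) (auto simp: smooth_atlas_def)
  then have DK0: "?DK 0 = 0" by (rule linear_0[OF has_derivative_linear])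
  show ?thesis
    unfolding D v grassmann_vertical_def y(1) u u' prod.case snd_conv
    by (simp only: DK0 matrix_mult_simps(7) add_0_left matrix_vector_mult_0_right
        grassmann_cocycle_algebra[OF refl inv law, of dul])
qed

lemma grassmann_vproj_properties:
  assumes v: "v \<in> tangent_space (grassmann_atlas E) \<omega>"
  shows "fst (grassmann_vproj E \<Gamma> (\<omega>, v)) = \<omega>"
    and "snd (grassmann_vproj E \<Gamma> (\<omega>, v)) \<in> tangent_space (grassmann_atlas E) \<omega>"
    and "\<lbrakk>d \<in> E; \<omega> \<in> fst (grassmann_chart E d)\<rbrakk> \<Longrightarrow>
      snd (grassmann_vproj E \<Gamma> (\<omega>, v)) (grassmann_chart E d) =
      grassmann_vertical E \<Gamma> d \<omega> (v (grassmann_chart E d))"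
proof -
  let ?S = "tangent_space (grassmann_atlas E) \<omega>"
  let ?F = "\<lambda>d. grassmann_vertical E \<Gamma> d \<omega> (v (grassmann_chart E d))"
  let ?P = "\<lambda>w. w \<in> ?S \<and> (\<forall>d\<in>E. \<omega> \<in> fst (grassmann_chart E d) \<longrightarrow> w (grassmann_chart E d) = ?F d)"
  note gA = grassmann_atlas_differentiable[OF E]
  obtain w where w: "w \<in> ?S" "\<And>d. d \<in> E \<Longrightarrow> \<omega> \<in> fst (grassmann_chart E d) \<Longrightarrow>
      w (grassmann_chart E d) = ?F d"
  proof (rule tangent_vector_with_components[OF gA[unfolded grassmann_atlas_def],
        where p = \<omega> and F = ?F])
    fix d d' assume d: "d \<in> E" "d' \<in> E"
      and \<omega>: "\<omega> \<in> fst (grassmann_chart E d)" "\<omega> \<in> fst (grassmann_chart E d')"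
    have "v (grassmann_chart E d') =
        dtrans (grassmann_chart E d) (grassmann_chart E d') \<omega> (v (grassmann_chart E d))"
      using d \<omega> by (intro tangent_space_component[OF gA v]) (simp_all add: grassmann_atlas_def)
    then show "dtrans (grassmann_chart E d) (grassmann_chart E d') \<omega> (?F d) = ?F d'"
      using grassmann_vertical_change_chart[OF d \<omega>, of "v (grassmann_chart E d)"] by simp
  qed (auto simp: grassmann_atlas_def)
  have Pw: "?P w" using w by blast
  have unique: "w' = w''" if P: "?P w'" "?P w''" for w' w''
  proof (rule tangent_space_eq_componentsI[OF conjunct1[OF P(1)] conjunct1[OF P(2)]])
    fix C assume "C \<in> grassmann_atlas E" "\<omega> \<in> fst C"
    then obtain d where C: "C = grassmann_chart E d" "d \<in> E" "\<omega> \<in> fst (grassmann_chart E d)"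
      unfolding grassmann_atlas_def by blast
    show "w' C = w'' C"
      unfolding C(1) conjunct2[OF P(1), rule_format, OF C(2,3)]
        conjunct2[OF P(2), rule_format, OF C(2,3)] ..
  qed
  have ex1: "\<exists>!w. ?P w"
    by (rule ex1I[of ?P, OF Pw unique[OF _ Pw]])
  have eq: "grassmann_vproj E \<Gamma> (\<omega>, v) = (\<omega>, THE w. ?P w)"
    unfolding grassmann_vproj_def grassmann_vertical_def dot_christoffel_entries
    by (simp only: case_prod_unfold fst_conv snd_conv)
  show "fst (grassmann_vproj E \<Gamma> (\<omega>, v)) = \<omega>" by (simp add: eq)
  have P: "?P (snd (grassmann_vproj E \<Gamma> (\<omega>, v)))"
    unfolding eq snd_conv by (rule theI'[OF ex1])
  show "snd (grassmann_vproj E \<Gamma> (\<omega>, v)) \<in> ?S" by (rule conjunct1[OF P])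
  show "snd (grassmann_vproj E \<Gamma> (\<omega>, v)) (grassmann_chart E d) = ?F d"
    if "d \<in> E" "\<omega> \<in> fst (grassmann_chart E d)"
    by (rule conjunct2[OF P, rule_format, OF that])
qed

lemma grassmann_vproj_vertical:
  assumes Z: "Z \<in> tangent_bundle (grassmann_atlas E)"
  shows "grassmann_vproj E \<Gamma> Z \<in> vertical_bundle (grassmann_atlas E) E fst"
proof -
  obtain \<omega> v where \<omega>v: "Z = (\<omega>, v)" "\<omega> \<in> points (grassmann_atlas E)"
      "v \<in> tangent_space (grassmann_atlas E) \<omega>"
    using Z by (auto simp: tangent_bundle_def)
  note gA = grassmann_atlas_differentiable[OF E] and props = grassmann_vproj_properties[OF \<omega>v(3)]
  have dE: "differentiable_atlas E"
    by (rule manifold_atlas[OF E])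
  define w where "w = snd (grassmann_vproj E \<Gamma> (\<omega>, v))"
  have eq: "grassmann_vproj E \<Gamma> Z = (\<omega>, w)"
    using props(1) by (simp add: \<omega>v(1) w_def prod_eq_iff)
  obtain d where d: "d \<in> E" "\<omega> \<in> fst (grassmann_chart E d)"
    using \<omega>v(2) by (auto simp: points_def grassmann_atlas_def)
  let ?C = "grassmann_chart E d"
  have C: "?C \<in> grassmann_atlas E" using d by (simp add: grassmann_atlas_def)
  have wC: "fst (w ?C) = 0"
    using props(3)[OF d] by (simp add: w_def grassmann_vertical_def case_prod_unfold)
  have coord: "fst \<omega>' \<in> fst d \<and> fst (snd ?C \<omega>') = snd d (fst \<omega>')" if "\<omega>' \<in> fst ?C" for \<omega>'
    using that by (auto simp: grassmann_chart_def)
  have "snd (tangent_map (grassmann_atlas E) E fst (\<omega>, w)) e = 0" for e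
  proof (cases "e \<in> E \<and> fst \<omega> \<in> fst e")
    case True
    then have e: "e \<in> E" "fst \<omega> \<in> fst e" by auto
    have y: "fst \<omega> \<in> fst d" using coord[OF d(2)] by simp
    have T: "(transition d e has_derivative dtrans d e (fst \<omega>)) (at (fst (snd ?C \<omega>)))"
      using transition_has_derivative[OF dE d(1) e(1) y e(2)] coord[OF d(2)] by simp
    have "(snd e \<circ> fst \<circ> chart_inv ?C has_derivative (\<lambda>h. dtrans d e (fst \<omega>) (fst h)))
        (at (snd ?C \<omega>))"
    proof (rule has_derivative_transform_within_open[OF _ atlas_open_image[OF gA C]])
      show "((\<lambda>z. transition d e (fst z)) has_derivative (\<lambda>h. dtrans d e (fst \<omega>) (fst h)))
          (at (snd ?C \<omega>))"
        by (rule has_derivative_compose[OF has_derivative_fst[OF has_derivative_ident] T])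
      show "snd ?C \<omega> \<in> snd ?C ` fst ?C" using d by simp
      fix z assume "z \<in> snd ?C ` fst ?C"
      then obtain \<omega>' where \<omega>': "\<omega>' \<in> fst ?C" "z = snd ?C \<omega>'" by auto
      then show "transition d e (fst z) = (snd e \<circ> fst \<circ> chart_inv ?C) z"
        using chart_inv_chart[OF atlas_inj[OF gA C] \<omega>'(1)] coord[OF \<omega>'(1)]
          transition_chart[OF atlas_inj[OF dE d(1)], of "fst \<omega>'" e] by simp
    qed
    then have "snd (tangent_map (grassmann_atlas E) E fst (\<omega>, w)) e = dtrans d e (fst \<omega>) (fst (w ?C))"
      using tangent_map_component[where f = fst, OF gA C d(2) _ e] props(2) by (simp add: w_def)
    then show ?thesis
      by (simp add: wC linear_0[OF linear_dtrans[OF dE d(1) e(1) y e(2)]])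
  next
    case False
    then show ?thesis by (rule tangent_map_outside)
  qed
  then have "tangent_map (grassmann_atlas E) E fst (\<omega>, w) = (fst \<omega>, 0)"
    by (intro prod_eqI) (auto simp: fst_tangent_map fun_eq_iff)
  then show ?thesis
    unfolding eq using props(2) \<omega>v(2)
    by (simp add: vertical_bundle_def tangent_bundle_def w_def[symmetric])
qed

end

lemma jet_plane_eq:
  fixes M :: "('p, real^'n) chart set" and E :: "('q, real^'k) chart set"
  assumes M: "smooth_manifold M" and E: "smooth_manifold E"
    and c: "c \<in> M" and d: "d \<in> E" and j: "j \<in> fst (jet_chart M E c d)"
  shows "jet_plane M E j = (jet_target j, plane_of_matrix E d (jet_target j) (jet_coord c d j))"
proof -
  note sA = manifold_atlas[OF M] and tA = manifold_atlas[OF E]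
  have jj: "j \<in> jet_bundle M E" "fst j \<in> fst c" "jet_target j \<in> fst d"
    using j by (simp_all add: in_jet_chart_iff)
  note map = jet_map_properties[OF M E jj(1) _ c jj(2) d jj(3)]
  have "jet_map M E j ` tangent_space M (fst j) = plane_of_matrix E d (jet_target j) (jet_coord c d j)"
  proof (intro equalityI subsetI)
    fix w assume "w \<in> jet_map M E j ` tangent_space M (fst j)"
    then show "w \<in> plane_of_matrix E d (jet_target j) (jet_coord c d j)"
      using map by (auto simp: plane_of_matrix_def)
  next
    fix w assume "w \<in> plane_of_matrix E d (jet_target j) (jet_coord c d j)"
    then obtain \<xi> where w: "w \<in> tangent_space E (jet_target j)" "w d = jet_coord c d j *v \<xi>"
      by (auto simp: plane_of_matrix_def)
    define v where "v = tangent_of_coords M c (fst j) \<xi>"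
    have v: "v \<in> tangent_space M (fst j)" "v c = \<xi>"
      unfolding v_def by (rule tangent_of_coords_in_tangent_space[OF sA c jj(2)],
          rule tangent_of_coords_same[OF sA c jj(2)])
    have "w = jet_map M E j v"
      by (rule tangent_space_eqI[OF tA w(1) map(2)[OF v(1)] d jj(3)]) (simp add: w(2) map(1)[OF v(1)] v(2))
    then show "w \<in> jet_map M E j ` tangent_space M (fst j)" using v(1) by blast
  qed
  then show ?thesis by (simp add: jet_plane_def)
qed

context
  fixes M :: "('p, real^'n::finite) chart set"
    and E :: "('q, real^('n + 'm::finite)) chart set"
  assumes M: "smooth_manifold M" and E: "smooth_manifold E"
begin

lemma jet_plane_in_grassmann_chart_iff:
  assumes c: "c \<in> M" and d: "d \<in> E" and j: "j \<in> fst (jet_chart M E c d)"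
  shows "jet_plane M E j \<in> fst (grassmann_chart E d) \<longleftrightarrow> invertible (top_block (jet_coord c d j))"
    and "invertible (top_block (jet_coord c d j)) \<Longrightarrow>
      snd (grassmann_chart E d) (jet_plane M E j) = (snd d (jet_target j), slope (jet_coord c d j))"
  using plane_in_grassmann_chart_iff[OF manifold_atlas[OF E] d, of "jet_target j" "jet_coord c d j"]
    grassmann_chart_plane[OF manifold_atlas[OF E] d, of "jet_target j" "jet_coord c d j"] j
  unfolding jet_plane_eq[OF M E c d j] in_jet_chart_iff by blast+

text \<open>In adapted charts \<open>jet_plane\<close> is \<open>(x, u, U) \<mapsto> (u, slope U)\<close>, and it stays in the Grassmann chart
  nearby because invertibility of the upper block is an open condition.\<close>
lemma jet_plane_local:
  assumes c: "c \<in> M" and d: "d \<in> E" and j: "j \<in> fst (jet_chart M E c d)"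
    and plane: "jet_plane M E j \<in> fst (grassmann_chart E d)"
  defines "U \<equiv> jet_coord c d j"
  shows "(snd (grassmann_chart E d) \<circ> jet_plane M E \<circ> chart_inv (jet_chart M E c d) has_derivative
      (\<lambda>(dx, du, dU). (du, vertical_part (slope U) dU ** matrix_inv (top_block U))))
      (at (snd (jet_chart M E c d) j))"
    and "\<forall>\<^sub>F z in nhds (snd (jet_chart M E c d) j).
      jet_plane M E (chart_inv (jet_chart M E c d) z) \<in> fst (grassmann_chart E d)"
proof -
  let ?C = "jet_chart M E c d"
  have C: "?C \<in> jet_atlas M E" unfolding jet_atlas_def using c d by blast
  note jA = jet_atlas_differentiable[OF M E]
  let ?O = "snd ?C ` fst ?C \<inter> (\<lambda>z. top_block (snd (snd z))) -` {P. invertible P}"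
  have inv: "invertible (top_block U)"
    using plane jet_plane_in_grassmann_chart_iff(1)[OF c d j] by (simp add: U_def)
  have zj: "snd ?C j = (snd c (fst j), snd d (jet_target j), U)"
    by (simp add: jet_chart_apply U_def)
  have "continuous_on UNIV (\<lambda>z :: (real^'n) \<times> (real^('n + 'm)) \<times> (real^'n^('n + 'm)). top_block (snd (snd z)))"
    by (intro continuous_on_compose2[OF linear_continuous_on[OF bounded_linear_top_block]]
        continuous_on_snd continuous_on_id) auto
  then have O: "open ?O"
    by (intro open_Int atlas_open_image[OF jA C] open_vimage[OF open_invertible])
  have jO: "snd ?C j \<in> ?O" using imageI[OF j, of "snd ?C"] inv by (simp add: zj)
  have plane_z: "jet_plane M E (chart_inv ?C z) \<in> fst (grassmann_chart E d) \<and>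
      snd (grassmann_chart E d) (jet_plane M E (chart_inv ?C z)) = (fst (snd z), slope (snd (snd z)))"
    if z: "z \<in> ?O" for z
  proof -
    obtain i where i: "z = snd ?C i" "i \<in> fst ?C" using z by auto
    have "chart_inv ?C z = i" using chart_inv_chart[OF atlas_inj[OF jA C] i(2)] i(1) by simp
    moreover have "invertible (top_block (jet_coord c d i))"
      using z i(1) by (simp add: jet_chart_apply)
    ultimately show ?thesis
      using jet_plane_in_grassmann_chart_iff[OF c d i(2)] i(1) by (simp add: jet_chart_apply)
  qed
  show "\<forall>\<^sub>F z in nhds (snd ?C j). jet_plane M E (chart_inv ?C z) \<in> fst (grassmann_chart E d)"
    using eventually_nhds_in_open[OF O jO] by (rule eventually_mono) (use plane_z in blast)
  have S: "(slope has_derivative (\<lambda>H. vertical_part (slope U) H ** matrix_inv (top_block U)))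
      (at (snd (snd (snd ?C j))))"
    using slope_has_derivative[OF inv] zj by simp
  have "((\<lambda>z. (fst (snd z), slope (snd (snd z)))) has_derivative
      (\<lambda>h. (fst (snd h), vertical_part (slope U) (snd (snd h)) ** matrix_inv (top_block U))))
      (at (snd ?C j))"
    by (intro has_derivative_Pair has_derivative_fst has_derivative_snd has_derivative_ident
        has_derivative_compose[where f = "\<lambda>z. snd (snd z)", OF _ S])
  from has_derivative_transform_within_open[OF this O jO]
  show "(snd (grassmann_chart E d) \<circ> jet_plane M E \<circ> chart_inv ?C has_derivative
      (\<lambda>(dx, du, dU). (du, vertical_part (slope U) dU ** matrix_inv (top_block U))))
      (at (snd ?C j))"
    using plane_z by (simp add: case_prod_unfold)
qed

text \<open>For a Grassmann chart that comes from \<open>d\<close>, the formula holds in the jet charts with the same \<open>d\<close>, since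
  only there \<open>jet_plane\<close> has the simple local form.\<close>
lemma tangent_map_jet_plane:
  assumes j: "j \<in> points (jet_atlas M E)" and v: "v \<in> tangent_space (jet_atlas M E) j"
  shows "snd (tangent_map (jet_atlas M E) (grassmann_atlas E) (jet_plane M E) (j, v)) \<in>
      tangent_space (grassmann_atlas E) (jet_plane M E j)"
    and "\<lbrakk>c \<in> M; d \<in> E; j \<in> fst (jet_chart M E c d); jet_plane M E j \<in> fst (grassmann_chart E d)\<rbrakk> \<Longrightarrow>
      snd (tangent_map (jet_atlas M E) (grassmann_atlas E) (jet_plane M E) (j, v)) (grassmann_chart E d) =
      (fst (snd (v (jet_chart M E c d))),
       vertical_part (slope (jet_coord c d j)) (snd (snd (v (jet_chart M E c d)))) **
         matrix_inv (top_block (jet_coord c d j)))"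
proof -
  note jA = jet_atlas_differentiable[OF M E] and gA = grassmann_atlas_differentiable[OF E]
  have jet_charts: "jet_chart M E c d \<in> jet_atlas M E" if "c \<in> M" "d \<in> E" for c d
    unfolding jet_atlas_def using that by blast
  obtain C where "C \<in> jet_atlas M E" "j \<in> fst C" using j by (auto simp: points_def)
  then obtain c0 d0 where C0: "c0 \<in> M" "d0 \<in> E" "j \<in> fst (jet_chart M E c0 d0)"
    unfolding jet_atlas_def by blast
  then have jj: "j \<in> jet_bundle M E" "fst j \<in> fst c0" by (simp_all add: in_jet_chart_iff)
  let ?C0 = "jet_chart M E c0 d0"
  have chart: "j \<in> fst (jet_chart M E c0 d)"
    if "d \<in> E" "jet_plane M E j \<in> fst (grassmann_chart E d)" for d
    using that jj by (auto simp: in_jet_chart_iff jet_plane_def grassmann_chart_def)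
  have obtain_d: "\<exists>d\<in>E. D = grassmann_chart E d" if "D \<in> grassmann_atlas E" for D
    using that by (auto simp: grassmann_atlas_def)
  show "snd (tangent_map (jet_atlas M E) (grassmann_atlas E) (jet_plane M E) (j, v)) \<in>
      tangent_space (grassmann_atlas E) (jet_plane M E j)"
  proof (rule tangent_map_in_tangent_space[OF jA gA jet_charts[OF C0(1,2)] C0(3) v])
    fix D assume "D \<in> grassmann_atlas E" and plane: "jet_plane M E j \<in> fst D"
    then obtain d where d: "d \<in> E" "D = grassmann_chart E d" using obtain_d by blast
    \<comment> \<open>The jet chart adapted to \<open>d\<close> depends on \<open>d\<close>; its local expression is carried over to one fixed chart.\<close>
    note j_d = chart[OF d(1) plane[unfolded d(2)]]
    note loc = jet_plane_local[OF C0(1) d(1) j_d plane[unfolded d(2)]]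
    note chg = jet_charts[OF C0(1,2)] jet_charts[OF C0(1) d(1)] C0(3) j_d
    show "snd D \<circ> jet_plane M E \<circ> chart_inv ?C0 differentiable (at (snd ?C0 j))"
      using has_derivative_change_chart[OF jA chg loc(1)]
      unfolding d(2) differentiable_def by blast
    show "\<forall>\<^sub>F z in nhds (snd ?C0 j). jet_plane M E (chart_inv ?C0 z) \<in> fst D"
      unfolding d(2)
      by (rule eventually_change_chart[OF jA chg, where P = "\<lambda>i. jet_plane M E i \<in> fst (grassmann_chart E d)"])
        (rule loc(2))
  qed
  assume c: "c \<in> M" and d: "d \<in> E" and jc: "j \<in> fst (jet_chart M E c d)"
    and plane: "jet_plane M E j \<in> fst (grassmann_chart E d)"
  have D: "grassmann_chart E d \<in> grassmann_atlas E" using d by (simp add: grassmann_atlas_def)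
  from tangent_map_component[OF jA jet_charts[OF c d] jc v D plane jet_plane_local(1)[OF c d jc plane]]
  show "snd (tangent_map (jet_atlas M E) (grassmann_atlas E) (jet_plane M E) (j, v)) (grassmann_chart E d) =
      (fst (snd (v (jet_chart M E c d))),
       vertical_part (slope (jet_coord c d j)) (snd (snd (v (jet_chart M E c d)))) **
         matrix_inv (top_block (jet_coord c d j)))"
    by (simp add: case_prod_unfold)
qed

end

text \<open>The heart of the matter. The columns of \<open>U ** T\<close> lie in the plane spanned by \<open>U\<close>, so the connection on
  \<open>M\<close> leaves no trace; and \<open>G ** U\<close> is \<open>G\<close> applied to the graph times the upper block of \<open>U\<close>, which
  the inverse cancels.\<close>
lemma quotient_algebra:
  fixes U :: "real^'n::finite^('n + 'm::finite)"
  assumes inv: "invertible (top_block U)"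
  shows "vertical_part (slope U) (dU - (U ** T - G ** U)) ** matrix_inv (top_block U) =
    vertical_part (slope U) dU ** matrix_inv (top_block U) +
    vertical_part (slope U) (G ** graph_matrix (slope U))"
proof -
  let ?s = "slope U" and ?Pi = "matrix_inv (top_block U)"
  note lin = linear_add[OF bounded_linear.linear[OF bounded_linear_vertical_part]]
    linear_diff[OF bounded_linear.linear[OF bounded_linear_vertical_part]]
  have Us: "U = graph_matrix ?s ** top_block U" by (rule graph_matrix_slope[OF inv])
  have 0: "vertical_part ?s (U ** T) = 0"
    by (subst Us) (simp add: vertical_part_mult matrix_mult_simps)
  have "G ** U = (G ** graph_matrix ?s) ** top_block U"
    using arg_cong[OF Us, of "\<lambda>X. G ** X"] by (simp only: matrix_mul_assoc)
  then have "vertical_part ?s (G ** U) = vertical_part ?s (G ** graph_matrix ?s) ** top_block U"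
    by (simp only: vertical_part_mult)
  then have "vertical_part ?s (G ** U) ** ?Pi = vertical_part ?s (G ** graph_matrix ?s)"
    by (simp add: matrix_mul_assoc[symmetric] matrix_inv_eq(1)[OF inv])
  then show ?thesis
    by (simp add: lin 0 matrix_mult_simps(1-4))
qed

theorem theorem7:
  fixes M :: "('p, real^'n) chart set"
    and E :: "('q, real^('n::finite + 'm::finite)) chart set"
    and \<Theta> :: "('p, real^'n) cov_deriv"
    and \<Gamma> :: "('q, real^('n + 'm)) cov_deriv"
  assumes "smooth_manifold M" and "smooth_manifold E"
    and "linear_connection E \<Gamma>" and "torsion_free E \<Gamma>"
    and "linear_connection M \<Theta>" and "torsion_free M \<Theta>"
  shows "(\<forall>Y \<in> tangent_bundle (jet_atlas M E).
            jet_vproj M E \<Theta> \<Gamma> Y \<in> vertical_bundle (jet_atlas M E) (prod_atlas M E) jet_proj) \<and>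
         (\<forall>Z \<in> tangent_bundle (grassmann_atlas E).
            grassmann_vproj E \<Gamma> Z \<in> vertical_bundle (grassmann_atlas E) E fst) \<and>
         (\<forall>Y \<in> imm_tangent_bundle M E.
            tangent_map (jet_atlas M E) (grassmann_atlas E) (jet_plane M E) (jet_vproj M E \<Theta> \<Gamma> Y) =
            grassmann_vproj E \<Gamma>
              (tangent_map (jet_atlas M E) (grassmann_atlas E) (jet_plane M E) Y))"
proof (intro conjI ballI)
  note M = assms(1) and E = assms(2) and \<Gamma> = assms(3) and \<Theta> = assms(5)
  show "jet_vproj M E \<Theta> \<Gamma> Y \<in> vertical_bundle (jet_atlas M E) (prod_atlas M E) jet_proj"
    if "Y \<in> tangent_bundle (jet_atlas M E)" for Y
    by (rule jet_vproj_vertical[OF M E \<Gamma> \<Theta> that])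
  show "grassmann_vproj E \<Gamma> Z \<in> vertical_bundle (grassmann_atlas E) E fst"
    if "Z \<in> tangent_bundle (grassmann_atlas E)" for Z
    by (rule grassmann_vproj_vertical[OF E \<Gamma> that])
  fix Y assume "Y \<in> imm_tangent_bundle M E"
  then obtain j v where Y: "Y = (j, v)" and j: "j \<in> points (jet_atlas M E)"
      and v: "v \<in> tangent_space (jet_atlas M E) j"
    by (auto simp: imm_tangent_bundle_def tangent_bundle_def)
  let ?T = "tangent_map (jet_atlas M E) (grassmann_atlas E) (jet_plane M E)"
  let ?\<omega> = "jet_plane M E j"
  define w where "w = v - jet_connection M E \<Theta> \<Gamma> j v"
  have w: "w \<in> tangent_space (jet_atlas M E) j"
    unfolding w_def by (rule jet_vproj_tangent[OF M E \<Gamma> \<Theta> v])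
  note Tv = tangent_map_jet_plane[OF M E j v] and Tw = tangent_map_jet_plane[OF M E j w]
  have TY: "?T Y = (?\<omega>, snd (?T (j, v)))"
    by (simp add: Y prod_eq_iff fst_tangent_map)
  note proj = grassmann_vproj_properties[OF E \<Gamma> Tv(1)]
  have "snd (?T (j, w)) = snd (grassmann_vproj E \<Gamma> (?\<omega>, snd (?T (j, v))))"
  proof (rule tangent_space_eq_componentsI[OF Tw(1) proj(2)])
    fix D assume "D \<in> grassmann_atlas E" and plane: "?\<omega> \<in> fst D"
    then obtain d where d: "d \<in> E" "D = grassmann_chart E d" by (auto simp: grassmann_atlas_def)
    note plane = plane[unfolded d(2)]
    obtain C where "C \<in> jet_atlas M E" "j \<in> fst C" using j by (auto simp: points_def)
    then obtain c d0 where c: "c \<in> M" "j \<in> fst (jet_chart M E c d0)"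
      unfolding jet_atlas_def by blast
    then have jc: "j \<in> fst (jet_chart M E c d)"
      using plane by (auto simp: in_jet_chart_iff jet_plane_def grassmann_chart_def)
    note inv = plane[unfolded jet_plane_in_grassmann_chart_iff(1)[OF M E c(1) d(1) jc]]
    let ?C = "jet_chart M E c d" and ?U = "jet_coord c d j"
    obtain dx du dU where vC: "v ?C = (dx, du, dU)" by (cases "v ?C")
    have wC: "w ?C = (0, 0, dU - (?U ** connection_matrix M \<Theta> c (fst j) dx -
        connection_matrix E \<Gamma> d (jet_target j) du ** ?U))"
      using jet_connection_properties(2)[OF M E \<Gamma> \<Theta> v c(1) d(1) jc]
      by (simp add: w_def vC jet_horizontal_def)
    have "snd (grassmann_vproj E \<Gamma> (?\<omega>, snd (?T (j, v)))) (grassmann_chart E d) =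
        grassmann_vertical E \<Gamma> d ?\<omega> (du, vertical_part (slope ?U) dU ** matrix_inv (top_block ?U))"
      using proj(3)[OF d(1) plane] Tv(2)[OF c(1) d(1) jc plane] by (simp add: vC)
    also have "\<dots> = snd (?T (j, w)) (grassmann_chart E d)"
      unfolding Tw(2)[OF c(1) d(1) jc plane] wC grassmann_vertical_def
        jet_plane_in_grassmann_chart_iff(2)[OF M E c(1) d(1) jc inv]
      by (simp add: quotient_algebra[OF inv] jet_plane_def)
    finally show "snd (?T (j, w)) D = snd (grassmann_vproj E \<Gamma> (?\<omega>, snd (?T (j, v)))) D"
      by (simp add: d(2))
  qed
  then show "?T (jet_vproj M E \<Theta> \<Gamma> Y) = grassmann_vproj E \<Gamma> (?T Y)"
    unfolding TY using proj(1) by (simp add: Y jet_vproj_def w_def[symmetric] prod_eq_iff fst_tangent_map)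
qed

end
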